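(* Let $m\ge2$, $\lambda_1,\dots,\lambda_m>0$ and $\mu>\lambda_1+\dots+\lambda_m$. Then the distribution $F_{m,\lambda_1,\dots,\lambda_m}$ (defined in the context) is a fixed point for a $./M/1$ queue with service rate $\mu$: if $\underline{A}$ is an $m$-type arrival process with distribution $F_{m,\lambda_1,\dots,\lambda_m}$ and $S_\mu$ is an independent Poisson process on $\mathbb{R}$ of rate $\mu$, then the $m$-type departure process $D(\underline{A},S_\mu)$ has distribution $F_{m,\lambda_1,\dots,\lambda_m}$.
   Context: **Continuous-time queue.** Processes are random locally finite point configurations on $\mathbb{R}$, identified with their counting measures. Given an arrival process $A$ and a simple service process $S$, an arrival increases the queue length by 1; at each point of $S$ one customer departs if the queue is non-empty, and otherwise that point is an unused service. The queue is run from time $-\infty$: the departure process $D(A,S)$ consists of those points $t$ of $S$ such that $\sup_{s\le t}\{A([s,t])-S([s,t))\}\ge1$ (arrivals at a given time precede the service at that time), and the unused service process is $U=S-D(A,S)$. **Multi-type queue.** An $m$-type arrival process is $\underline{A}=(A^{=1},\dots,A^{=m})$; lower class number means higher priority. Put $A^{\le r}=\sum_{i=1}^rA^{=i}$. The $m$-type departure process $D(\underline{A},S)=(D^{=1},\dots,D^{=m})$ is defined by $D^{\le r}=D(A^{\le r},S)$, $D^{\le0}=0$, $D^{=r}=D^{\le r}-D^{\le r-1}$. The unused service process is $S-D^{\le m}$. **The distributions $F_m=F_{m,\lambda_1,\dots,\lambda_m}$.** $F_{1,\lambda_1}$ is the law of a Poisson process on $\mathbb{R}$ of rate $\lambda_1$.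 For $m\ge2$, let $\underline{A}$ have law $F_{m-1,\lambda_1,\dots,\lambda_{m-1}}$, and let $S$ be an independent Poisson process of rate $\lambda_1+\dots+\lambda_m$. Let $(D^{=1},\dots,D^{=m-1})=D(\underline{A},S)$ and $U=S-D^{\le m-1}$. Then $F_m$ is the law of the $m$-type process $(D^{=1},\dots,D^{=m-1},U)$; that is, unused services are identified as $m$th-type customers. *)

theory Defs
  imports "HOL-Probability.Probability"
begin

section \<open>Point configurations on the real line\<close>

text \<open>
  A point configuration is represented by its multiplicity function: \<open>x t\<close> is the number of
  points at time \<open>t\<close>, i.e. the mass of the counting measure at \<open>t\<close>.
\<close>

type_synonym config = "real \<Rightarrow> nat"

definition locally_finite :: "config \<Rightarrow> bool" where
  "locally_finite x \<longleftrightarrow> (\<forall>a b. finite {t \<in> {a..b}. x t \<noteq> 0})"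

text \<open>
  \<open>npts x B\<close> is the mass that the counting measure of \<open>x\<close> gives to \<open>B\<close>. It is used only for
  bounded \<open>B\<close> and locally finite \<open>x\<close>, where the sum is over a finite set.
\<close>

definition npts :: "config \<Rightarrow> real set \<Rightarrow> nat" where
  "npts x B = (\<Sum>t\<in>{t \<in> B. x t \<noteq> 0}. x t)"

text \<open>
  The usual \<open>\<sigma>\<close>-algebra on configurations, generated by the counts of bounded intervals
  (equivalently, by the counts of all bounded Borel sets).
\<close>

definition config_space :: "config measure" where
  "config_space = sigma {x. locally_finite x}
     {{x. locally_finite x \<and> npts x {a<..b} = n} | a b n. True}"

text \<open>
  The law of a Poisson process on \<open>\<real>\<close> with constant rate \<open>r > 0\<close>: Poisson counts on intervals
  and independent increments.
\<close>

definition poisson_process_law :: "real \<Rightarrow> config measure \<Rightarrow> bool" where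
  "poisson_process_law r P \<longleftrightarrow>
     prob_space P \<and> sets P = sets config_space \<and>
     (\<forall>a b. a < b \<longrightarrow>
        distr P (count_space UNIV) (\<lambda>x. npts x {a<..b}) = measure_pmf (poisson_pmf (r * (b - a)))) \<and>
     (\<forall>t :: nat \<Rightarrow> real. strict_mono t \<longrightarrow>
        prob_space.indep_vars P (\<lambda>_. count_space UNIV) (\<lambda>i x. npts x {t i<..t (Suc i)}) UNIV)"


section \<open>The queue\<close>

text \<open>
  The supremum is taken in the extended reals since it may be infinite. The service configuration
  is meant to be simple, so that a departure point has multiplicity one.
\<close>

definition departures :: "config \<Rightarrow> config \<Rightarrow> config" where
  "departures A S t = of_bool (S t \<noteq> 0 \<and>
     (SUP s\<in>{..t}. ereal (real (npts A {s..t}) - real (npts S {s..<t}))) \<ge> 1)"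


section \<open>Multi-type queues\<close>

text \<open>
  An \<open>m\<close>-type configuration assigns to each class \<open>i \<in> {1..m}\<close> its configuration; as an element of
  the product space it is \<open>undefined\<close> outside \<open>{1..m}\<close>.
\<close>

type_synonym mt_config = "nat \<Rightarrow> config"

definition mt_space :: "nat \<Rightarrow> mt_config measure" where
  "mt_space m = (\<Pi>\<^sub>M i\<in>{1..m}. config_space)"

definition class_le :: "mt_config \<Rightarrow> nat \<Rightarrow> config" where
  "class_le A r = (\<lambda>t. \<Sum>i = 1..r. A i t)"

definition departures_le :: "mt_config \<Rightarrow> config \<Rightarrow> nat \<Rightarrow> config" where
  "departures_le A S r = (if r = 0 then (\<lambda>t. 0) else departures (class_le A r) S)"

text \<open>
  The subtractions of natural numbers below do not truncate: \<open>departures\<close> is monotone in the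
  arrival configuration and pointwise bounded by the service configuration.
\<close>

definition departures_eq :: "mt_config \<Rightarrow> config \<Rightarrow> nat \<Rightarrow> config" where
  "departures_eq A S r = (\<lambda>t. departures_le A S r t - departures_le A S (r - 1) t)"

definition mt_departures :: "nat \<Rightarrow> mt_config \<Rightarrow> config \<Rightarrow> mt_config" where
  "mt_departures m A S = (\<lambda>r\<in>{1..m}. departures_eq A S r)"

definition mt_unused :: "nat \<Rightarrow> mt_config \<Rightarrow> config \<Rightarrow> config" where
  "mt_unused m A S = (\<lambda>t. S t - departures_le A S m t)"


section \<open>The multi-type laws\<close>

text \<open>
  \<open>F_law lam m P\<close> states that \<open>P\<close> is the law \<open>F\<close> with \<open>m\<close> types and parameters
  \<open>lam 1, ..., lam m\<close>. The product measure \<open>Q \<Otimes>\<^sub>M R\<close> is the joint law of the arrival process and an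
  independent service process; the last class of the new process consists of the unused services.
\<close>

inductive F_law :: "(nat \<Rightarrow> real) \<Rightarrow> nat \<Rightarrow> mt_config measure \<Rightarrow> bool" for lam where
  F_law_1: "poisson_process_law (lam 1) R \<Longrightarrow>
     F_law lam 1 (distr R (mt_space 1) (\<lambda>x. \<lambda>i\<in>{1..1}. x))"
| F_law_Suc: "F_law lam m Q \<Longrightarrow> poisson_process_law (\<Sum>i = 1..Suc m. lam i) R \<Longrightarrow>
     F_law lam (Suc m)
       (distr (Q \<Otimes>\<^sub>M R) (mt_space (Suc m))
          (\<lambda>(A, S). (mt_departures m A S)(Suc m := mt_unused m A S)))"

end

(*
  Every class boundary of F_m is the output of a chain of single-type queues, so appending one more
  server with Poisson services amounts to moving that server to the front of the chain. Two facts
  allow this. Write d = D(a, s) and r = a + s - d (departures and "arrivals or unused services").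

  Interchange: D(D(X, a), s) = D(D(X, r), d) for every arrival process X whenever a and s are simple,
  disjoint and the queue (a, s) is stable. This is pathwise. For X without points before some time,
  an invariant relating the queue lengths of both tandems is preserved at every point;
  the general case follows by letting that time tend to minus infinity.

  Burke: if a and s are independent Poisson processes of rates lambda < mu, then (d, r) has the same
  law as (a, s). Cut [-j, j] into finer and finer slots. As long as every slot contains at most one
  point, one step of the queue started with a geometric length is a weight-preserving bijection
  between (length, slot) and (slot of (d, r), new length). Borel-Cantelli makes all slots
  good eventually, and the negative drift couples the queue started at -j with the stationary one.

  With F_{m+1} = G(F_m, a), where G records the departures and the unused services, these two facts
  say that feeding G(A, a) into s gives G(D(A, r), d), and the theorem follows by induction on m.
*)
theory Submission
  imports Defs
begin

section \<open>Counting measures of point configurations\<close>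

text \<open>The process r comes from time reversal. This predicts that d and r are independent with
  the old rates although both are built from one pair. The induction needs this joint statement: r
  becomes the server of rate mu in front and has to be independent of the server d behind it.

  The queue (a, s) takes a server as its arrival process.

  Queues that run from minus infinity have no first point at which an induction could begin. In the
  probabilistic part the true length at -j is a function of the whole past; a geometric length of
  ratio lambda/mu, the equilibrium law of the queue, takes its place, and both starts are forgotten
  before the first time that is observed.\<close>

declare neq0_conv [simp del]

lemma locally_finiteD: "locally_finite x \<Longrightarrow> finite {t \<in> {a..b}. x t \<noteq> 0}"
  by (auto simp: locally_finite_def)

lemma locally_finite_finite:
  assumes "locally_finite x" "B \<subseteq> {a..b}"
  shows "finite {t \<in> B. x t \<noteq> 0}"
  by (rule finite_subset[OF _ locally_finiteD[OF assms(1), of a b]]) (use assms(2) in auto)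

lemma locally_finite_add:
  assumes "locally_finite x" "locally_finite y"
  shows "locally_finite (\<lambda>t. x t + y t)"
  unfolding locally_finite_def
proof (intro allI)
  fix a b
  have "{t \<in> {a..b}. x t + y t \<noteq> 0} \<subseteq> {t \<in> {a..b}. x t \<noteq> 0} \<union> {t \<in> {a..b}. y t \<noteq> 0}" by auto
  then show "finite {t \<in> {a..b}. x t + y t \<noteq> 0}"
    using assms[THEN locally_finiteD] by (meson finite_Un finite_subset)
qed

lemma locally_finite_support:
  assumes "locally_finite x" "\<And>t. x t = 0 \<Longrightarrow> y t = 0"
  shows "locally_finite y"
  unfolding locally_finite_def
proof (intro allI)
  fix a b
  show "finite {t \<in> {a..b}. y t \<noteq> 0}"
    by (rule finite_subset[OF _ locally_finiteD[OF assms(1), of a b]]) (use assms(2) in \<open>auto intro: ccontr\<close>)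
qed

lemma locally_finite_zero: "locally_finite (\<lambda>t. 0)"
  by (simp add: locally_finite_def)

lemma npts_empty [simp]: "npts x {} = 0" by (simp add: npts_def)

lemma npts_Un:
  assumes "locally_finite x" "B \<subseteq> {a..b}" "C \<subseteq> {a..b}" "B \<inter> C = {}"
  shows "npts x (B \<union> C) = npts x B + npts x C"
proof -
  have "{t \<in> B \<union> C. x t \<noteq> 0} = {t \<in> B. x t \<noteq> 0} \<union> {t \<in> C. x t \<noteq> 0}" by auto
  then show ?thesis unfolding npts_def
    using assms by (auto intro!: sum.union_disjoint locally_finite_finite)
qed

lemma npts_split:
  assumes "locally_finite x" "a \<le> b" "b \<le> c"
  shows "npts x {a<..c} = npts x {a<..b} + npts x {b<..c}"
proof -
  have "{a<..c} = {a<..b} \<union> {b<..c}" using assms by auto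
  then show ?thesis
    using npts_Un[OF assms(1), of "{a<..b}" a c "{b<..c}"] assms by force
qed

lemma npts_mono_set:
  assumes "locally_finite x" "B \<subseteq> C" "C \<subseteq> {a..b}"
  shows "npts x B \<le> npts x C"
  unfolding npts_def
  by (rule sum_mono2) (use assms in \<open>auto intro: locally_finite_finite\<close>)

lemma npts_cong:
  assumes "\<And>t. t \<in> B \<Longrightarrow> x t = y t"
  shows "npts x B = npts y B"
  unfolding npts_def by (rule sum.cong) (use assms in auto)

lemma npts_cong_set:
  assumes "\<And>t. x t \<noteq> 0 \<Longrightarrow> t \<in> B \<longleftrightarrow> t \<in> C"
  shows "npts x B = npts x C"
  unfolding npts_def by (rule sum.cong) (use assms in auto)

lemma npts_point:
  assumes "p \<in> B" "\<And>t. t \<in> B \<Longrightarrow> t \<noteq> p \<Longrightarrow> x t = 0"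
  shows "npts x B = x p"
proof -
  have "npts x B = npts x {p}"
    by (rule npts_cong_set) (use assms in force)
  also have "\<dots> = x p"
    by (cases "x p = 0") (auto simp: npts_def Collect_conv_if)
  finally show ?thesis .
qed

lemma npts_eq_0:
  assumes "\<And>t. t \<in> B \<Longrightarrow> x t = 0"
  shows "npts x B = 0"
  unfolding npts_def using assms by (intro sum.neutral) auto

lemma npts_eq_sum_superset:
  assumes "finite T" "{t \<in> B. x t \<noteq> 0} \<subseteq> T" "T \<subseteq> B"
  shows "npts x B = sum x T"
  unfolding npts_def by (rule sum.mono_neutral_left) (use assms in auto)

lemma npts_add:
  assumes "locally_finite x" "locally_finite y" "B \<subseteq> {a..b}"
  shows "npts (\<lambda>t. x t + y t) B = npts x B + npts y B"
proof -
  let ?T = "{t \<in> B. x t \<noteq> 0} \<union> {t \<in> B. y t \<noteq> 0}"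
  have "finite ?T" using assms by (auto intro: locally_finite_finite)
  then have "npts (\<lambda>t. x t + y t) B = (\<Sum>t\<in>?T. x t + y t)" "npts x B = sum x ?T" "npts y B = sum y ?T"
    by (auto intro!: npts_eq_sum_superset)
  then show ?thesis by (simp add: sum.distrib)
qed

lemma npts_diff:
  assumes "locally_finite x" "\<And>t. y t \<le> x t" "B \<subseteq> {a..b}"
  shows "npts (\<lambda>t. x t - y t) B = npts x B - npts y B"
proof -
  have y: "locally_finite y"
    by (rule locally_finite_support[OF assms(1)]) (use assms(2) in \<open>metis le_zero_eq\<close>)
  have d: "locally_finite (\<lambda>t. x t - y t)"
    by (rule locally_finite_support[OF assms(1)]) auto
  have "npts x B = npts (\<lambda>t. (x t - y t) + y t) B"
    using assms(2) by (intro npts_cong) simp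
  also have "\<dots> = npts (\<lambda>t. x t - y t) B + npts y B"
    by (rule npts_add[OF d y assms(3)])
  finally show ?thesis by simp
qed

lemma npts_mono:
  assumes "locally_finite x" "\<And>t. y t \<le> x t" "B \<subseteq> {a..b}"
  shows "npts y B \<le> npts x B"
proof -
  have y: "locally_finite y"
    by (rule locally_finite_support[OF assms(1)]) (use assms(2) in \<open>metis le_zero_eq\<close>)
  have d: "locally_finite (\<lambda>t. x t - y t)"
    by (rule locally_finite_support[OF assms(1)]) auto
  have "npts x B = npts (\<lambda>t. (x t - y t) + y t) B"
    using assms(2) by (intro npts_cong) simp
  also have "\<dots> = npts (\<lambda>t. x t - y t) B + npts y B"
    by (rule npts_add[OF d y assms(3)])
  finally show ?thesis by simp
qed

section \<open>Gaps between points, and induction along points\<close>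

lemma gap_left:
  assumes "locally_finite x" "a < t"
  obtains u where "a \<le> u" "u < t" "\<And>p. u < p \<Longrightarrow> p < t \<Longrightarrow> x p = 0"
proof -
  define T where "T = insert a {p \<in> {a..<t}. x p \<noteq> 0}"
  define u where "u = Max T"
  have f: "finite T" unfolding T_def finite_insert
    by (rule locally_finite_finite[OF assms(1), of _ a t]) auto
  have "u \<in> T" unfolding u_def using f by (rule Max_in) (simp add: T_def)
  then have "a \<le> u" "u < t" using assms(2) by (auto simp: T_def)
  moreover have "x p = 0" if "u < p" "p < t" for p
  proof (rule ccontr)
    assume "x p \<noteq> 0"
    then have "p \<in> T" using that \<open>a \<le> u\<close> by (simp add: T_def)
    then have "p \<le> u" unfolding u_def using f by (intro Max_ge)
    then show False using that by simp
  qed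
  ultimately show ?thesis by (rule that)
qed

lemma gap_right:
  assumes "locally_finite x" "t < b"
  obtains u where "t < u" "u \<le> b" "\<And>p. t < p \<Longrightarrow> p < u \<Longrightarrow> x p = 0"
proof -
  define T where "T = insert b {p \<in> {t<..b}. x p \<noteq> 0}"
  define u where "u = Min T"
  have f: "finite T" unfolding T_def finite_insert
    by (rule locally_finite_finite[OF assms(1), of _ t b]) auto
  have "u \<in> T" unfolding u_def using f by (rule Min_in) (simp add: T_def)
  then have "t < u" "u \<le> b" using assms(2) by (auto simp: T_def)
  moreover have "x p = 0" if "t < p" "p < u" for p
  proof (rule ccontr)
    assume "x p \<noteq> 0"
    then have "p \<in> T" using that \<open>u \<le> b\<close> by (simp add: T_def)
    then have "u \<le> p" unfolding u_def using f by (intro Min_le)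
    then show False using that by simp
  qed
  ultimately show ?thesis by (rule that)
qed

text \<open>Only finitely many points of \<open>z\<close> lie strictly between \<open>T\<close> and
  \<open>t\<close>, so it is enough to cross intervals on whose interior \<open>z\<close> vanishes;
  the recursion goes back to the last point before \<open>v\<close>. A point at the right end
  \<open>v\<close> is allowed: it is the event that the step has to process.\<close>

lemma locally_finite_induct [consumes 2, case_names base step]:
  assumes "locally_finite z" "T \<le> t" "P T"
    and step: "\<And>u v. T \<le> u \<Longrightarrow> u < v \<Longrightarrow> v \<le> t \<Longrightarrow> (\<And>p. u < p \<Longrightarrow> p < v \<Longrightarrow> z p = 0) \<Longrightarrow> P u \<Longrightarrow> P v"
  shows "P t"
proof -
  have "P v" if "T \<le> v" "v \<le> t" for v
    using that
  proof (induction "card {p \<in> {T<..<v}. z p \<noteq> 0}" arbitrary: v rule: less_induct)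
    case less
    let ?D = "{p \<in> {T<..<v}. z p \<noteq> 0}"
    have f: "finite ?D"
      by (rule locally_finite_finite[OF assms(1), of _ T v]) auto
    consider "v = T" | "T < v" "?D = {}" | "T < v" "?D \<noteq> {}"
      using less.prems(1) unfolding order_le_less by blast
    then show ?case
    proof cases
      case 1
      then show ?thesis using assms(3) by simp
    next
      case 2
      have "z p = 0" if "T < p" "p < v" for p using that 2(2) by auto
      then show ?thesis using 2 less.prems assms(3) by (intro step[of T v]) auto
    next
      case 3
      define m where "m = Max ?D"
      have m: "m \<in> ?D" unfolding m_def using f 3(2) by (rule Max_in)
      have mm: "p \<le> m" if "p \<in> ?D" for p unfolding m_def using f that by (rule Max_ge)
      have "m \<notin> {p \<in> {T<..<m}. z p \<noteq> 0}" "{p \<in> {T<..<m}. z p \<noteq> 0} \<subseteq> ?D"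
        using m by auto
      then have "{p \<in> {T<..<m}. z p \<noteq> 0} \<subset> ?D"
        using m by blast
      then have "P m"
        using m less.prems f by (intro less.hyps psubset_card_mono) auto
      moreover have "z p = 0" if "m < p" "p < v" for p
      proof (rule ccontr)
        assume "z p \<noteq> 0"
        then have "p \<in> ?D" using that m by auto
        then show False using mm[of p] that by simp
      qed
      ultimately show ?thesis using m less.prems by (intro step[of m v]) auto
    qed
  qed
  then show ?thesis using assms(2) by simp
qed

section \<open>Queue lengths\<close>

definition busy :: "config \<Rightarrow> config \<Rightarrow> real \<Rightarrow> bool" where
  "busy A S t \<longleftrightarrow> (\<exists>s\<le>t. npts S {s..<t} < npts A {s..t})"

text \<open>The values under the supremum are integers. If none of them reaches 1, all are at most
  0, and so is the supremum; hence one window \<open>s\<close> decides and the extended reals can be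
  left behind.\<close>

lemma departures_eq_busy: "departures A S t = of_bool (S t \<noteq> 0 \<and> busy A S t)"
proof -
  have "(SUP s\<in>{..t}. ereal (real (npts A {s..t}) - real (npts S {s..<t}))) \<ge> 1 \<longleftrightarrow> busy A S t"
    (is "?sup \<ge> 1 \<longleftrightarrow> _")
  proof
    assume 1: "?sup \<ge> 1"
    show "busy A S t"
    proof (rule ccontr)
      assume "\<not> busy A S t"
      then have "?sup \<le> 0"
        unfolding busy_def by (intro SUP_least) (auto simp: not_less)
      with 1 show False using order_trans by fastforce
    qed
  next
    assume "busy A S t"
    then obtain s where s: "s \<le> t" "npts S {s..<t} < npts A {s..t}" by (auto simp: busy_def)
    then have "1 \<le> ereal (real (npts A {s..t}) - real (npts S {s..<t}))" by simp
    also have "\<dots> \<le> ?sup" using s(1) by (intro SUP_upper) simp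
    finally show "?sup \<ge> 1" .
  qed
  then show ?thesis by (simp add: departures_def)
qed

lemma busy_mono:
  assumes "busy A S t" "locally_finite A'" "\<And>p. A p \<le> A' p"
  shows "busy A' S t"
proof -
  obtain s where s: "s \<le> t" "npts S {s..<t} < npts A {s..t}" using assms(1) unfolding busy_def by blast
  have "npts A {s..t} \<le> npts A' {s..t}"
    by (rule npts_mono[where a=s and b=t]) (simp_all add: assms)
  then show ?thesis
    unfolding busy_def by (intro exI[of _ s] conjI s(1) less_le_trans[OF s(2)])
qed

lemma departures_mono:
  assumes "locally_finite A'" "\<And>p. A p \<le> A' p"
  shows "departures A S t \<le> departures A' S t"
proof -
  have "busy A S t \<Longrightarrow> busy A' S t"
    by (erule busy_mono) (fact assms)+
  then show ?thesis by (simp add: departures_eq_busy)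
qed

lemma departures_le_service: "departures A S t \<le> S t"
  by (auto simp: departures_eq_busy)

lemma departures_eq_0: "S t = 0 \<Longrightarrow> departures A S t = 0"
  by (simp add: departures_eq_busy)

lemma locally_finite_departures: "locally_finite S \<Longrightarrow> locally_finite (departures A S)"
  by (erule locally_finite_support) (rule departures_eq_0)

text \<open>The mass at \<open>p\<close> may be any number, also zero. The location is a parameter
  so that several processes can share it.\<close>

definition concentrated :: "config \<Rightarrow> real \<Rightarrow> real \<Rightarrow> real \<Rightarrow> bool" where
  "concentrated x u v p \<longleftrightarrow> u < p \<and> p \<le> v \<and> (\<forall>t. u < t \<and> t \<le> v \<and> t \<noteq> p \<longrightarrow> x t = 0)"

lemma npts_concentrated: "concentrated x u v p \<Longrightarrow> npts x {u<..v} = x p"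
  by (rule npts_point) (auto simp: concentrated_def)

lemma npts_concentrated_from:
  assumes "concentrated x u v p" "locally_finite x" "w \<le> u"
  shows "npts x {w<..v} = npts x {w<..u} + x p"
proof -
  have "u \<le> v" using assms(1) by (simp add: concentrated_def)
  then show ?thesis
    using npts_split[OF assms(2,3), of v] npts_concentrated[OF assms(1)] by simp
qed

text \<open>A window from \<open>s\<close> to \<open>p\<close> that begins after \<open>u\<close>
  sees only the arrivals at \<open>p\<close>. One that begins earlier sees the history up to
  \<open>u\<close> and the arrivals at \<open>p\<close>, but not the service at \<open>p\<close>,
  which comes after them. Gaps of the superposition of \<open>A\<close> and \<open>S\<close> turn
  closed left ends of windows into open ones and back.\<close>

lemma busy_concentrated:
  assumes lf: "locally_finite A" "locally_finite S"
    and conc: "concentrated A u v p" "concentrated S u v p"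
  shows "busy A S p \<longleftrightarrow> A p \<noteq> 0 \<or> (\<exists>w\<le>u. npts S {w<..u} < npts A {w<..u})"
proof -
  have off: "t = p \<or> t \<le> u \<or> v < t" if "A t \<noteq> 0 \<or> S t \<noteq> 0" for t
    using conc that unfolding concentrated_def by (metis not_le)
  have up: "u < p" "p \<le> v" using conc by (auto simp: concentrated_def)
  show ?thesis
  proof
    assume "busy A S p"
    then obtain s where s: "s \<le> p" "npts S {s..<p} < npts A {s..p}" by (auto simp: busy_def)
    show "A p \<noteq> 0 \<or> (\<exists>w\<le>u. npts S {w<..u} < npts A {w<..u})"
    proof (cases "s \<le> u")
      case False
      have "npts A {s..p} = A p"
      proof (rule npts_point)
        show "p \<in> {s..p}" using s(1) by simp
        show "A t = 0" if "t \<in> {s..p}" "t \<noteq> p" for t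
          using off[of t] that False up by force
      qed
      then show ?thesis using s by auto
    next
      case True
      \<comment> \<open>The value \<open>s - 1\<close> is an arbitrary bound for the search for a
        gap that ends at \<open>s\<close>.\<close>
      have "s - 1 < s" by simp
      then obtain w where w: "s - 1 \<le> w" "w < s"
        and w0: "\<And>q. w < q \<Longrightarrow> q < s \<Longrightarrow> A q + S q = 0"
        using gap_left[OF locally_finite_add[OF lf]] by blast
      have gap: "t \<le> w \<or> s \<le> t" if "A t \<noteq> 0 \<or> S t \<noteq> 0" for t
        using w0[of t] that by linarith
      have "npts A {s..p} = npts A {w<..v}"
      proof (rule npts_cong_set)
        fix t assume t: "A t \<noteq> 0"
        show "t \<in> {s..p} \<longleftrightarrow> t \<in> {w<..v}"
          using off[of t] gap[of t] t up w(2) True by auto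
      qed
      also have "\<dots> = npts A {w<..u} + A p"
        by (rule npts_concentrated_from[OF conc(1) lf(1)]) (use w True in simp)
      finally have 1: "npts A {s..p} = npts A {w<..u} + A p" .
      have 2: "npts S {s..<p} = npts S {w<..u}"
      proof (rule npts_cong_set)
        fix t assume t: "S t \<noteq> 0"
        show "t \<in> {s..<p} \<longleftrightarrow> t \<in> {w<..u}"
          using off[of t] gap[of t] t up w(2) True by auto
      qed
      have "w \<le> u" using w True by simp
      moreover have "A p \<noteq> 0 \<or> npts S {w<..u} < npts A {w<..u}"
        using 1 2 s(2) by linarith
      ultimately show ?thesis by blast
    qed
  next
    assume *: "A p \<noteq> 0 \<or> (\<exists>w\<le>u. npts S {w<..u} < npts A {w<..u})"
    show "busy A S p"
    proof (cases "A p = 0")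
      case False
      have "npts A {p..p} = A p" by (rule npts_point) auto
      then show ?thesis using False unfolding busy_def by (intro exI[of _ p]) simp
    next
      case True
      with * obtain w where w: "w \<le> u" "npts S {w<..u} < npts A {w<..u}" by auto
      then have "w < u" by (cases "w = u") auto
      then obtain s where s: "w < s" "s \<le> u"
        and s0: "\<And>q. w < q \<Longrightarrow> q < s \<Longrightarrow> A q + S q = 0"
        using gap_right[OF locally_finite_add[OF lf]] by blast
      have gap: "t \<le> w \<or> s \<le> t" if "A t \<noteq> 0 \<or> S t \<noteq> 0" for t
        using s0[of t] that by linarith
      have "npts A {s..p} = npts A {w<..v}"
      proof (rule npts_cong_set)
        fix t assume t: "A t \<noteq> 0"
        show "t \<in> {s..p} \<longleftrightarrow> t \<in> {w<..v}"
          using off[of t] gap[of t] t up s(1,2) by auto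
      qed
      also have "\<dots> = npts A {w<..u} + A p"
        by (rule npts_concentrated_from[OF conc(1) lf(1) w(1)])
      finally have 1: "npts A {s..p} = npts A {w<..u} + A p" .
      have 2: "npts S {s..<p} = npts S {w<..u}"
      proof (rule npts_cong_set)
        fix t assume t: "S t \<noteq> 0"
        show "t \<in> {s..<p} \<longleftrightarrow> t \<in> {w<..u}"
          using off[of t] gap[of t] t up s(1,2) by auto
      qed
      show ?thesis unfolding busy_def using 1 2 s w up by (intro exI[of _ s]) auto
    qed
  qed
qed

text \<open>The queue length is the maximum over \<open>u\<close> of arrivals minus services in
  \<open>{u<..t}\<close>, written without subtraction; the empty window \<open>u = t\<close> makes
  it nonnegative. It is a relation because a queue run from minus infinity may have no finite
  length.\<close>

definition is_qlen :: "config \<Rightarrow> config \<Rightarrow> real \<Rightarrow> nat \<Rightarrow> bool" where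
  "is_qlen A S t n \<longleftrightarrow> (\<forall>u\<le>t. npts A {u<..t} \<le> npts S {u<..t} + n) \<and>
     (\<exists>u\<le>t. npts A {u<..t} = npts S {u<..t} + n)"

definition serve :: "nat \<Rightarrow> nat \<Rightarrow> nat \<Rightarrow> nat" where
  "serve q a s = of_bool (s \<noteq> 0 \<and> q + a \<noteq> 0)"

text \<open>The least bound on the excess of arrivals over services is attained: otherwise the
  excesses, being integers, would obey the bound lowered by one. The empty window attains the bound
  0.\<close>

lemma is_qlen_exI:
  assumes "\<And>u. u \<le> t \<Longrightarrow> npts A {u<..t} \<le> npts S {u<..t} + b"
  obtains n where "n \<le> b" "is_qlen A S t n"
proof -
  let ?P = "\<lambda>n. \<forall>u\<le>t. npts A {u<..t} \<le> npts S {u<..t} + n"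
  define n where "n = (LEAST n. ?P n)"
  have P: "?P n" unfolding n_def by (rule LeastI[of ?P b]) (use assms in blast)
  have "n \<le> b" unfolding n_def by (rule Least_le) (use assms in blast)
  moreover have "\<exists>u\<le>t. npts A {u<..t} = npts S {u<..t} + n"
  proof (rule ccontr)
    assume neg: "\<not> ?thesis"
    then have "n \<noteq> 0" by (metis add.right_neutral greaterThanAtMost_empty npts_empty order_refl)
    have "?P (n - 1)"
    proof (intro allI impI)
      fix u assume "u \<le> t"
      then have "npts A {u<..t} \<le> npts S {u<..t} + n" "npts A {u<..t} \<noteq> npts S {u<..t} + n"
        using P neg by auto
      then show "npts A {u<..t} \<le> npts S {u<..t} + (n - 1)" using \<open>n \<noteq> 0\<close> by linarith
    qed
    then have "n \<le> n - 1" unfolding n_def by (rule Least_le)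
    then show False using \<open>n \<noteq> 0\<close> by simp
  qed
  ultimately show ?thesis using P that unfolding is_qlen_def by blast
qed

text \<open>Lindley recursion. For windows that begin up to \<open>u\<close> the excess changes by
  the contents of \<open>p\<close>, and the empty window at \<open>v\<close> has excess 0, so the
  truncated subtraction is the maximum with 0.\<close>

lemma is_qlen_concentrated:
  assumes lf: "locally_finite A" "locally_finite S"
    and conc: "concentrated A u v p" "concentrated S u v p"
    and q: "is_qlen A S u n"
  shows "is_qlen A S v (n + A p - S p)" and "departures A S p = serve n (A p) (S p)"
proof -
  have up: "u < p" "p \<le> v" using conc by (auto simp: concentrated_def)
  note fromA = npts_concentrated_from[OF conc(1) lf(1)]
  note fromS = npts_concentrated_from[OF conc(2) lf(2)]
  have le: "npts A {w<..u} \<le> npts S {w<..u} + n" if "w \<le> u" for w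
    using q that by (simp add: is_qlen_def)
  obtain w0 where w0: "w0 \<le> u" "npts A {w0<..u} = npts S {w0<..u} + n"
    using q unfolding is_qlen_def by blast
  show "is_qlen A S v (n + A p - S p)"
    unfolding is_qlen_def
  proof (intro conjI allI impI)
    fix w assume "w \<le> v"
    consider "w \<le> u" | "u < w" "w < p" | "p \<le> w" by linarith
    then show "npts A {w<..v} \<le> npts S {w<..v} + (n + A p - S p)"
    proof cases
      case 1
      then show ?thesis using le[OF 1] fromA[OF 1] fromS[OF 1] by linarith
    next
      case 2
      then have "npts A {w<..v} = A p"
        using conc up by (intro npts_point) (simp_all add: concentrated_def)
      moreover have "npts S {w<..v} = S p"
        using 2 conc up by (intro npts_point) (simp_all add: concentrated_def)
      ultimately show ?thesis by simp
    next
      case 3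
      have "npts A {w<..v} = 0"
        by (rule npts_eq_0) (use 3 conc in \<open>auto simp: concentrated_def\<close>)
      then show ?thesis by simp
    qed
  next
    show "\<exists>w\<le>v. npts A {w<..v} = npts S {w<..v} + (n + A p - S p)"
    proof (cases "S p \<le> n + A p")
      case True
      then have "npts A {w0<..v} = npts S {w0<..v} + (n + A p - S p)"
        using w0(2) fromA[OF w0(1)] fromS[OF w0(1)] by linarith
      then show ?thesis using w0(1) up by (intro exI[of _ w0]) simp
    next
      case False
      then show ?thesis by (intro exI[of _ v]) simp
    qed
  qed
  have "(\<exists>w\<le>u. npts S {w<..u} < npts A {w<..u}) \<longleftrightarrow> n \<noteq> 0"
  proof (cases "n = 0")
    case True
    then show ?thesis using le by (simp add: not_less)
  next
    case False
    then have "npts S {w0<..u} < npts A {w0<..u}" using w0(2) by linarith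
    then show ?thesis using w0(1) False by blast
  qed
  then show "departures A S p = serve n (A p) (S p)"
    unfolding departures_eq_busy busy_concentrated[OF lf conc] serve_def by simp
qed

section \<open>Interchanging two servers\<close>

text \<open>
  Here \<open>q1\<close> and \<open>q2\<close> are the queue lengths of the tandem with services \<open>a\<close> then \<open>s\<close>, \<open>q1'\<close> and
  \<open>q2'\<close> those of the tandem with services \<open>a + s - d\<close> then \<open>d\<close>, and \<open>q\<close> is the length of the
  queue with arrivals \<open>a\<close> and services \<open>s\<close>, whose departures are \<open>d\<close>.
\<close>

definition tandem_inv :: "nat \<Rightarrow> nat \<Rightarrow> nat \<Rightarrow> nat \<Rightarrow> nat \<Rightarrow> bool" where
  "tandem_inv q1 q2 q q1' q2' \<longleftrightarrow>
     q1 + q2 = q1' + q2' \<and> q2 \<le> q2' \<and> q2 \<le> q \<and> (q2 < q \<longrightarrow> q2' = q2)"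

lemma tandem_inv_step:
  fixes x a s q1 q2 q q1' q2' :: nat
  defines "d \<equiv> serve q a s"
  defines "r \<equiv> a + s - d"
  defines "y \<equiv> serve q1 x a"
  defines "y' \<equiv> serve q1' x r"
  assumes "tandem_inv q1 q2 q q1' q2'" "a + s \<le> 1"
  shows "tandem_inv (q1 + x - a) (q2 + y - s) (q + a - s) (q1' + x - r) (q2' + y' - d)"
    and "serve q2 y s = serve q2' y' d"
proof -
  consider "a = 0" "s = 0" | "a = 1" "s = 0" | "a = 0" "s = 1" using assms(6) by linarith
  then have "tandem_inv (q1 + x - a) (q2 + y - s) (q + a - s) (q1' + x - r) (q2' + y' - d) \<and>
    serve q2 y s = serve q2' y' d"
  proof cases
    case 1
    then show ?thesis using assms(5) by (auto simp: assms(1-4) serve_def tandem_inv_def)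
  next
    case 2
    then show ?thesis using assms(5)
      by (cases "q1 + x = 0"; cases "q1' + x = 0"; auto simp: assms(1-4) serve_def tandem_inv_def)
  next
    case 3
    then show ?thesis using assms(5)
      by (cases "q = 0"; cases "q1' + x = 0"; cases "q2 = 0"; cases "q2' = 0";
          auto simp: assms(1-4) serve_def tandem_inv_def)
  qed
  then show "tandem_inv (q1 + x - a) (q2 + y - s) (q + a - s) (q1' + x - r) (q2' + y' - d)"
    and "serve q2 y s = serve q2' y' d" by auto
qed

definition stable :: "config \<Rightarrow> config \<Rightarrow> bool" where
  "stable A S \<longleftrightarrow> (\<forall>t. \<exists>n. is_qlen A S t n)"

definition dual_service :: "config \<Rightarrow> config \<Rightarrow> config" where
  "dual_service A S = (\<lambda>t. A t + S t - departures A S t)"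

definition truncate :: "real \<Rightarrow> config \<Rightarrow> config" where
  "truncate T x = (\<lambda>t. if T < t then x t else 0)"

lemma locally_finite_dual_service:
  assumes "locally_finite A" "locally_finite S"
  shows "locally_finite (dual_service A S)"
  by (rule locally_finite_support[OF locally_finite_add[OF assms]]) (simp add: dual_service_def)

lemma locally_finite_truncate: "locally_finite x \<Longrightarrow> locally_finite (truncate T x)"
  by (erule locally_finite_support) (simp add: truncate_def)

lemma not_busy_before:
  assumes "\<And>p. p \<le> t \<Longrightarrow> A p = 0"
  shows "\<not> busy A S t"
proof -
  have "npts A {s..t} = 0" for s by (rule npts_eq_0) (simp add: assms)
  then show ?thesis by (simp add: busy_def)
qed

lemma is_qlen_before:
  assumes "\<And>p. p \<le> t \<Longrightarrow> A p = 0"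
  shows "is_qlen A S t 0"
proof -
  have "npts A {s<..t} = 0" for s by (rule npts_eq_0) (simp add: assms)
  then show ?thesis unfolding is_qlen_def by (auto intro: exI[of _ t])
qed

locale tandem =
  fixes a s :: config
  assumes lf: "locally_finite a" "locally_finite s"
    and simple: "\<And>t. a t + s t \<le> 1"
    and stable: "stable a s"
begin

definition "tandem_state X u \<longleftrightarrow> (\<exists>q1 q2 q q1' q2'.
  is_qlen X a u q1 \<and> is_qlen (departures X a) s u q2 \<and> is_qlen a s u q \<and>
  is_qlen X (dual_service a s) u q1' \<and>
  is_qlen (departures X (dual_service a s)) (departures a s) u q2' \<and>
  tandem_inv q1 q2 q q1' q2')"

lemma tandem_state_step:
  assumes X: "locally_finite X"
    and uv: "u < v" "\<And>p. u < p \<Longrightarrow> p < v \<Longrightarrow> X p + (a p + s p) = 0"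
    and st: "tandem_state X u"
  shows "tandem_state X v"
    and "departures (departures X a) s v =
         departures (departures X (dual_service a s)) (departures a s) v"
proof -
  define d where "d = departures a s"
  define R where "R = dual_service a s"
  define Y where "Y = departures X a"
  define Y' where "Y' = departures X R"
  have lfs: "locally_finite d" "locally_finite R" "locally_finite Y" "locally_finite Y'"
    unfolding d_def R_def Y_def Y'_def
    by (intro locally_finite_departures locally_finite_dual_service lf)+
  have z: "X p = 0" "a p = 0" "s p = 0" if "u < p" "p \<le> v" "p \<noteq> v" for p
    using uv(2)[of p] that by simp_all
  have z': "d p = 0" "R p = 0" "Y p = 0" "Y' p = 0" if "u < p" "p \<le> v" "p \<noteq> v" for p
    using z[OF that] by (simp_all add: d_def R_def Y_def Y'_def dual_service_def departures_eq_0)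
  \<comment> \<open>Departures and dual services can only occur at points of \<open>a\<close> or
    \<open>s\<close>, so all seven processes are silent strictly between \<open>u\<close> and
    \<open>v\<close>, and the recursion applies to all five queues with the common location
    \<open>v\<close>.\<close>
  have conc: "concentrated X u v v" "concentrated a u v v" "concentrated s u v v"
    "concentrated d u v v" "concentrated R u v v" "concentrated Y u v v" "concentrated Y' u v v"
    unfolding concentrated_def using uv(1) z z' by blast+
  obtain q1 q2 q q1' q2' where q: "is_qlen X a u q1" "is_qlen Y s u q2" "is_qlen a s u q"
    "is_qlen X R u q1'" "is_qlen Y' d u q2'" and inv: "tandem_inv q1 q2 q q1' q2'"
    using st unfolding tandem_state_def Y_def[symmetric] d_def[symmetric] R_def[symmetric]
      Y'_def[symmetric] by blast
  note q1 = is_qlen_concentrated[OF X lf(1) conc(1,2) q(1), folded Y_def]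
  note q0 = is_qlen_concentrated[OF lf conc(2,3) q(3), folded d_def]
  note q1' = is_qlen_concentrated[OF X lfs(2) conc(1,5) q(4), folded Y'_def]
  note q2 = is_qlen_concentrated[OF lfs(3) lf(2) conc(6,3) q(2)]
  note q2' = is_qlen_concentrated[OF lfs(4) lfs(1) conc(7,4) q(5)]
  have R: "R v = a v + s v - serve q (a v) (s v)"
    using q0(2) by (simp add: R_def dual_service_def d_def)
  note stp = tandem_inv_step[OF inv simple[of v], of "X v", folded q0(2) q1(2)]
  have 1: "a v + s v - d v = R v" by (simp add: R_def dual_service_def d_def)
  show "tandem_state X v"
    unfolding tandem_state_def Y_def[symmetric] d_def[symmetric] R_def[symmetric]
      Y'_def[symmetric]
    using q1(1) q0(1) q1'(1) q2(1) q2'(1) stp(1)[unfolded 1, folded q1'(2)] by blast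
  show "departures (departures X a) s v =
         departures (departures X (dual_service a s)) (departures a s) v"
    unfolding Y_def[symmetric] d_def[symmetric] R_def[symmetric] Y'_def[symmetric]
    using q2(2) q2'(2) stp(2)[unfolded 1, folded q1'(2)] by simp
qed

lemma interchange_truncate:
  assumes X: "locally_finite X" and T: "\<And>p. p \<le> T \<Longrightarrow> X p = 0"
  shows "departures (departures X a) s t =
         departures (departures X (dual_service a s)) (departures a s) t"
proof (cases "t \<le> T")
  case True
  have Y: "departures X b p = 0" if "p \<le> T" for p b
    using not_busy_before[of p X b] T that by (simp add: departures_eq_busy)
  have "departures (departures X b) c t = 0" for b c
    using not_busy_before[of t "departures X b" c] Y True by (simp add: departures_eq_busy)
  then show ?thesis by simp
next
  case False
  define Z where "Z = (\<lambda>p. X p + (a p + s p))"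
  have Z: "locally_finite Z" unfolding Z_def by (intro locally_finite_add X lf)
  obtain u where u: "T \<le> u" "u < t" "\<And>p. u < p \<Longrightarrow> p < t \<Longrightarrow> Z p = 0"
    using gap_left[OF Z, of T t] False by auto
  have base: "tandem_state X T"
  proof -
    have Y: "departures X b p = 0" if "p \<le> T" for p b
      using not_busy_before[of p X b] T that by (simp add: departures_eq_busy)
    obtain q where "is_qlen a s T q" using stable unfolding stable_def by blast
    moreover have "is_qlen X b T 0" "is_qlen (departures X b) c T 0" for b c
      using T Y by (auto intro: is_qlen_before)
    \<comment> \<open>The four queues that depend on \<open>X\<close> are empty at \<open>T\<close>,
      and then the invariant holds for whatever length \<open>q\<close> the stable queue has
      accumulated.\<close>
    moreover have "tandem_inv 0 0 q 0 0" by (simp add: tandem_inv_def)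
    ultimately show ?thesis unfolding tandem_state_def by blast
  qed
  have "tandem_state X u"
    using Z u(1) base
  proof (induction rule: locally_finite_induct)
    case (step u v)
    then show ?case
      by (intro tandem_state_step(1)[OF X, of u v]) (simp_all add: Z_def)
  qed
  then show ?thesis
    using u by (intro tandem_state_step(2)[OF X, of u t]) (simp_all add: Z_def)
qed

end

text \<open>A busy instant is witnessed by one bounded window, which holds finitely many points of
  \<open>X\<close>, and these are all present in \<open>Y T\<close> once \<open>T\<close> is far
  enough to the left. Conversely, \<open>Y T\<close> lies below \<open>X\<close> and busyness is
  monotone in the arrivals.\<close>

lemma busy_eventually:
  assumes X: "locally_finite X" and le: "\<And>T p. Y T p \<le> X p"
    and ev: "\<And>p. eventually (\<lambda>T. Y T p = X p) at_bot"
  shows "eventually (\<lambda>T. busy (Y T) S t = busy X S t) at_bot"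
proof (cases "busy X S t")
  case True
  then obtain w where w: "w \<le> t" "npts S {w..<t} < npts X {w..t}" unfolding busy_def by blast
  have "eventually (\<lambda>T. \<forall>p\<in>{p \<in> {w..t}. X p \<noteq> 0}. Y T p = X p) at_bot"
    using locally_finiteD[OF X] ev by (intro eventually_ball_finite) auto
  then show ?thesis
  proof eventually_elim
    case (elim T)
    have "Y T p = X p" if "p \<in> {w..t}" for p
      using elim that le[of T p] by (cases "X p = 0") auto
    then have "npts (Y T) {w..t} = npts X {w..t}" by (rule npts_cong)
    then show ?case using w True unfolding busy_def by auto
  qed
next
  case False
  have "\<not> busy (Y T) S t" for T
  proof
    assume "busy (Y T) S t"
    then have "busy X S t" by (rule busy_mono) (fact X le)+
    then show False using False by simp
  qed
  then show ?thesis using False by simp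
qed

lemma departures_eventually:
  assumes "locally_finite X" and "\<And>T p. Y T p \<le> X p"
    and "\<And>p. eventually (\<lambda>T. Y T p = X p) at_bot"
  shows "eventually (\<lambda>T. departures (Y T) S t = departures X S t) at_bot"
  using busy_eventually[of X Y S t, OF assms]
  by eventually_elim (simp add: departures_eq_busy)

lemma truncate_eventually: "eventually (\<lambda>T. truncate T x p = x p) at_bot"
  using eventually_gt_at_bot[of p]
  by (rule eventually_mono) (simp add: truncate_def)

text \<open>Departures inherit from the truncated arrivals both the domination and the eventual
  pointwise equality, so the argument can be repeated for the second queue.\<close>

lemma departures_truncate_eventually:
  assumes X: "locally_finite X" and S: "locally_finite S"
  shows "eventually (\<lambda>T. departures (departures (truncate T X) S) S' t =
    departures (departures X S) S' t) at_bot"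
proof -
  have le: "truncate T X p \<le> X p" for T p by (simp add: truncate_def)
  show ?thesis
  proof (rule departures_eventually)
    show "locally_finite (departures X S)" by (rule locally_finite_departures[OF S])
    show "departures (truncate T X) S p \<le> departures X S p" for T p
      by (rule departures_mono) (fact X le)+
    show "eventually (\<lambda>T. departures (truncate T X) S p = departures X S p) at_bot" for p
      by (rule departures_eventually) (fact X le truncate_eventually)+
  qed
qed

theorem (in tandem) interchange:
  assumes X: "locally_finite X"
  shows "departures (departures X a) s =
         departures (departures X (dual_service a s)) (departures a s)"
proof
  fix t
  obtain T where T: "departures (departures (truncate T X) a) s t = departures (departures X a) s t"
    "departures (departures (truncate T X) (dual_service a s)) (departures a s) t =
      departures (departures X (dual_service a s)) (departures a s) t"
    using eventually_happens'[OF trivial_limit_at_bot_linorder eventually_conj[OF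
      departures_truncate_eventually[OF X lf(1), of s t]
      departures_truncate_eventually[OF X locally_finite_dual_service[OF lf], of "departures a s" t]]]
    by blast
  have "departures (departures (truncate T X) a) s t =
       departures (departures (truncate T X) (dual_service a s)) (departures a s) t"
    by (rule interchange_truncate[OF locally_finite_truncate[OF X], of T]) (simp add: truncate_def)
  with T show "departures (departures X a) s t =
         departures (departures X (dual_service a s)) (departures a s) t"
    by simp
qed

section \<open>Measurability\<close>

lemma space_config_space: "space config_space = {x. locally_finite x}"
  unfolding config_space_def by (rule space_measure_of) auto

lemma sets_config_space: "sets config_space = sigma_sets {x. locally_finite x}
     {{x. locally_finite x \<and> npts x {a<..b} = n} | a b n. True}"
  unfolding config_space_def by (rule sets_measure_of) auto

lemma measurable_npts_config:
  "(\<lambda>x. npts x {a<..b}) \<in> config_space \<rightarrow>\<^sub>M count_space UNIV"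
proof (rule measurable_count_space_eq2_countable[THEN iffD2])
  have "(\<lambda>x. npts x {a<..b}) -` {n} \<inter> space config_space \<in> sets config_space" for n
  proof -
    have "(\<lambda>x. npts x {a<..b}) -` {n} \<inter> space config_space =
      {x. locally_finite x \<and> npts x {a<..b} = n}"
      by (auto simp: space_config_space)
    also have "\<dots> \<in> sets config_space"
      unfolding sets_config_space by (rule sigma_sets.Basic) blast
    finally show ?thesis .
  qed
  then show "(\<lambda>x. npts x {a<..b}) \<in> space config_space \<rightarrow> UNIV \<and>
    (\<forall>n\<in>UNIV. (\<lambda>x. npts x {a<..b}) -` {n} \<inter> space config_space \<in> sets config_space)"
    by simp
qed

lemma measurable_npts [measurable (raw)]:
  "f \<in> N \<rightarrow>\<^sub>M config_space \<Longrightarrow> (\<lambda>w. npts (f w) {a<..b}) \<in> N \<rightarrow>\<^sub>M count_space UNIV"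
  by (rule measurable_compose[OF _ measurable_npts_config])

lemma measurable_configI:
  assumes "\<And>w. w \<in> space N \<Longrightarrow> locally_finite (f w)"
    and "\<And>a b. a < b \<Longrightarrow> (\<lambda>w. npts (f w) {a<..b}) \<in> N \<rightarrow>\<^sub>M count_space UNIV"
  shows "f \<in> N \<rightarrow>\<^sub>M config_space"
  unfolding config_space_def
proof (rule measurable_measure_of)
  fix B assume "B \<in> {{x. locally_finite x \<and> npts x {a<..b} = n} |a b n. True}"
  then obtain a b n where B: "B = {x. locally_finite x \<and> npts x {a<..b} = n}" by blast
  have "(\<lambda>w. npts (f w) {a<..b}) \<in> N \<rightarrow>\<^sub>M count_space UNIV"
    using assms(2) by (cases "a < b") simp_all
  then have "(\<lambda>w. npts (f w) {a<..b}) -` {n} \<inter> space N \<in> sets N"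
    by (rule measurable_sets) simp
  also have "(\<lambda>w. npts (f w) {a<..b}) -` {n} \<inter> space N = f -` B \<inter> space N"
    using assms(1) by (auto simp: B)
  finally show "f -` B \<inter> space N \<in> sets N" .
qed (use assms(1) in auto)

lemma measurable_config_locally_finite:
  "f \<in> N \<rightarrow>\<^sub>M config_space \<Longrightarrow> w \<in> space N \<Longrightarrow> locally_finite (f w)"
  using measurable_space[of f N config_space w] by (simp add: space_config_space)

lemma measurable_config_add [measurable]:
  assumes [measurable]: "f \<in> N \<rightarrow>\<^sub>M config_space" "g \<in> N \<rightarrow>\<^sub>M config_space"
  shows "(\<lambda>w t. f w t + g w t) \<in> N \<rightarrow>\<^sub>M config_space"
proof (rule measurable_configI)
  note lf = assms[THEN measurable_config_locally_finite]
  show "locally_finite (\<lambda>t. f w t + g w t)" if "w \<in> space N" for w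
    using lf[OF that] by (rule locally_finite_add)
  show "(\<lambda>w. npts (\<lambda>t. f w t + g w t) {a<..b}) \<in> N \<rightarrow>\<^sub>M count_space UNIV" for a b
  proof (subst measurable_cong)
    show "npts (\<lambda>t. f w t + g w t) {a<..b} = npts (f w) {a<..b} + npts (g w) {a<..b}"
      if "w \<in> space N" for w
      using lf[OF that] by (rule npts_add[where a=a and b=b]) auto
  qed simp
qed

lemma measurable_config_diff:
  assumes [measurable]: "f \<in> N \<rightarrow>\<^sub>M config_space" "g \<in> N \<rightarrow>\<^sub>M config_space"
    and le: "\<And>w t. w \<in> space N \<Longrightarrow> g w t \<le> f w t"
  shows "(\<lambda>w t. f w t - g w t) \<in> N \<rightarrow>\<^sub>M config_space"
proof (rule measurable_configI)
  note lf = assms(1,2)[THEN measurable_config_locally_finite]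
  show "locally_finite (\<lambda>t. f w t - g w t)" if "w \<in> space N" for w
    using lf(1)[OF that] by (rule locally_finite_support) simp
  show "(\<lambda>w. npts (\<lambda>t. f w t - g w t) {a<..b}) \<in> N \<rightarrow>\<^sub>M count_space UNIV" for a b
  proof (subst measurable_cong)
    show "npts (\<lambda>t. f w t - g w t) {a<..b} = npts (f w) {a<..b} - npts (g w) {a<..b}"
      if "w \<in> space N" for w
      using lf(1)[OF that] le[OF that] by (rule npts_diff[where a=a and b=b]) auto
  qed simp
qed

lemma measurable_config_zero [measurable]: "(\<lambda>w t. 0) \<in> N \<rightarrow>\<^sub>M config_space"
  by (rule measurable_configI) (simp_all add: locally_finite_zero npts_def)

section \<open>Departure counts as eventual values of sums over small cells\<close>

lemma locally_finite_separated:
  assumes "locally_finite x"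
  obtains e where "e > 0"
    "\<And>p q. p \<in> {a<..b} \<Longrightarrow> q \<in> {a<..b} \<Longrightarrow> x p \<noteq> 0 \<Longrightarrow> x q \<noteq> 0 \<Longrightarrow> \<bar>p - q\<bar> < e \<Longrightarrow> p = q"
proof -
  define T where "T = {p \<in> {a<..b}. x p \<noteq> 0}"
  \<comment> \<open>The extra 1 keeps the set nonempty when there are fewer than two points.\<close>
  define D where "D = insert 1 ((\<lambda>(p, q). \<bar>p - q\<bar>) ` {(p, q) \<in> T \<times> T. p \<noteq> q})"
  have "finite T" unfolding T_def by (rule locally_finite_finite[OF assms, of _ a b]) auto
  then have "finite {(p, q) \<in> T \<times> T. p \<noteq> q}"
    by (rule_tac finite_subset[of _ "T \<times> T"]) auto
  then have D: "finite D" unfolding D_def by simp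
  have "Min D \<in> D" using D by (rule Min_in) (simp add: D_def)
  moreover have "\<forall>d\<in>D. d > 0" by (auto simp: D_def)
  ultimately have "Min D > 0" by blast
  moreover have "p = q" if "p \<in> {a<..b}" "q \<in> {a<..b}" "x p \<noteq> 0" "x q \<noteq> 0" "\<bar>p - q\<bar> < Min D" for p q
  proof (rule ccontr)
    assume "p \<noteq> q"
    then have "\<bar>p - q\<bar> \<in> D" using that by (auto simp: D_def T_def)
    then have "Min D \<le> \<bar>p - q\<bar>" using D by (intro Min_le)
    then show False using that by simp
  qed
  ultimately show ?thesis by (rule that)
qed

lemma concentrated_if_separated:
  assumes "u < v" and sep: "\<And>p q. u < p \<Longrightarrow> p \<le> v \<Longrightarrow> u < q \<Longrightarrow> q \<le> v \<Longrightarrow> x p \<noteq> 0 \<Longrightarrow> x q \<noteq> 0 \<Longrightarrow> p = q"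
  obtains p where "concentrated x u v p"
proof (cases "\<exists>p. u < p \<and> p \<le> v \<and> x p \<noteq> 0")
  case True
  then obtain p where p: "u < p" "p \<le> v" "x p \<noteq> 0" by blast
  have "concentrated x u v p"
    unfolding concentrated_def using p sep[OF _ _ p(1,2) _ p(3)] by blast
  then show ?thesis by (rule that)
next
  case False
  then have "concentrated x u v v" unfolding concentrated_def using assms(1) by blast
  then show ?thesis by (rule that)
qed

lemma concentrated_add:
  "concentrated (\<lambda>t. x t + y t) u v p \<longleftrightarrow> concentrated x u v p \<and> concentrated y u v p"
  by (auto simp: concentrated_def)

lemma concentrated_support:
  "concentrated x u v p \<Longrightarrow> (\<And>t. x t = 0 \<Longrightarrow> y t = 0) \<Longrightarrow> concentrated y u v p"
  by (auto simp: concentrated_def)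

text \<open>This is the departure criterion for a cell with at most one location, expressed through
  interval counts. The left ends \<open>w\<close> are rational so that the existential is a
  countable union of measurable events.\<close>

definition cell_departures :: "config \<Rightarrow> config \<Rightarrow> real \<Rightarrow> real \<Rightarrow> nat" where
  "cell_departures A S u v = of_bool (npts S {u<..v} \<noteq> 0 \<and>
     (npts A {u<..v} \<noteq> 0 \<or> (\<exists>w::rat. of_rat w \<le> u \<and> npts S {of_rat w<..u} < npts A {of_rat w<..u})))"

lemma npts_shift_left:
  assumes "w \<le> r" "\<And>q. w < q \<Longrightarrow> q \<le> r \<Longrightarrow> x q = 0"
  shows "npts x {w<..u} = npts x {r<..u}"
proof (rule npts_cong_set)
  fix t assume "x t \<noteq> 0"
  then show "t \<in> {w<..u} \<longleftrightarrow> t \<in> {r<..u}" using assms(1) assms(2)[of t] by force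
qed

text \<open>A real left end \<open>w\<close> can be moved to a rational inside the gap to its right
  without changing either count.\<close>

lemma cell_departures:
  assumes lf: "locally_finite A" "locally_finite S"
    and conc: "concentrated A u v p" "concentrated S u v p"
  shows "npts (departures A S) {u<..v} = cell_departures A S u v"
proof -
  have "(\<exists>w\<le>u. npts S {w<..u} < npts A {w<..u}) \<longleftrightarrow>
    (\<exists>w::rat. of_rat w \<le> u \<and> npts S {of_rat w<..u} < npts A {of_rat w<..u})"
  proof
    assume "\<exists>w\<le>u. npts S {w<..u} < npts A {w<..u}"
    then obtain w where w: "w \<le> u" "npts S {w<..u} < npts A {w<..u}" by blast
    then have "w < u" by (cases "w = u") simp_all
    then obtain s where s: "w < s" "s \<le> u" and s0: "\<And>q. w < q \<Longrightarrow> q < s \<Longrightarrow> A q + S q = 0"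
      using gap_right[OF locally_finite_add[OF lf]] by blast
    obtain r :: rat where r: "w < of_rat r" "of_rat r < s"
      using of_rat_dense[OF s(1)] by blast
    have "A q = 0" "S q = 0" if "w < q" "q \<le> of_rat r" for q
      using s0[of q] that r by simp_all
    then have "npts A {w<..u} = npts A {of_rat r<..u}" "npts S {w<..u} = npts S {of_rat r<..u}"
      using r(1) by (simp_all add: npts_shift_left)
    then show "\<exists>w::rat. of_rat w \<le> u \<and> npts S {of_rat w<..u} < npts A {of_rat w<..u}"
      using w(2) r s by (intro exI[of _ r]) simp
  qed blast
  moreover have "concentrated (departures A S) u v p"
    by (rule concentrated_support[OF conc(2)]) (rule departures_eq_0)
  ultimately show ?thesis
    by (simp add: npts_concentrated[OF conc(1)] npts_concentrated[OF conc(2)] npts_concentrated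
        cell_departures_def departures_eq_busy busy_concentrated[OF lf conc])
qed

lemma measurable_countable_binary:
  fixes f :: "'a \<Rightarrow> 'b::countable" and g :: "'a \<Rightarrow> 'c::countable"
  assumes "f \<in> N \<rightarrow>\<^sub>M count_space UNIV" "g \<in> N \<rightarrow>\<^sub>M count_space UNIV"
  shows "(\<lambda>w. h (f w) (g w)) \<in> N \<rightarrow>\<^sub>M count_space UNIV"
proof (rule measurable_compose_countable[OF _ assms(1)])
  show "(\<lambda>w. h i (g w)) \<in> N \<rightarrow>\<^sub>M count_space UNIV" for i
    by (rule measurable_compose[OF assms(2)]) simp
qed

lemma measurable_cell_departures [measurable]:
  assumes [measurable]: "f \<in> N \<rightarrow>\<^sub>M config_space" "g \<in> N \<rightarrow>\<^sub>M config_space"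
  shows "(\<lambda>w. cell_departures (f w) (g w) u v) \<in> N \<rightarrow>\<^sub>M count_space UNIV"
proof -
  have p: "Measurable.pred N (\<lambda>w. npts (g w) {of_rat r<..u} < npts (f w) {of_rat r<..u})" for r :: rat
    by (intro measurable_countable_binary[where h="\<lambda>i j. i < j"] measurable_npts assms)
  have "Measurable.pred N (\<lambda>w. \<exists>r\<in>{r::rat. of_rat r \<le> u}.
      npts (g w) {of_rat r<..u} < npts (f w) {of_rat r<..u})"
    by (rule pred_intros_countable_bounded(4)) (rule p)
  then have "Measurable.pred N (\<lambda>w. \<exists>r::rat. of_rat r \<le> u \<and>
      npts (g w) {of_rat r<..u} < npts (f w) {of_rat r<..u})"
    unfolding Bex_def mem_Collect_eq .
  then have "(\<lambda>w. npts (f w) {u<..v} \<noteq> 0 \<or> (\<exists>r::rat. of_rat r \<le> u \<and>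
      npts (g w) {of_rat r<..u} < npts (f w) {of_rat r<..u})) \<in> N \<rightarrow>\<^sub>M count_space UNIV"
    by (rule measurable_countable_binary[where h="\<lambda>n P. n \<noteq> 0 \<or> P", OF measurable_npts[OF assms(1)]])
  then show ?thesis
    unfolding cell_departures_def
    by (rule measurable_countable_binary[where h="\<lambda>n P. of_bool (n \<noteq> 0 \<and> P)", OF measurable_npts[OF assms(2)]])
qed

lemma npts_cells:
  fixes h :: real
  assumes "locally_finite x" "h \<ge> 0"
  shows "npts x {a<..a + real n * h} = (\<Sum>k<n. npts x {a + real k * h<..a + real (Suc k) * h})"
proof (induction n)
  case (Suc n)
  have "npts x {a<..a + real (Suc n) * h} = npts x {a<..a + real n * h} +
    npts x {a + real n * h<..a + real (Suc n) * h}"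
    by (rule npts_split[OF assms(1)]) (use assms(2) in \<open>auto simp: algebra_simps\<close>)
  then show ?case using Suc by simp
qed simp

text \<open>Once the mesh is below the smallest distance between points of the superposition in
  \<open>{a<..b}\<close>, each cell has at most one location, and the cell formula is exact.\<close>

lemma npts_departures_eventually:
  assumes lf: "locally_finite A" "locally_finite S" and ab: "a < b"
  shows "eventually (\<lambda>n. npts (departures A S) {a<..b} =
    (\<Sum>k<Suc n. cell_departures A S (a + real k * ((b - a) / Suc n)) (a + real (Suc k) * ((b - a) / Suc n))))
    sequentially"
proof -
  obtain e where e: "e > 0"
    "\<And>p q. p \<in> {a<..b} \<Longrightarrow> q \<in> {a<..b} \<Longrightarrow> A p + S p \<noteq> 0 \<Longrightarrow> A q + S q \<noteq> 0 \<Longrightarrow> \<bar>p - q\<bar> < e \<Longrightarrow> p = q"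
    using locally_finite_separated[OF locally_finite_add[OF lf], of a b] by blast
  have "(\<lambda>n. (b - a) / Suc n) \<longlonglongrightarrow> 0"
    using tendsto_mult_right_zero[OF LIMSEQ_inverse_real_of_nat, of "b - a"] by (simp add: divide_inverse)
  then have "eventually (\<lambda>n. (b - a) / Suc n < e) sequentially"
    using e(1) by (rule order_tendstoD)
  then show ?thesis
  proof eventually_elim
    case (elim n)
    define h where "h = (b - a) / Suc n"
    have h: "h > 0" "h < e" "real (Suc n) * h = b - a" using ab elim by (simp_all add: h_def)
    have b: "b = a + real (Suc n) * h" using h by simp
    have "npts (departures A S) {a<..b} = (\<Sum>k<Suc n. npts (departures A S) {a + real k * h<..a + real (Suc k) * h})"
      unfolding b by (rule npts_cells) (use h lf in \<open>simp_all add: locally_finite_departures\<close>)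
    also have "\<dots> = (\<Sum>k<Suc n. cell_departures A S (a + real k * h) (a + real (Suc k) * h))"
    proof (rule sum.cong[OF refl])
      fix k assume "k \<in> {..<Suc n}"
      then have "real (Suc k) * h \<le> real (Suc n) * h" using h by (intro mult_right_mono) auto
      then have k: "0 \<le> real k * h" "a + real (Suc k) * h \<le> b" using h(1) b by simp_all
      have uv: "a + real k * h < a + real (Suc k) * h" using h by simp
      have len: "real (Suc k) * h = real k * h + h" by (simp add: algebra_simps)
      obtain p where "concentrated (\<lambda>t. A t + S t) (a + real k * h) (a + real (Suc k) * h) p"
      proof (rule concentrated_if_separated[OF uv])
        fix p q assume "a + real k * h < p" "p \<le> a + real (Suc k) * h"
          "a + real k * h < q" "q \<le> a + real (Suc k) * h" "A p + S p \<noteq> 0" "A q + S q \<noteq> 0"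
        then show "p = q"
          using k len h(2) by (intro e(2)) (simp_all only: greaterThanAtMost_iff not_False_eq_True, linarith+)
      qed blast
      then show "npts (departures A S) {a + real k * h<..a + real (Suc k) * h} =
        cell_departures A S (a + real k * h) (a + real (Suc k) * h)"
        by (intro cell_departures[OF lf]) (auto simp: concentrated_add)
    qed
    finally show ?case by (simp add: h_def)
  qed
qed

lemma measurable_departures [measurable]:
  assumes [measurable]: "f \<in> N \<rightarrow>\<^sub>M config_space" "g \<in> N \<rightarrow>\<^sub>M config_space"
  shows "(\<lambda>w. departures (f w) (g w)) \<in> N \<rightarrow>\<^sub>M config_space"
proof (rule measurable_configI)
  note lf = assms[THEN measurable_config_locally_finite]
  show "locally_finite (departures (f w) (g w))" if "w \<in> space N" for w
    using lf(2)[OF that] by (rule locally_finite_departures)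
  fix a b :: real assume ab: "a < b"
  define c where "c n w = (\<Sum>k<Suc n. cell_departures (f w) (g w)
    (a + real k * ((b - a) / Suc n)) (a + real (Suc k) * ((b - a) / Suc n)))" for n w
  have [measurable]: "c n \<in> N \<rightarrow>\<^sub>M count_space UNIV" for n
    unfolding c_def by measurable
  have ev: "eventually (\<lambda>n. npts (departures (f w) (g w)) {a<..b} = c n w) sequentially"
    if "w \<in> space N" for w
    unfolding c_def by (rule npts_departures_eventually[OF lf[OF that] ab])
  \<comment> \<open>The approximations are eventually constant, so a level set of the limit is a
    countable union of countable intersections of level sets of \<open>c n\<close>.\<close>
  have lim: "npts (departures (f w) (g w)) {a<..b} = k \<longleftrightarrow> (\<exists>n0. \<forall>n\<ge>n0. c n w = k)"
    if "w \<in> space N" for w k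
    using ev[OF that] unfolding eventually_sequentially by (metis nle_le)
  show "(\<lambda>w. npts (departures (f w) (g w)) {a<..b}) \<in> N \<rightarrow>\<^sub>M count_space UNIV"
  proof (rule measurable_count_space_eq2_countable[THEN iffD2])
    have "(\<lambda>w. npts (departures (f w) (g w)) {a<..b}) -` {k} \<inter> space N \<in> sets N" for k
    proof -
      have "(\<lambda>w. npts (departures (f w) (g w)) {a<..b}) -` {k} \<inter> space N =
        {w \<in> space N. \<exists>n0. \<forall>n\<ge>n0. c n w = k}"
        using lim by auto
      also have "\<dots> \<in> sets N"
      proof -
        have "Measurable.pred N (\<lambda>w. c n w = k)" for n
          by (rule measurable_compose[of "c n" N "count_space UNIV"]) simp_all
        then have "Measurable.pred N (\<lambda>w. \<exists>n0. \<forall>n\<in>{n0..}. c n w = k)"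
          by (intro pred_intros_countable pred_intros_countable_bounded) simp_all
        then show ?thesis by (simp add: pred_def Ball_def)
      qed
      finally show ?thesis .
    qed
    then show "(\<lambda>w. npts (departures (f w) (g w)) {a<..b}) \<in> space N \<rightarrow> UNIV \<and>
      (\<forall>k\<in>UNIV. (\<lambda>w. npts (departures (f w) (g w)) {a<..b}) -` {k} \<inter> space N \<in> sets N)"
      by simp
  qed
qed

lemma measurable_dual_service [measurable]:
  assumes [measurable]: "f \<in> N \<rightarrow>\<^sub>M config_space" "g \<in> N \<rightarrow>\<^sub>M config_space"
  shows "(\<lambda>w. dual_service (f w) (g w)) \<in> N \<rightarrow>\<^sub>M config_space"
  unfolding dual_service_def
  by (rule measurable_config_diff)
    (auto intro: trans_le_add2 departures_le_service)

section \<open>The queue in discrete time\<close>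

text \<open>The contents of a good slot: nothing, one arrival, or one service. The pair
  \<open>(1, 1)\<close> is excluded, since the order of the two points inside the slot would
  matter.\<close>

definition marks :: "(nat \<times> nat) set" where "marks = {(0, 0), (1, 0), (0, 1)}"

definition queue_step :: "nat \<Rightarrow> nat \<times> nat \<Rightarrow> nat" where
  "queue_step q m = q + fst m - snd m"

definition queue_out :: "nat \<Rightarrow> nat \<times> nat \<Rightarrow> nat \<times> nat" where
  "queue_out q m = (serve q (fst m) (snd m), fst m + snd m - serve q (fst m) (snd m))"

text \<open>In the lists of slots below the latest slot comes first.\<close>

fun queue_run :: "nat \<Rightarrow> (nat \<times> nat) list \<Rightarrow> nat" where
  "queue_run q [] = q"
| "queue_run q (m # ws) = queue_step (queue_run q ws) m"

fun queue_outs :: "nat \<Rightarrow> (nat \<times> nat) list \<Rightarrow> (nat \<times> nat) list" where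
  "queue_outs q [] = []"
| "queue_outs q (m # ws) = queue_out (queue_run q ws) m # queue_outs q ws"

fun slot_weight :: "(nat \<Rightarrow> nat \<times> nat \<Rightarrow> ennreal) \<Rightarrow> (nat \<times> nat) list \<Rightarrow> ennreal" where
  "slot_weight wt [] = 1"
| "slot_weight wt (m # ws) = wt (length ws) m * slot_weight wt ws"

definition mark_lists :: "nat \<Rightarrow> (nat \<times> nat) list set" where
  "mark_lists N = {ws. set ws \<subseteq> marks \<and> length ws = N}"

lemma finite_marks: "finite marks" by (simp add: marks_def)

lemma finite_mark_lists: "finite (mark_lists N)"
  unfolding mark_lists_def by (rule finite_lists_length_eq[OF finite_marks])

lemma mark_lists_0: "mark_lists 0 = {[]}"
  by (auto simp: mark_lists_def)

lemma sum_mark_lists_Suc: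
  fixes f :: "(nat \<times> nat) list \<Rightarrow> 'b::comm_monoid_add"
  shows "(\<Sum>ws\<in>mark_lists (Suc N). f ws) = (\<Sum>ws\<in>mark_lists N. \<Sum>m\<in>marks. f (m # ws))"
proof -
  have eq: "mark_lists (Suc N) = (\<lambda>(ws, m). m # ws) ` (mark_lists N \<times> marks)"
    by (auto simp: mark_lists_def length_Suc_conv image_iff)
  have "inj_on (\<lambda>(ws, m). m # ws) (mark_lists N \<times> marks)"
    by (auto simp: inj_on_def)
  then show ?thesis unfolding eq
    by (subst sum.reindex) (auto simp: sum.cartesian_product case_prod_unfold)
qed

lemma nn_integral_geometric_pmf:
  assumes "0 < r" "r < 1"
  shows "(\<integral>\<^sup>+q. f q \<partial>geometric_pmf (1 - r)) = (\<Sum>q. ennreal ((1 - r) * r ^ q) * f q)"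
  using assms by (simp add: nn_integral_measure_pmf nn_integral_count_space_nat mult.commute)

lemma suminf_split_head_ennreal:
  fixes h :: "nat \<Rightarrow> ennreal"
  shows "(\<Sum>q. h q) = (\<Sum>q. h (Suc q)) + h 0"
proof -
  have "(\<lambda>q. h (Suc q)) sums (\<Sum>q. h (Suc q))" by (rule summable_sums) simp
  from sums_unique[OF sums_Suc[OF this]] show ?thesis by simp
qed

text \<open>With success probability \<open>1 - r\<close> the mass at \<open>q\<close> is
  \<open>(1 - r) * r ^ q\<close>, so each mass is \<open>r\<close> times the previous one.\<close>

lemma nn_integral_geometric_pmf_shift:
  fixes f :: "nat \<Rightarrow> ennreal"
  assumes r: "0 < r" "r < 1"
  shows "(\<integral>\<^sup>+q. f q \<partial>geometric_pmf (1 - r)) =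
    ennreal (1 - r) * f 0 + ennreal r * (\<integral>\<^sup>+q. f (Suc q) \<partial>geometric_pmf (1 - r))"
proof -
  have "(\<Sum>q. ennreal ((1 - r) * r ^ q) * f q) =
    (\<Sum>q. ennreal ((1 - r) * r ^ Suc q) * f (Suc q)) + ennreal (1 - r) * f 0"
    using suminf_split_head_ennreal[of "\<lambda>q. ennreal ((1 - r) * r ^ q) * f q"] by simp
  moreover have "ennreal ((1 - r) * r ^ Suc q) * f (Suc q) = ennreal r * (ennreal ((1 - r) * r ^ q) * f (Suc q))" for q
    using r by (simp add: ennreal_mult[symmetric] mult.assoc[symmetric]) (simp add: mult_ac)
  ultimately show ?thesis
    using r by (simp add: nn_integral_geometric_pmf ennreal_suminf_cmult add.commute)
qed

text \<open>One step sends (length, slot) bijectively to (output slot, new length): an empty slot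
  changes nothing, \<open>(q, (1, 0))\<close> goes to \<open>((0, 1), q + 1)\<close>,
  \<open>(q + 1, (0, 1))\<close> goes to \<open>((1, 0), q)\<close>, and \<open>(0, (0, 1))\<close>
  to \<open>((0, 1), 0)\<close>. Geometric mass times \<open>wt\<close> is preserved because an
  arrival weighs \<open>r\<close> times as much as a service and length \<open>q + 1\<close> weighs
  \<open>r\<close> times as much as length \<open>q\<close>.\<close>

lemma queue_step_invariant:
  fixes G :: "nat \<times> nat \<Rightarrow> nat \<Rightarrow> ennreal" and wt :: "nat \<times> nat \<Rightarrow> ennreal"
  assumes r: "0 < r" "r < 1" and wt: "wt (1, 0) = ennreal r * wt (0, 1)"
  shows "(\<integral>\<^sup>+q. (\<Sum>m\<in>marks. wt m * G (queue_out q m) (queue_step q m)) \<partial>geometric_pmf (1 - r)) =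
    (\<integral>\<^sup>+q. (\<Sum>m\<in>marks. wt m * G m q) \<partial>geometric_pmf (1 - r))"
proof -
  let ?I = "\<lambda>f. (\<integral>\<^sup>+q. f q \<partial>geometric_pmf (1 - r))"
  have sm: "(\<Sum>m\<in>marks. f m) = f (0, 0) + f (1, 0) + f (0, 1)" for f :: "nat \<times> nat \<Rightarrow> ennreal"
    by (simp add: marks_def add.assoc)
  define H where "H q = (if q = 0 then G (0, 1) 0 else G (1, 0) (q - 1))" for q
  have out: "queue_out q (0, 0) = (0, 0)" "queue_step q (0, 0) = q"
    "queue_out q (1, 0) = (0, 1)" "queue_step q (1, 0) = Suc q" for q
    by (simp_all add: queue_out_def queue_step_def serve_def)
  have H: "G (queue_out q (0, 1)) (queue_step q (0, 1)) = H q" for q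
    by (simp add: queue_out_def queue_step_def serve_def H_def)
  have cm: "?I (\<lambda>q. c * f q) = c * ?I f" for c :: ennreal and f
    by (rule nn_integral_cmult) simp
  have ad: "?I (\<lambda>q. f q + g q) = ?I f + ?I g" for f g :: "nat \<Rightarrow> ennreal"
    by (rule nn_integral_add) simp_all
  have "?I H = ennreal (1 - r) * G (0, 1) 0 + ennreal r * ?I (G (1, 0))"
    by (subst nn_integral_geometric_pmf_shift[OF r]) (simp add: H_def)
  moreover have "?I (G (0, 1)) = ennreal (1 - r) * G (0, 1) 0 + ennreal r * ?I (\<lambda>q. G (0, 1) (Suc q))"
    by (rule nn_integral_geometric_pmf_shift[OF r])
  ultimately show ?thesis
    unfolding sm out H ad cm wt by (simp add: algebra_simps)
qed

text \<open>Letting \<open>F\<close> depend on the final length as well makes the induction work: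
  after each slot the new length is again geometric and independent of the output so far, hence a
  valid start for the next slot. The weights may vary with the slot; only their ratio
  \<open>r\<close> is common.\<close>

theorem queue_run_invariant:
  fixes F :: "(nat \<times> nat) list \<Rightarrow> nat \<Rightarrow> ennreal"
  assumes r: "0 < r" "r < 1" and wt: "\<And>k. wt k (1, 0) = ennreal r * wt k (0, 1)"
  shows "(\<integral>\<^sup>+q. (\<Sum>ws\<in>mark_lists N. slot_weight wt ws * F (queue_outs q ws) (queue_run q ws))
      \<partial>geometric_pmf (1 - r)) =
    (\<integral>\<^sup>+q. (\<Sum>ws\<in>mark_lists N. slot_weight wt ws * F ws q) \<partial>geometric_pmf (1 - r))"
proof (induction N arbitrary: F)
  case 0
  show ?case by (simp add: mark_lists_0)
next
  case (Suc N)
  let ?I = "\<lambda>f. (\<integral>\<^sup>+q. f q \<partial>geometric_pmf (1 - r))"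
  have len: "length ws = N" if "ws \<in> mark_lists N" for ws using that by (simp add: mark_lists_def)
  \<comment> \<open>The contribution of the latest slot is summed out, which leaves a functional of
    the first \<open>N\<close> slots and of the length after them.\<close>
  define F' where "F' v q = (\<Sum>m\<in>marks. wt N m * F (queue_out q m # v) (queue_step q m))" for v q
  have "?I (\<lambda>q. \<Sum>ws\<in>mark_lists (Suc N). slot_weight wt ws * F (queue_outs q ws) (queue_run q ws)) =
    ?I (\<lambda>q. \<Sum>ws\<in>mark_lists N. slot_weight wt ws * F' (queue_outs q ws) (queue_run q ws))"
    by (simp add: sum_mark_lists_Suc F'_def sum_distrib_left len mult_ac cong: sum.cong)
  also have "\<dots> = ?I (\<lambda>q. \<Sum>ws\<in>mark_lists N. slot_weight wt ws * F' ws q)"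
    by (rule Suc.IH)
  also have "\<dots> = (\<Sum>ws\<in>mark_lists N. slot_weight wt ws * ?I (F' ws))"
    by (subst nn_integral_sum) (simp_all add: nn_integral_cmult)
  also have "\<dots> = (\<Sum>ws\<in>mark_lists N. slot_weight wt ws * ?I (\<lambda>q. \<Sum>m\<in>marks. wt N m * F (m # ws) q))"
    unfolding F'_def
    by (intro sum.cong refl arg_cong2[where f="(*)"]
      queue_step_invariant[OF r wt, where G="\<lambda>m q. F (m # _) q"])
  also have "\<dots> = ?I (\<lambda>q. \<Sum>ws\<in>mark_lists N. slot_weight wt ws * (\<Sum>m\<in>marks. wt N m * F (m # ws) q))"
    by (subst nn_integral_sum) (simp_all add: nn_integral_cmult)
  also have "\<dots> = ?I (\<lambda>q. \<Sum>ws\<in>mark_lists (Suc N). slot_weight wt ws * F ws q)"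
    by (simp add: sum_mark_lists_Suc sum_distrib_left len mult_ac cong: sum.cong)
  finally show ?case .
qed

section \<open>Poisson counts in slots\<close>

fun slot_counts :: "(nat \<Rightarrow> real) \<Rightarrow> nat \<Rightarrow> config \<Rightarrow> config \<Rightarrow> (nat \<times> nat) list" where
  "slot_counts g 0 x y = []"
| "slot_counts g (Suc N) x y =
    (npts x {g N<..g (Suc N)}, npts y {g N<..g (Suc N)}) # slot_counts g N x y"

lemma length_slot_counts [simp]: "length (slot_counts g N x y) = N"
  by (induction N) auto

lemma rev_nth_slot_counts:
  "k < N \<Longrightarrow> rev (slot_counts g N x y) ! k = (npts x {g k<..g (Suc k)}, npts y {g k<..g (Suc k)})"
  by (induction N) (auto simp: nth_append less_Suc_eq)

lemma slot_counts_eq_iff: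
  assumes "length ws = N"
  shows "slot_counts g N x y = ws \<longleftrightarrow>
    (\<forall>k<N. npts x {g k<..g (Suc k)} = fst (rev ws ! k) \<and> npts y {g k<..g (Suc k)} = snd (rev ws ! k))"
proof -
  have "slot_counts g N x y = ws \<longleftrightarrow> rev (slot_counts g N x y) = rev ws" by simp
  also have "\<dots> \<longleftrightarrow> (\<forall>k<N. rev (slot_counts g N x y) ! k = rev ws ! k)"
    using assms by (subst list_eq_iff_nth_eq) auto
  finally show ?thesis by (auto simp: rev_nth_slot_counts prod_eq_iff)
qed

lemma slot_counts_in_mark_lists:
  "slot_counts g N x y \<in> mark_lists N \<longleftrightarrow>
    (\<forall>k<N. (npts x {g k<..g (Suc k)}, npts y {g k<..g (Suc k)}) \<in> marks)"
proof -
  have "set (slot_counts g N x y) = (\<lambda>k. (npts x {g k<..g (Suc k)}, npts y {g k<..g (Suc k)})) ` {..<N}"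
    by (induction N) (auto simp: lessThan_Suc)
  then show ?thesis by (auto simp: mark_lists_def)
qed

lemma singleton_in_mark_lists [simp]: "[m] \<in> mark_lists (Suc 0) \<longleftrightarrow> m \<in> marks"
  by (simp add: mark_lists_def)

lemma slot_weight_eq_prod: "slot_weight wt ws = (\<Prod>k<length ws. wt k (rev ws ! k))"
proof (induction ws)
  case (Cons m ws)
  have "(\<Prod>k<length ws. wt k (rev (m # ws) ! k)) = (\<Prod>k<length ws. wt k (rev ws ! k))"
    by (intro prod.cong refl) (simp add: nth_append)
  then show ?case using Cons by (simp add: nth_append mult.commute)
qed simp

lemma measurable_slot_counts [measurable (raw)]:
  assumes "f \<in> M \<rightarrow>\<^sub>M config_space" "h \<in> M \<rightarrow>\<^sub>M config_space"
  shows "(\<lambda>w. slot_counts g N (f w) (h w)) \<in> M \<rightarrow>\<^sub>M count_space UNIV"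
proof (induction N)
  case (Suc N)
  show ?case unfolding slot_counts.simps
    by (intro measurable_countable_binary[where h="(#)"] measurable_countable_binary[where h=Pair]
        measurable_npts assms Suc)
qed simp

lemma poisson_process_law_prob_space: "poisson_process_law r P \<Longrightarrow> prob_space P"
  and poisson_process_law_sets: "poisson_process_law r P \<Longrightarrow> sets P = sets config_space"
  by (simp_all add: poisson_process_law_def)

lemma poisson_process_law_space: "poisson_process_law r P \<Longrightarrow> space P = {x. locally_finite x}"
  using sets_eq_imp_space_eq[OF poisson_process_law_sets] by (simp add: space_config_space)

lemma poisson_process_law_measurable:
  "poisson_process_law r P \<Longrightarrow> (\<lambda>x. npts x {a<..b}) \<in> P \<rightarrow>\<^sub>M count_space UNIV"
  using measurable_npts_config measurable_cong_sets[OF poisson_process_law_sets refl] by blast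

lemma poisson_process_law_count:
  assumes P: "poisson_process_law r P" and ab: "a < b"
  shows "measure P ((\<lambda>x. npts x {a<..b}) -` {n} \<inter> space P) = pmf (poisson_pmf (r * (b - a))) n"
proof -
  have d: "distr P (count_space UNIV) (\<lambda>x. npts x {a<..b}) = measure_pmf (poisson_pmf (r * (b - a)))"
    using P ab by (simp add: poisson_process_law_def)
  have "measure P ((\<lambda>x. npts x {a<..b}) -` {n} \<inter> space P) =
    measure (distr P (count_space UNIV) (\<lambda>x. npts x {a<..b})) {n}"
    by (rule measure_distr[symmetric]) (simp_all add: poisson_process_law_measurable[OF P])
  then show ?thesis by (simp add: d pmf.rep_eq)
qed

lemma poisson_process_law_slots:
  assumes P: "poisson_process_law r P" and g: "strict_mono g"
  shows "measure P {x \<in> space P. \<forall>k<N. npts x {g k<..g (Suc k)} = n k} =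
    (\<Prod>k<N. pmf (poisson_pmf (r * (g (Suc k) - g k))) (n k))"
proof (cases "N = 0")
  case True
  interpret prob_space P by (rule poisson_process_law_prob_space[OF P])
  show ?thesis using True by (simp add: prob_space)
next
  case False
  interpret prob_space P by (rule poisson_process_law_prob_space[OF P])
  have ind: "indep_vars (\<lambda>_. count_space UNIV) (\<lambda>i x. npts x {g i<..g (Suc i)}) UNIV"
    using P g by (simp add: poisson_process_law_def)
  have "measure P {x \<in> space P. \<forall>k<N. npts x {g k<..g (Suc k)} = n k} =
    prob (\<Inter>k\<in>{..<N}. (\<lambda>x. npts x {g k<..g (Suc k)}) -` {n k} \<inter> space P)"
    using False by (intro arg_cong[where f=prob]) auto
  also have "\<dots> = (\<Prod>k<N. prob ((\<lambda>x. npts x {g k<..g (Suc k)}) -` {n k} \<inter> space P))"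
    by (rule indep_varsD[OF ind]) (use False in auto)
  also have "\<dots> = (\<Prod>k<N. pmf (poisson_pmf (r * (g (Suc k) - g k))) (n k))"
    using strict_monoD[OF g] by (intro prod.cong refl poisson_process_law_count[OF P]) auto
  finally show ?thesis .
qed

section \<open>Two independent Poisson processes seen through slots\<close>

locale poisson_pair =
  fixes lam mu :: real and P1 P2 :: "config measure"
  assumes lam: "0 < lam" and mu: "lam < mu"
    and P1: "poisson_process_law lam P1" and P2: "poisson_process_law mu P2"
begin

sublocale P1: prob_space P1 by (rule poisson_process_law_prob_space[OF P1])
sublocale P2: prob_space P2 by (rule poisson_process_law_prob_space[OF P2])
sublocale pair_prob_space P1 P2 ..

abbreviation "Pr \<equiv> P1 \<Otimes>\<^sub>M P2"

lemma sets_P [measurable_cong]: "sets P1 = sets config_space" "sets P2 = sets config_space"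
  by (rule poisson_process_law_sets[OF P1] poisson_process_law_sets[OF P2])+

lemma space_P: "space P1 = {x. locally_finite x}" "space P2 = {x. locally_finite x}"
  by (rule poisson_process_law_space[OF P1] poisson_process_law_space[OF P2])+

lemma space_Pr: "space Pr = {x. locally_finite x} \<times> {x. locally_finite x}"
  by (simp add: space_pair_measure space_P)

lemma fst_measurable [measurable]: "fst \<in> Pr \<rightarrow>\<^sub>M config_space"
  and snd_measurable [measurable]: "snd \<in> Pr \<rightarrow>\<^sub>M config_space"
  using measurable_fst[of P1 P2] measurable_snd[of P1 P2] measurable_cong_sets[OF refl sets_P(1)]
    measurable_cong_sets[OF refl sets_P(2)] by auto

definition wt :: "(nat \<Rightarrow> real) \<Rightarrow> nat \<Rightarrow> nat \<times> nat \<Rightarrow> ennreal" where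
  "wt g k m = ennreal (pmf (poisson_pmf (lam * (g (Suc k) - g k))) (fst m) *
     pmf (poisson_pmf (mu * (g (Suc k) - g k))) (snd m))"

definition "counts g N w = slot_counts g N (fst w) (snd w)"

lemma measurable_counts [measurable]: "counts g N \<in> Pr \<rightarrow>\<^sub>M count_space UNIV"
  unfolding counts_def[abs_def] by (intro measurable_slot_counts fst_measurable snd_measurable)

lemma emeasure_counts_eq:
  assumes g: "strict_mono g" and len: "length ws = N"
  shows "emeasure Pr {w \<in> space Pr. counts g N w = ws} = slot_weight (wt g) ws"
proof -
  let ?A = "{x \<in> space P1. \<forall>k<N. npts x {g k<..g (Suc k)} = fst (rev ws ! k)}"
  let ?B = "{x \<in> space P2. \<forall>k<N. npts x {g k<..g (Suc k)} = snd (rev ws ! k)}"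
  have "{x \<in> space config_space. \<forall>k<N. npts x {g k<..g (Suc k)} = n k} \<in> sets config_space" for n
  proof -
    have "Measurable.pred config_space (\<lambda>x. npts x {g k<..g (Suc k)} = n k)" for k
      by (rule measurable_compose[OF measurable_npts_config]) simp
    then have "Measurable.pred config_space (\<lambda>x. \<forall>k\<in>{..<N}. npts x {g k<..g (Suc k)} = n k)"
      by (intro pred_intros_countable_bounded) auto
    then show ?thesis by (simp add: pred_def)
  qed
  then have m: "?A \<in> sets P1" "?B \<in> sets P2"
    by (simp_all add: sets_P space_P space_config_space)
  have "{w \<in> space Pr. counts g N w = ws} = ?A \<times> ?B"
    by (auto simp: counts_def slot_counts_eq_iff[OF len] space_pair_measure)
  then have "emeasure Pr {w \<in> space Pr. counts g N w = ws} = emeasure P1 ?A * emeasure P2 ?B"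
    using m by (simp add: P2.emeasure_pair_measure_Times)
  also have "\<dots> = ennreal (measure P1 ?A * measure P2 ?B)"
    by (simp add: P1.emeasure_eq_measure P2.emeasure_eq_measure ennreal_mult)
  also have "\<dots> = slot_weight (wt g) ws"
    unfolding poisson_process_law_slots[OF P1 g] poisson_process_law_slots[OF P2 g]
      prod.distrib[symmetric]
    by (simp add: slot_weight_eq_prod len wt_def prod_ennreal)
  finally show ?thesis .
qed

text \<open>For a slot of length \<open>d\<close> both probabilities share the factor
  \<open>d * exp (- (lam + mu) * d)\<close>. The ratio of what remains is the same for slots of all
  lengths, so a single geometric law serves irregular grids.\<close>

lemma wt_ratio:
  assumes g: "strict_mono g"
  shows "wt g k (1, 0) = ennreal (lam / mu) * wt g k (0, 1)"
proof -
  define d where "d = g (Suc k) - g k"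
  have "d > 0" using strict_monoD[OF g, of k "Suc k"] by (simp add: d_def)
  then have 1: "wt g k (1, 0) = ennreal (lam * d * exp (- (lam * d)) * exp (- (mu * d)))"
    "wt g k (0, 1) = ennreal (exp (- (lam * d)) * (mu * d * exp (- (mu * d))))"
    using lam mu by (simp_all add: wt_def d_def[symmetric])
  have 2: "lam * d * exp (- (lam * d)) * exp (- (mu * d)) =
    (lam / mu) * (exp (- (lam * d)) * (mu * d * exp (- (mu * d))))"
    using lam mu by simp
  show ?thesis
    unfolding 1 2 by (rule ennreal_mult) (use lam mu \<open>d > 0\<close> in simp_all)
qed

lemma emeasure_counts_finite:
  assumes g: "strict_mono g"
  shows "emeasure Pr {w \<in> space Pr. counts g N w \<in> mark_lists N \<and> Q (counts g N w)} =
    (\<Sum>ws\<in>mark_lists N. slot_weight (wt g) ws * of_bool (Q ws))"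
proof -
  let ?B = "{ws \<in> mark_lists N. Q ws}"
  let ?E = "\<lambda>ws. {w \<in> space Pr. counts g N w = ws}"
  have E: "?E ws \<in> sets Pr" for ws
    using measurable_sets[OF measurable_counts[of g N], of "{ws}"]
    by (simp add: vimage_def Int_def conj_commute)
  have "{w \<in> space Pr. counts g N w \<in> mark_lists N \<and> Q (counts g N w)} = (\<Union>ws\<in>?B. ?E ws)"
    by auto
  also have "emeasure Pr \<dots> = (\<Sum>ws\<in>?B. emeasure Pr (?E ws))"
    using E finite_mark_lists by (intro sum_emeasure[symmetric]) (auto simp: disjoint_family_on_def)
  also have "\<dots> = (\<Sum>ws\<in>?B. slot_weight (wt g) ws)"
    by (intro sum.cong refl emeasure_counts_eq[OF g]) (simp add: mark_lists_def)
  also have "\<dots> = (\<Sum>ws\<in>mark_lists N. slot_weight (wt g) ws * of_bool (Q ws))"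
    using finite_mark_lists by (intro sum.mono_neutral_cong_left) auto
  finally show ?thesis .
qed

text \<open>Averaging over \<open>q\<close> outside the probability makes the initial length
  independent of both processes. Each side is cut down to the event that all slots are good, where
  the discrete invariance applies.\<close>

theorem counts_invariant:
  assumes g: "strict_mono g"
  shows "(\<integral>\<^sup>+q. emeasure Pr {w \<in> space Pr. counts g N w \<in> mark_lists N \<and> Q (queue_outs q (counts g N w))}
      \<partial>geometric_pmf (1 - lam / mu)) =
    emeasure Pr {w \<in> space Pr. counts g N w \<in> mark_lists N \<and> Q (counts g N w)}"
proof -
  have r: "0 < lam / mu" "lam / mu < 1" using lam mu by simp_all
  show ?thesis
    unfolding emeasure_counts_finite[OF g, of N "\<lambda>ws. Q (queue_outs _ ws)"]
      emeasure_counts_finite[OF g, of N Q]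
    using queue_run_invariant[where wt="wt g" and N=N and F="\<lambda>ws q. of_bool (Q ws)", OF r wt_ratio[OF g]]
    by (simp add: measure_pmf.emeasure_space_1)
qed

text \<open>The number of points of both processes in a slot is Poisson with mean \<open>c\<close>,
  so the slot is good with probability \<open>exp (- c) * (1 + c)\<close>.\<close>

lemma one_slot_not_marks:
  assumes g: "strict_mono g"
  shows "measure Pr {w \<in> space Pr. counts g 1 w \<notin> mark_lists 1} \<le> ((lam + mu) * (g 1 - g 0))\<^sup>2"
proof -
  define c where "c = (lam + mu) * (g 1 - g 0)"
  have c: "c \<ge> 0" "g 0 < g 1" using lam mu strict_monoD[OF g, of 0 1] by (auto simp: c_def)
  have sm: "(\<Sum>m\<in>marks. f m) = f (0, 0) + f (1, 0) + f (0, 1)" for f :: "nat \<times> nat \<Rightarrow> ennreal"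
    by (simp add: marks_def add.assoc)
  have "emeasure Pr {w \<in> space Pr. counts g 1 w \<in> mark_lists 1 \<and> True} = (\<Sum>m\<in>marks. wt g 0 m)"
    using emeasure_counts_finite[OF g, of 1 "\<lambda>_. True"] by (simp add: sum_mark_lists_Suc mark_lists_0)
  also have "\<dots> = ennreal (exp (- c) * (1 + c))"
  proof -
    define d where "d = g 1 - g 0"
    have d: "d > 0" using c by (simp add: d_def)
    then have ld: "lam * d > 0" "mu * d > 0" using lam mu by simp_all
    have e: "exp (- c) = exp (- (lam * d)) * exp (- (mu * d))"
      by (simp add: c_def d_def exp_add[symmetric] algebra_simps)
    have "wt g 0 (0, 0) = ennreal (exp (- c))" "wt g 0 (1, 0) = ennreal (exp (- c) * (lam * d))"
      "wt g 0 (0, 1) = ennreal (exp (- c) * (mu * d))"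
      using pmf_poisson[OF ld(1)] pmf_poisson[OF ld(2)]
      by (simp_all add: wt_def e d_def[symmetric] flip: One_nat_def) (simp_all add: mult_ac)
    then have "(\<Sum>m\<in>marks. wt g 0 m) = ennreal (exp (- c) + exp (- c) * (lam * d) + exp (- c) * (mu * d))"
      using d lam mu by (simp add: sm)
    then show ?thesis by (simp add: c_def d_def[symmetric] algebra_simps flip: One_nat_def)
  qed
  finally have "measure Pr {w \<in> space Pr. counts g 1 w \<in> mark_lists 1} = exp (- c) * (1 + c)"
    using c by (simp add: P.emeasure_eq_measure)
  moreover have "measure Pr (space Pr - {w \<in> space Pr. counts g 1 w \<in> mark_lists 1}) =
      1 - measure Pr {w \<in> space Pr. counts g 1 w \<in> mark_lists 1}"
    using measurable_sets[OF measurable_counts[of g 1], of "mark_lists 1"]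
    by (intro P.prob_compl) (simp add: vimage_def Int_def conj_commute)
  moreover have "space Pr - {w \<in> space Pr. counts g 1 w \<in> mark_lists 1} =
      {w \<in> space Pr. counts g 1 w \<notin> mark_lists 1}" by auto
  \<comment> \<open>The bound \<open>1 - c \<le> exp (- c)\<close> yields a failure probability of
    second order in the slot length; summed over a fine grid this is small.\<close>
  moreover have "(1 + (- c)) * (1 + c) \<le> exp (- c) * (1 + c)"
    using c exp_ge_add_one_self[of "- c"] by (intro mult_right_mono) auto
  moreover have "(1 + (- c)) * (1 + c) = 1 - c\<^sup>2" by (simp add: power2_eq_square algebra_simps)
  ultimately have "measure Pr {w \<in> space Pr. counts g 1 w \<notin> mark_lists 1} = 1 - exp (- c) * (1 + c)"
      "1 - c\<^sup>2 \<le> exp (- c) * (1 + c)" by simp_all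
  then have "measure Pr {w \<in> space Pr. counts g 1 w \<notin> mark_lists 1} \<le> c\<^sup>2" by linarith
  then show ?thesis by (simp add: c_def)
qed

lemma counts_not_marks:
  assumes g: "strict_mono g"
  shows "measure Pr {w \<in> space Pr. counts g N w \<notin> mark_lists N} \<le>
    (\<Sum>k<N. ((lam + mu) * (g (Suc k) - g k))\<^sup>2)"
proof -
  \<comment> \<open>Shifting the grid by \<open>k\<close> turns slot \<open>k\<close> into slot 0,
    so the bound for one slot applies to each.\<close>
  let ?E = "\<lambda>k. {w \<in> space Pr. counts (\<lambda>i. g (k + i)) 1 w \<notin> mark_lists 1}"
  have E: "?E k \<in> sets Pr" for k
    using measurable_sets[OF measurable_counts[of "\<lambda>i. g (k + i)" 1], of "- mark_lists 1"]
    by (simp add: vimage_def Int_def conj_commute)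
  have "{w \<in> space Pr. counts g N w \<notin> mark_lists N} = (\<Union>k<N. ?E k)"
    by (auto simp: counts_def slot_counts_in_mark_lists)
  also have "measure Pr \<dots> \<le> (\<Sum>k<N. measure Pr (?E k))"
    using E by (intro P.finite_measure_subadditive_finite) auto
  also have "\<dots> \<le> (\<Sum>k<N. ((lam + mu) * (g (Suc k) - g k))\<^sup>2)"
  proof (rule sum_mono)
    fix k
    have "strict_mono (\<lambda>i. g (k + i))" using g by (simp add: strict_mono_def)
    from one_slot_not_marks[OF this]
    show "measure Pr (?E k) \<le> ((lam + mu) * (g (Suc k) - g k))\<^sup>2" by simp
  qed
  finally show ?thesis .
qed

end

section \<open>Grids and negative drift\<close>

text \<open>The grid is the sorted union of \<open>F\<close> with a regular grid of step at most
  \<open>e\<close>; adding points cannot enlarge a gap.\<close>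

lemma grid_exists:
  fixes T e :: real
  assumes F: "finite F" "F \<subseteq> {- T..T}" and T: "T > 0" and e: "e > 0"
  obtains g :: "nat \<Rightarrow> real" and N where "strict_mono g" "g 0 = - T" "g N = T" "F \<subseteq> g ` {..N}"
    "\<And>k. k < N \<Longrightarrow> g (Suc k) - g k \<le> e"
proof -
  define n where "n = nat \<lceil>2 * T / e\<rceil> + 1"
  define h where "h = 2 * T / real n"
  have n: "real n > 0" "2 * T / e \<le> real n" unfolding n_def by linarith+
  have h: "h > 0" "h \<le> e" "real n * h = 2 * T"
    using n T e by (simp_all add: h_def field_simps)
  define L where "L = sorted_list_of_set (F \<union> (\<lambda>k. - T + real k * h) ` {..n})"
  have L: "set L = F \<union> (\<lambda>k. - T + real k * h) ` {..n}" "sorted_wrt (<) L"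
    using F(1) by (simp_all add: L_def)
  have T': "- T \<in> set L" "T \<in> set L"
  proof -
    have "- T + real 0 * h \<in> set L" "- T + real n * h \<in> set L"
      unfolding L(1) by (intro UnI2 imageI; simp)+
    then show "- T \<in> set L" "T \<in> set L" using h(3) by simp_all
  qed
  have bd: "- T \<le> p \<and> p \<le> T" if "p \<in> set L" for p
  proof -
    have "real k * h \<le> 2 * T" if "k \<le> n" for k
      using h that by (metis mult_right_mono of_nat_le_iff less_imp_le)
    then show ?thesis using that F(2) h(1) unfolding L(1) by auto
  qed
  define N where "N = length L - 1"
  have len: "length L = Suc N" using T'(1) unfolding N_def by (cases L) auto
  have lt: "L ! i < L ! j" if "i < j" "j \<le> N" for i j
    using L(2) that len by (simp add: sorted_wrt_nth_less)
  have lei: "i < j" if "L ! i < L ! j" "i \<le> N" "j \<le> N" for i j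
    using lt[of j i] that by (metis less_asym linorder_neqE_nat less_irrefl)
  have L0: "L ! 0 = - T"
  proof -
    obtain i where i: "i \<le> N" "L ! i = - T" using T'(1) len by (metis in_set_conv_nth less_Suc_eq_le)
    moreover have "- T \<le> L ! 0" using bd[of "L ! 0"] len by simp
    ultimately show ?thesis using lt[of 0 i] by (cases "i = 0") auto
  qed
  have LN: "L ! N = T"
  proof -
    obtain i where i: "i \<le> N" "L ! i = T" using T'(2) len by (metis in_set_conv_nth less_Suc_eq_le)
    moreover have "L ! N \<le> T" using bd[of "L ! N"] len by simp
    ultimately show ?thesis using lt[of i N] by (cases "i = N") auto
  qed
  \<comment> \<open>Beyond \<open>N\<close> the grid continues in unit steps merely to be strictly
    increasing on all natural numbers.\<close>
  define g where "g i = (if i \<le> N then L ! i else T + real (i - N))" for i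
  show ?thesis
  proof (rule that[of g N])
    show "strict_mono g"
      unfolding strict_mono_Suc_iff
    proof
      fix i
      consider "i < N" | "i = N" | "N < i" by linarith
      then show "g i < g (Suc i)"
        using lt[of i "Suc i"] LN by cases (auto simp: g_def)
    qed
    show "g 0 = - T" "g N = T" using L0 LN by (simp_all add: g_def)
    show "F \<subseteq> g ` {..N}"
    proof
      fix p assume "p \<in> F"
      then have "p \<in> set L" by (simp add: L(1))
      then obtain i where "i \<le> N" "L ! i = p" using len by (metis in_set_conv_nth less_Suc_eq_le)
      then show "p \<in> g ` {..N}" by (intro image_eqI[of _ _ i]) (auto simp: g_def)
    qed
    fix k assume k: "k < N"
    define x where "x = L ! k"
    have x: "x < T" "- T \<le> x" using lt[of k N] k LN bd[of x] len by (auto simp: x_def)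
    \<comment> \<open>The point \<open>x\<close> lies in cell \<open>i\<close> of the regular grid,
      whose right end is at most \<open>x + h\<close> and belongs to \<open>L\<close>; the successor
      of \<open>x\<close> in \<open>L\<close> cannot lie beyond it.\<close>
    define i where "i = nat \<lfloor>(x + T) / h\<rfloor>"
    have i: "real i \<le> (x + T) / h" "(x + T) / h < real (Suc i)"
    proof -
      have "0 \<le> (x + T) / h" using x h(1) by simp
      then have "real i = of_int \<lfloor>(x + T) / h\<rfloor>" by (simp add: i_def)
      then show "real i \<le> (x + T) / h" "(x + T) / h < real (Suc i)" by linarith+
    qed
    then have i': "real i * h \<le> x + T" "x + T < real (Suc i) * h"
      using h by (simp_all add: field_simps)
    have "real i * h < real n * h" using i'(1) x h by linarith
    then have "i < n" using h(1) by simp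
    then have "- T + real (Suc i) * h \<in> set L" unfolding L(1) by (intro UnI2 imageI) simp
    then obtain j where j: "j \<le> N" "L ! j = - T + real (Suc i) * h"
      using len by (metis in_set_conv_nth less_Suc_eq_le)
    have "k < j" using lei[of k j] i'(2) j k by (simp add: x_def)
    then have "L ! Suc k \<le> L ! j" using lt[of "Suc k" j] j by (cases "Suc k = j") auto
    then show "g (Suc k) - g k \<le> e"
      using k i'(1) j h(2) by (simp add: g_def x_def algebra_simps)
  qed
qed

section \<open>Exponential moments and almost sure negative drift\<close>

lemma nn_integral_power_poisson:
  assumes "0 < r" "0 \<le> z"
  shows "(\<integral>\<^sup>+n. ennreal (z ^ n) \<partial>poisson_pmf r) = ennreal (exp (r * (z - 1)))"
proof -
  have "(\<lambda>n. exp (- r) * ((r * z) ^ n /\<^sub>R fact n)) sums (exp (- r) * exp (r * z))"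
    by (intro sums_mult exp_converges)
  moreover have "exp (- r) * ((r * z) ^ n /\<^sub>R fact n) = pmf (poisson_pmf r) n * z ^ n" for n
    using assms by (simp add: power_mult_distrib divide_inverse)
  ultimately have "(\<lambda>n. pmf (poisson_pmf r) n * z ^ n) sums (exp (- r) * exp (r * z))"
    by (simp only:)
  moreover have "exp (- r) * exp (r * z) = exp (r * (z - 1))"
    by (simp add: exp_add[symmetric] algebra_simps)
  ultimately have "(\<lambda>n. pmf (poisson_pmf r) n * z ^ n) sums exp (r * (z - 1))"
    by (simp only:)
  then have "(\<Sum>n. ennreal (pmf (poisson_pmf r) n * z ^ n)) = ennreal (exp (r * (z - 1)))"
    using assms by (intro sums_unique[symmetric] sums_ennreal[THEN iffD2]) auto
  then show ?thesis
    using assms by (simp add: nn_integral_measure_pmf nn_integral_count_space_nat ennreal_mult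
        del: pmf_poisson)
qed

lemma poisson_process_law_moment:
  assumes P: "poisson_process_law r P" and r: "0 < r" and ab: "a < b" and z: "0 \<le> z"
  shows "(\<integral>\<^sup>+x. ennreal (z ^ npts x {a<..b}) \<partial>P) = ennreal (exp (r * (b - a) * (z - 1)))"
proof -
  have d: "distr P (count_space UNIV) (\<lambda>x. npts x {a<..b}) = measure_pmf (poisson_pmf (r * (b - a)))"
    using P ab by (simp add: poisson_process_law_def)
  have "(\<integral>\<^sup>+x. ennreal (z ^ npts x {a<..b}) \<partial>P) =
    (\<integral>\<^sup>+n. ennreal (z ^ n) \<partial>distr P (count_space UNIV) (\<lambda>x. npts x {a<..b}))"
    by (rule nn_integral_distr[symmetric]) (simp_all add: poisson_process_law_measurable[OF P])
  also have "\<dots> = ennreal (exp (r * (b - a) * (z - 1)))"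
    unfolding d using r ab z by (intro nn_integral_power_poisson) auto
  finally show ?thesis .
qed

text \<open>Negative drift, seen backwards in time along one path. The case \<open>K = 0\<close>
  gives a finite queue length, and a general \<open>K\<close> lets the queue forget an initial
  length \<open>K\<close>.\<close>

definition drains :: "config \<Rightarrow> config \<Rightarrow> bool" where
  "drains x y \<longleftrightarrow> (\<forall>t K. eventually (\<lambda>u. npts x {u<..t} + K \<le> npts y {u<..t}) at_bot)"

text \<open>Windows that start before \<open>M\<close> have no excess, and the excess of all others
  is at most the number of arrivals after \<open>M\<close>.\<close>

lemma drains_stable:
  assumes lf: "locally_finite x" "locally_finite y" and dr: "drains x y"
  shows "stable x y"
  unfolding stable_def
proof
  fix t
  have "eventually (\<lambda>u. npts x {u<..t} + 0 \<le> npts y {u<..t}) at_bot"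
    using dr unfolding drains_def by blast
  then obtain M where M: "\<And>u. u \<le> M \<Longrightarrow> npts x {u<..t} \<le> npts y {u<..t}"
    unfolding eventually_at_bot_linorder by auto
  have "npts x {u<..t} \<le> npts y {u<..t} + npts x {M<..t}" if "u \<le> t" for u
  proof (cases "u \<le> M")
    case True
    then show ?thesis using M[of u] by simp
  next
    case False
    then have "npts x {u<..t} \<le> npts x {M<..t}"
      by (intro npts_mono_set[OF lf(1), where a=M and b=t]) auto
    then show ?thesis by simp
  qed
  from is_qlen_exI[OF this] show "\<exists>n. is_qlen x y t n" by blast
qed

text \<open>Countably many events suffice: for \<open>u\<close> between consecutive negative
  integers, arrivals are counted from the earlier integer and services from the later one.\<close>

lemma drainsI:
  assumes lf: "locally_finite x" "locally_finite y"
    and ev: "\<And>K. eventually (\<lambda>n. npts x {- real (n + 2)<..0} + K \<le> npts y {- real (n + 1)<..0}) sequentially"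
  shows "drains x y"
  unfolding drains_def
proof (intro allI)
  fix t K
  \<comment> \<open>The additional terms pay for moving the right end of the windows from 0 to
    \<open>t\<close>, once for the arrivals and once for the services.\<close>
  define K' where "K' = K + npts x {- \<bar>t\<bar><..\<bar>t\<bar>} + npts y {- \<bar>t\<bar><..\<bar>t\<bar>}"
  obtain n0 where n0: "\<And>n. n \<ge> n0 \<Longrightarrow> npts x {- real (n + 2)<..0} + K' \<le> npts y {- real (n + 1)<..0}"
    using ev[of K'] unfolding eventually_sequentially by auto
  show "eventually (\<lambda>u. npts x {u<..t} + K \<le> npts y {u<..t}) at_bot"
    unfolding eventually_at_bot_linorder
  proof (intro exI allI impI)
    fix u assume u: "u \<le> - \<bar>t\<bar> - real n0 - 2"
    \<comment> \<open>Chosen so that \<open>- (n + 2) < u \<le> - (n + 1)\<close>.\<close>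
    define n where "n = nat \<lfloor>- u\<rfloor> - 1"
    have n: "real n + 1 \<le> - u" "- u < real n + 2" "n0 \<le> n"
      using u unfolding n_def by linarith+
    have 1: "npts x {u<..t} \<le> npts x ({u<..0} \<union> {- \<bar>t\<bar><..\<bar>t\<bar>})"
      by (rule npts_mono_set[OF lf(1), where a=u and b="\<bar>t\<bar>"]) (use u in auto)
    have sub: "npts z (A \<union> B) \<le> npts z A + npts z B"
      if "locally_finite z" "A \<subseteq> {u..\<bar>t\<bar>}" "B \<subseteq> {u..\<bar>t\<bar>}" for z A B
    proof -
      have "npts z (A \<union> B) = npts z (A \<union> (B - A))" by (simp add: Un_Diff_cancel)
      also have "\<dots> = npts z A + npts z (B - A)"
        by (rule npts_Un[OF that(1)]) (use that in auto)
      also have "npts z (B - A) \<le> npts z B"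
        by (rule npts_mono_set[OF that(1)]) (use that in auto)
      finally show ?thesis by simp
    qed
    have 2: "npts x ({u<..0} \<union> {- \<bar>t\<bar><..\<bar>t\<bar>}) \<le> npts x {u<..0} + npts x {- \<bar>t\<bar><..\<bar>t\<bar>}"
      by (rule sub[OF lf(1)]) (use u in auto)
    have 3: "npts x {u<..0} \<le> npts x {- real (n + 2)<..0}"
      by (rule npts_mono_set[OF lf(1), where a="- real (n + 2)" and b=0]) (use n in auto)
    have 4: "npts y {- real (n + 1)<..0} \<le> npts y ({u<..t} \<union> {- \<bar>t\<bar><..\<bar>t\<bar>})"
      by (rule npts_mono_set[OF lf(2), where a=u and b="\<bar>t\<bar>"]) (use n u in auto)
    have 5: "npts y ({u<..t} \<union> {- \<bar>t\<bar><..\<bar>t\<bar>}) \<le> npts y {u<..t} + npts y {- \<bar>t\<bar><..\<bar>t\<bar>}"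
      by (rule sub[OF lf(2)]) (use u in auto)
    show "npts x {u<..t} + K \<le> npts y {u<..t}"
      using 1 2 3 4 5 n0[OF n(3)] unfolding K'_def by linarith
  qed
qed

context poisson_pair
begin

text \<open>Chernoff bound: on the event the power of \<open>z\<close> with exponent
  \<open>K\<close> plus arrivals minus services is at least 1. Its expectation factorises by
  independence, with \<open>z\<close> for the arrivals and \<open>1 / z\<close> for the
  services.\<close>

lemma queue_growth_bound:
  assumes z: "z > 1" and ab: "a < 0" "b < 0"
  shows "measure Pr {w \<in> space Pr. npts (snd w) {b<..0} < npts (fst w) {a<..0} + K} \<le>
    z ^ K * exp (lam * (- a) * (z - 1) + mu * (- b) * (1 / z - 1))"
proof -
  let ?E = "{w \<in> space Pr. npts (snd w) {b<..0} < npts (fst w) {a<..0} + K}"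
  have m1: "(\<lambda>w. npts (fst w) {a<..0}) \<in> Pr \<rightarrow>\<^sub>M count_space UNIV"
    and m2: "(\<lambda>w. npts (snd w) {b<..0}) \<in> Pr \<rightarrow>\<^sub>M count_space UNIV"
    by (intro measurable_npts fst_measurable snd_measurable)+
  have pm1: "(\<lambda>x. f (npts x {a<..0})) \<in> borel_measurable P1" for f :: "nat \<Rightarrow> ennreal"
    by (rule measurable_compose[OF poisson_process_law_measurable[OF P1]]) simp
  have pm2: "(\<lambda>x. f (npts x {b<..0})) \<in> borel_measurable P2" for f :: "nat \<Rightarrow> ennreal"
    by (rule measurable_compose[OF poisson_process_law_measurable[OF P2]]) simp
  have pr: "Measurable.pred Pr (\<lambda>w. npts (snd w) {b<..0} < npts (fst w) {a<..0} + K)"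
    by (rule measurable_countable_binary[where h="\<lambda>i j. i < j + K", OF m2 m1])
  then have E: "?E \<in> sets Pr" by (simp add: pred_def)
  let ?f = "\<lambda>x. ennreal (z ^ K) * ennreal (z ^ npts x {a<..0})"
  let ?h = "\<lambda>y. ennreal ((1 / z) ^ npts y {b<..0})"
  have le: "indicator ?E w \<le> ?f (fst w) * ?h (snd w)" for w
  proof (cases "w \<in> ?E")
    case True
    then have "npts (snd w) {b<..0} \<le> K + npts (fst w) {a<..0}" by simp
    then have "z ^ npts (snd w) {b<..0} \<le> z ^ (K + npts (fst w) {a<..0})"
      using z by (intro power_increasing) auto
    then have "1 \<le> z ^ K * z ^ npts (fst w) {a<..0} * (1 / z) ^ npts (snd w) {b<..0}"
      using z by (simp add: power_add power_one_over field_simps)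
    then have "ennreal 1 \<le> ennreal (z ^ K * z ^ npts (fst w) {a<..0} * (1 / z) ^ npts (snd w) {b<..0})"
      by (rule ennreal_leI)
    also have "\<dots> = ?f (fst w) * ?h (snd w)"
      using z by (simp add: ennreal_mult)
    finally show ?thesis using True by simp
  qed simp
  have "emeasure Pr ?E = (\<integral>\<^sup>+w. indicator ?E w \<partial>Pr)" using E by simp
  also have "\<dots> \<le> (\<integral>\<^sup>+w. ?f (fst w) * ?h (snd w) \<partial>Pr)"
    by (rule nn_integral_mono) (rule le)
  also have "\<dots> = (\<integral>\<^sup>+x. \<integral>\<^sup>+y. ?f x * ?h y \<partial>P2 \<partial>P1)"
  proof -
    have "(\<lambda>w. ?f (fst w) * ?h (snd w)) \<in> borel_measurable Pr"
      by (intro borel_measurable_times_ennreal measurable_compose[OF m1] measurable_compose[OF m2]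
          borel_measurable_const) simp_all
    from P2.nn_integral_fst[OF this] show ?thesis by simp
  qed
  also have "\<dots> = (\<integral>\<^sup>+x. ?f x \<partial>P1) * (\<integral>\<^sup>+y. ?h y \<partial>P2)"
    by (simp add: nn_integral_cmult nn_integral_multc pm1 pm2)
  also have "\<dots> = ennreal (z ^ K) * ennreal (exp (lam * (- a) * (z - 1))) * ennreal (exp (mu * (- b) * (1 / z - 1)))"
    using poisson_process_law_moment[OF P1, of a 0 z] poisson_process_law_moment[OF P2, of b 0 "1 / z"]
      lam mu z ab by (simp add: nn_integral_cmult pm1)
  also have "\<dots> = ennreal (z ^ K * exp (lam * (- a) * (z - 1) + mu * (- b) * (1 / z - 1)))"
  proof -
    have "ennreal (A * exp (p + q)) = ennreal A * ennreal (exp p) * ennreal (exp q)" if "A \<ge> 0" for A p q :: real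
      using that by (simp add: exp_add ennreal_mult mult.assoc)
    from this[symmetric] show ?thesis by (rule trans) (use z in simp_all)
  qed
  finally show ?thesis using z by (simp add: P.emeasure_eq_measure)
qed

lemma AE_drains: "AE w in Pr. drains (fst w) (snd w)"
proof -
  \<comment> \<open>This value minimises \<open>lam * (z - 1) + mu * (1 / z - 1)\<close>, the rate
    in the Chernoff bound. The minimum is \<open>- lam * (z - 1)\<^sup>2\<close>, negative because
    \<open>lam < mu\<close>, so the probabilities decay geometrically and Borel-Cantelli
    applies.\<close>
  define z where "z = sqrt (mu / lam)"
  have z: "z > 1" using lam mu by (simp add: z_def)
  have zz: "lam * z = mu * (1 / z)"
  proof -
    have "z * z = mu / lam" using lam mu by (simp add: z_def)
    then have "lam * (z * z) = mu" using lam by simp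
    then show ?thesis using z by (simp add: field_simps)
  qed
  define c where "c = lam * (z - 1) + mu * (1 / z - 1)"
  have c: "c < 0"
  proof -
    have "c = - (lam * (z - 1)\<^sup>2)"
    proof -
      have "mu = lam * z * z" using zz z by (simp add: field_simps)
      then show ?thesis using z unfolding c_def by (simp add: field_simps power2_eq_square)
    qed
    then show ?thesis using lam z by simp
  qed
  have "AE w in Pr. eventually (\<lambda>n. w \<in> space Pr -
      {w \<in> space Pr. npts (snd w) {- real (n + 1)<..0} < npts (fst w) {- real (n + 2)<..0} + K}) sequentially" for K
  proof (rule borel_cantelli_AE1)
    fix n
    have "Measurable.pred Pr (\<lambda>w. npts (snd w) {- real (n + 1)<..0} < npts (fst w) {- real (n + 2)<..0} + K)"
      by (intro measurable_countable_binary[where h="\<lambda>i j. i < j + K"] measurable_npts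
          fst_measurable snd_measurable)
    then show "{w \<in> space Pr. npts (snd w) {- real (n + 1)<..0} < npts (fst w) {- real (n + 2)<..0} + K} \<in> sets Pr"
      by (simp add: pred_def)
  next
    show "emeasure Pr {w \<in> space Pr. npts (snd w) {- real (n + 1)<..0} < npts (fst w) {- real (n + 2)<..0} + K} < \<infinity>" for n
      by (simp add: P.emeasure_eq_measure)
  next
    \<comment> \<open>The factor \<open>z ^ K\<close> and the exponent left at \<open>n = 0\<close>,
      where the windows have lengths 2 and 1.\<close>
    define C where "C = z ^ K * exp (lam * 2 * (z - 1) + mu * (1 / z - 1))"
    have "summable (\<lambda>n. C * exp c ^ n)"
      using c by (intro summable_mult summable_geometric) simp
    then show "summable (\<lambda>n. measure Pr {w \<in> space Pr. npts (snd w) {- real (n + 1)<..0} < npts (fst w) {- real (n + 2)<..0} + K})"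
    proof (rule summable_comparison_test'[where N=0])
      fix n :: nat
      have "lam * real (n + 2) * (z - 1) + mu * real (n + 1) * (1 / z - 1) =
        (lam * 2 * (z - 1) + mu * (1 / z - 1)) + real n * c"
        by (simp add: c_def algebra_simps)
      then have "z ^ K * exp (lam * real (n + 2) * (z - 1) + mu * real (n + 1) * (1 / z - 1)) = C * exp c ^ n"
        by (simp add: C_def exp_add exp_of_nat_mult)
      then show "norm (measure Pr {w \<in> space Pr. npts (snd w) {- real (n + 1)<..0} <
          npts (fst w) {- real (n + 2)<..0} + K}) \<le> C * exp c ^ n"
        using queue_growth_bound[OF z, of "- real (n + 2)" "- real (n + 1)" K]
        by (simp only: minus_minus real_norm_def abs_of_nonneg measure_nonneg)
    qed
  qed
  then have "AE w in Pr. \<forall>K. eventually (\<lambda>n. w \<in> space Pr -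
      {w \<in> space Pr. npts (snd w) {- real (n + 1)<..0} < npts (fst w) {- real (n + 2)<..0} + K}) sequentially"
    by (simp add: AE_all_countable)
  then show ?thesis
    using AE_space
  proof eventually_elim
    case (elim w)
    then have lf: "locally_finite (fst w)" "locally_finite (snd w)" by (auto simp: space_Pr)
    show ?case
    proof (rule drainsI[OF lf])
      fix K
      show "eventually (\<lambda>n. npts (fst w) {- real (n + 2)<..0} + K \<le> npts (snd w) {- real (n + 1)<..0}) sequentially"
        using elim(1)[rule_format, of K] by (rule eventually_mono) auto
    qed
  qed
qed

end

section \<open>Comparing the slotted queue with the stationary queue\<close>

lemma concentrated_if_npts_le_1:
  assumes lf: "locally_finite x" and uv: "u < v" and le: "npts x {u<..v} \<le> 1"
  obtains p where "concentrated x u v p"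
proof (rule concentrated_if_separated[OF uv])
  fix p q assume pq: "u < p" "p \<le> v" "u < q" "q \<le> v" "x p \<noteq> 0" "x q \<noteq> 0"
  show "p = q"
  proof (rule ccontr)
    assume "p \<noteq> q"
    then have "x p + x q = sum x {p, q}" by simp
    also have "\<dots> \<le> npts x {u<..v}"
      unfolding npts_def
    proof (rule sum_mono2)
      show "finite {t \<in> {u<..v}. x t \<noteq> 0}"
        by (rule locally_finite_finite[OF lf, of _ u v]) auto
    qed (use pq in auto)
    finally show False using le pq by linarith
  qed
qed blast

text \<open>A good slot contains at most one location of both processes together, so across it the
  queue in continuous time makes exactly one discrete step.\<close>

lemma queue_slot:
  assumes lf: "locally_finite x" "locally_finite y" and uv: "u < v"
    and m: "(npts x {u<..v}, npts y {u<..v}) \<in> marks" and q: "is_qlen x y u n"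
  shows "is_qlen x y v (queue_step n (npts x {u<..v}, npts y {u<..v}))"
    and "(npts (departures x y) {u<..v}, npts (dual_service x y) {u<..v}) =
      queue_out n (npts x {u<..v}, npts y {u<..v})"
proof -
  have "npts (\<lambda>t. x t + y t) {u<..v} \<le> 1"
  proof -
    have "npts (\<lambda>t. x t + y t) {u<..v} = npts x {u<..v} + npts y {u<..v}"
      by (rule npts_add[OF lf, of _ u v]) auto
    then show ?thesis using m by (auto simp: marks_def)
  qed
  then obtain p where "concentrated (\<lambda>t. x t + y t) u v p"
    by (rule concentrated_if_npts_le_1[OF locally_finite_add[OF lf] uv])
  then have c: "concentrated x u v p" "concentrated y u v p" by (simp_all add: concentrated_add)
  have d: "concentrated (departures x y) u v p"
    by (rule concentrated_support[OF c(2)]) (rule departures_eq_0)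
  have r: "concentrated (dual_service x y) u v p"
    using c by (auto simp: concentrated_def dual_service_def)
  show "is_qlen x y v (queue_step n (npts x {u<..v}, npts y {u<..v}))"
    using is_qlen_concentrated(1)[OF lf c q] c by (simp add: queue_step_def npts_concentrated)
  show "(npts (departures x y) {u<..v}, npts (dual_service x y) {u<..v}) =
      queue_out n (npts x {u<..v}, npts y {u<..v})"
    using is_qlen_concentrated(2)[OF lf c q] c d r
    by (simp add: queue_out_def npts_concentrated dual_service_def)
qed

lemma is_qlen_slots:
  assumes lf: "locally_finite x" "locally_finite y" and g: "strict_mono g"
    and m: "slot_counts g N x y \<in> mark_lists N" and q: "is_qlen x y (g 0) n" and k: "k \<le> N"
  shows "is_qlen x y (g k) (queue_run n (slot_counts g k x y))"
  using k
proof (induction k)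
  case (Suc k)
  then have "(npts x {g k<..g (Suc k)}, npts y {g k<..g (Suc k)}) \<in> marks"
    using m by (simp add: slot_counts_in_mark_lists)
  from queue_slot(1)[OF lf _ this] Suc strict_monoD[OF g, of k "Suc k"] show ?case by simp
qed (use q in simp)

lemma rev_nth_queue_outs:
  "k < N \<Longrightarrow> rev (queue_outs q (slot_counts g N x y)) ! k =
    queue_out (queue_run q (slot_counts g k x y)) (npts x {g k<..g (Suc k)}, npts y {g k<..g (Suc k)})"
proof (induction N)
  case (Suc N)
  have "length (queue_outs q ws) = length ws" for ws by (induction ws) auto
  then show ?case using Suc by (auto simp: nth_append less_Suc_eq)
qed simp

text \<open>The larger run stays on top. If it ever wastes a service it is empty, hence so is the
  smaller one, and they have met. Until then its length is its start plus arrivals minus services,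
  stated here without subtraction.\<close>

lemma queue_run_coupled:
  assumes "q \<le> q'"
  shows "queue_run q ws \<le> queue_run q' ws \<and> (queue_run q ws = queue_run q' ws \<or>
    queue_run q' ws + (\<Sum>m\<leftarrow>ws. snd m) = q' + (\<Sum>m\<leftarrow>ws. fst m))"
proof (induction ws)
  case (Cons m ws)
  then show ?case
    by (cases "snd m \<le> queue_run q' ws + fst m") (auto simp: queue_step_def)
qed (use assms in simp)

text \<open>If the services cover the larger start and all arrivals, the second alternative of the
  coupling leaves the larger run at 0, and the smaller run with it.\<close>

lemma queue_run_merge:
  assumes "q + (\<Sum>m\<leftarrow>ws. fst m) \<le> (\<Sum>m\<leftarrow>ws. snd m)" "q' + (\<Sum>m\<leftarrow>ws. fst m) \<le> (\<Sum>m\<leftarrow>ws. snd m)"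
  shows "queue_run q ws = queue_run q' ws"
  using queue_run_coupled[of q q' ws] queue_run_coupled[of q' q ws] assms
  by (cases "q \<le> q'") linarith+

lemma sum_slot_counts:
  assumes lf: "locally_finite x" "locally_finite y" and g: "strict_mono g"
  shows "(\<Sum>m\<leftarrow>slot_counts g N x y. fst m) = npts x {g 0<..g N}"
    and "(\<Sum>m\<leftarrow>slot_counts g N x y. snd m) = npts y {g 0<..g N}"
proof (induction N)
  case (Suc N)
  have le: "g 0 \<le> g N" "g N \<le> g (Suc N)" using g by (simp_all add: strict_mono_less_eq)
  {
    case 1
    show ?case using Suc npts_split[OF lf(1) le] by simp
  next
    case 2
    show ?case using Suc npts_split[OF lf(2) le] by simp
  }
qed simp_all

lemma queue_run_slots_eq:
  assumes lf: "locally_finite x" "locally_finite y" and g: "strict_mono g"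
    and le: "q + npts x {g 0<..g k} \<le> npts y {g 0<..g k}" "q' + npts x {g 0<..g k} \<le> npts y {g 0<..g k}"
    and l: "k \<le> l"
  shows "queue_run q (slot_counts g l x y) = queue_run q' (slot_counts g l x y)"
  using l
proof (induction l rule: dec_induct)
  case base
  show ?case by (rule queue_run_merge) (use le in \<open>simp_all only: sum_slot_counts[OF lf g]\<close>)
qed simp

lemma npts_eq_sum_slots:
  assumes lf: "locally_finite z" and g: "strict_mono g" and ab: "a \<in> g ` {..N}" "b \<in> g ` {..N}"
  shows "npts z {a<..b} = (\<Sum>k | k < N \<and> a \<le> g k \<and> g k < b. npts z {g k<..g (Suc k)})"
proof -
  obtain i l where il: "i \<le> N" "l \<le> N" "a = g i" "b = g l" using ab by auto
  have "{k. k < N \<and> a \<le> g k \<and> g k < b} = {i..<l}"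
    using il g by (auto simp: strict_mono_less strict_mono_less_eq)
  moreover have "npts z {g i<..g l} = (\<Sum>k=i..<l. npts z {g k<..g (Suc k)})"
  proof (cases "i \<le> l")
    case True
    then show ?thesis
    proof (induction l rule: dec_induct)
      case (step l)
      have "g i \<le> g l" "g l \<le> g (Suc l)" using step g by (simp_all add: strict_mono_less_eq)
      from npts_split[OF lf this] show ?case using step by simp
    qed simp
  next
    case False
    then have "g l \<le> g i" using g by (simp add: strict_mono_less_eq)
    then show ?thesis using False by simp
  qed
  ultimately show ?thesis using il by simp
qed

definition count_event :: "(real \<times> real \<times> nat) set \<Rightarrow> (real \<times> real \<times> nat) set \<Rightarrow> (config \<times> config) set" where
  "count_event J1 J2 = {(x, y). locally_finite x \<and> locally_finite y \<and>
     (\<forall>(a, b, n)\<in>J1. npts x {a<..b} = n) \<and> (\<forall>(a, b, n)\<in>J2. npts y {a<..b} = n)}"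

text \<open>The same conditions as in \<open>count_event\<close>, read off a list of slots. Reversal
  makes position \<open>k\<close> of the list the slot from \<open>g k\<close> to
  \<open>g (Suc k)\<close>.\<close>

definition slot_event :: "(real \<times> real \<times> nat) set \<Rightarrow> (real \<times> real \<times> nat) set \<Rightarrow> (nat \<Rightarrow> real) \<Rightarrow> nat \<Rightarrow>
    (nat \<times> nat) list \<Rightarrow> bool" where
  "slot_event J1 J2 g N v \<longleftrightarrow>
     (\<forall>(a, b, n)\<in>J1. (\<Sum>k | k < N \<and> a \<le> g k \<and> g k < b. fst (rev v ! k)) = n) \<and>
     (\<forall>(a, b, n)\<in>J2. (\<Sum>k | k < N \<and> a \<le> g k \<and> g k < b. snd (rev v ! k)) = n)"

definition endpoints :: "(real \<times> real \<times> nat) set \<Rightarrow> real set" where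
  "endpoints J = fst ` J \<union> (fst \<circ> snd) ` J"

text \<open>When all endpoints are grid points, each interval is a union of slots. Agreement is
  demanded only for slots to the right of some endpoint; the earlier ones are left free for the two
  queues to merge.\<close>

lemma slot_event_iff:
  assumes lf: "locally_finite x" "locally_finite y" and g: "strict_mono g"
    and J: "endpoints (J1 \<union> J2) \<subseteq> g ` {..N}"
    and v: "\<And>k. k < N \<Longrightarrow> (\<exists>p\<in>endpoints (J1 \<union> J2). p \<le> g k) \<Longrightarrow>
      rev v ! k = (npts x {g k<..g (Suc k)}, npts y {g k<..g (Suc k)})"
  shows "slot_event J1 J2 g N v \<longleftrightarrow> (x, y) \<in> count_event J1 J2"
proof -
  have eq: "(\<Sum>k | k < N \<and> a \<le> g k \<and> g k < b. fst (rev v ! k)) = npts x {a<..b}"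
    "(\<Sum>k | k < N \<and> a \<le> g k \<and> g k < b. snd (rev v ! k)) = npts y {a<..b}"
    if "(a, b, n) \<in> J1 \<union> J2" for a b n
  proof -
    have e: "a \<in> endpoints (J1 \<union> J2)" "b \<in> endpoints (J1 \<union> J2)"
      using that unfolding endpoints_def by force+
    then have ab: "a \<in> g ` {..N}" "b \<in> g ` {..N}" using J by auto
    have "rev v ! k = (npts x {g k<..g (Suc k)}, npts y {g k<..g (Suc k)})"
      if "k < N" "a \<le> g k" for k using v[of k] that e by blast
    then show "(\<Sum>k | k < N \<and> a \<le> g k \<and> g k < b. fst (rev v ! k)) = npts x {a<..b}"
      "(\<Sum>k | k < N \<and> a \<le> g k \<and> g k < b. snd (rev v ! k)) = npts y {a<..b}"
      unfolding npts_eq_sum_slots[OF lf(1) g ab] npts_eq_sum_slots[OF lf(2) g ab]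
      by (auto intro!: sum.cong)
  qed
  have "(\<forall>(a, b, n)\<in>J1. (\<Sum>k | k < N \<and> a \<le> g k \<and> g k < b. fst (rev v ! k)) = n) \<longleftrightarrow>
      (\<forall>(a, b, n)\<in>J1. npts x {a<..b} = n)"
    using eq(1)[OF UnI1] by (intro ball_cong refl) (metis (mono_tags, lifting) case_prod_conv surj_pair)
  moreover have "(\<forall>(a, b, n)\<in>J2. (\<Sum>k | k < N \<and> a \<le> g k \<and> g k < b. snd (rev v ! k)) = n) \<longleftrightarrow>
      (\<forall>(a, b, n)\<in>J2. npts y {a<..b} = n)"
    using eq(2)[OF UnI2] by (intro ball_cong refl) (metis (mono_tags, lifting) case_prod_conv surj_pair)
  ultimately show ?thesis
    unfolding slot_event_def count_event_def using lf by simp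
qed

section \<open>Burke's theorem\<close>

lemma (in prob_space) emeasure_tendsto:
  assumes A: "\<And>j. A j \<in> events" and B: "B \<in> events"
    and ev: "AE w in M. eventually (\<lambda>j. w \<in> A j \<longleftrightarrow> w \<in> B) sequentially"
  shows "(\<lambda>j. emeasure M (A j)) \<longlonglongrightarrow> emeasure M B"
proof -
  have "(\<lambda>j. \<integral>\<^sup>+w. indicator (A j) w \<partial>M) \<longlonglongrightarrow> (\<integral>\<^sup>+w. indicator B w \<partial>M)"
  proof (rule nn_integral_dominated_convergence[where w="\<lambda>_. 1"])
    show "AE w in M. (\<lambda>j. indicator (A j) w :: ennreal) \<longlonglongrightarrow> indicator B w"
      using ev
    proof eventually_elim
      case (elim w)
      then have "eventually (\<lambda>j. indicator (A j) w = (indicator B w :: ennreal)) sequentially"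
        by (rule eventually_mono) (simp add: indicator_def)
      then show ?case by (rule tendsto_eventually)
    qed
    show "AE w in M. indicator (A j) w \<le> (1 :: ennreal)" for j
      by (simp add: indicator_def)
    show "(\<integral>\<^sup>+w. 1 \<partial>M) < \<infinity>" by (simp add: emeasure_space_1)
  qed (use A B in simp_all)
  then show ?thesis using A B by simp
qed

lemma grid_sequence_exists:
  assumes F: "finite (F :: real set)"
  obtains G :: "nat \<Rightarrow> nat \<Rightarrow> real" and N where "\<And>j. strict_mono (G j)" "\<And>j. F \<subseteq> G j ` {..N j}"
    "\<And>j. G j 0 \<le> - real j" "\<And>j. real j \<le> G j (N j)"
    "\<And>j. (\<Sum>k<N j. (G j (Suc k) - G j k)\<^sup>2) \<le> 2 * (1 / 2) ^ j"
proof -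
  obtain B where B: "\<And>p. p \<in> F \<Longrightarrow> \<bar>p\<bar> \<le> B"
    using finite_imp_bounded[OF F] unfolding bounded_iff by auto
  define T where "T j = max B 1 + real j" for j :: nat
  \<comment> \<open>The squared slot lengths sum to at most \<open>e j\<close> times the total
    length \<open>2 * T j\<close>, that is to \<open>2 * (1 / 2) ^ j\<close>, which is summable in
    \<open>j\<close>.\<close>
  define e where "e j = (1 / 2) ^ j / T j" for j
  have T: "T j > 0" "F \<subseteq> {- T j..T j}" "real j \<le> T j" for j
    using B by (force simp: T_def abs_le_iff)+
  have e: "e j > 0" for j using T(1)[of j] by (simp add: e_def)
  have "\<exists>g N. strict_mono g \<and> g 0 = - T j \<and> g N = T j \<and> F \<subseteq> g ` {..N} \<and>
    (\<forall>k<N. g (Suc k) - g k \<le> e j)" for j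
    using grid_exists[OF F T(2,1) e, of j] by metis
  then obtain G N where G: "\<And>j. strict_mono (G j) \<and> G j 0 = - T j \<and> G j (N j) = T j \<and>
    F \<subseteq> G j ` {..N j} \<and> (\<forall>k<N j. G j (Suc k) - G j k \<le> e j)"
    by metis
  have "(\<Sum>k<N j. (G j (Suc k) - G j k)\<^sup>2) \<le> 2 * (1 / 2) ^ j" for j
  proof -
    have "(\<Sum>k<N j. (G j (Suc k) - G j k)\<^sup>2) \<le> (\<Sum>k<N j. e j * (G j (Suc k) - G j k))"
    proof (rule sum_mono)
      fix k assume "k \<in> {..<N j}"
      then have "G j (Suc k) - G j k \<le> e j" "0 \<le> G j (Suc k) - G j k"
        using G[of j] by (auto simp: strict_mono_less_eq)
      then show "(G j (Suc k) - G j k)\<^sup>2 \<le> e j * (G j (Suc k) - G j k)"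
        unfolding power2_eq_square by (rule mult_right_mono)
    qed
    also have "\<dots> = e j * (G j (N j) - G j 0)"
      by (simp add: sum_distrib_left[symmetric] sum_lessThan_telescope)
    also have "\<dots> = 2 * (1 / 2) ^ j"
      using G[of j] T(1)[of j] by (simp add: e_def)
    finally show ?thesis .
  qed
  with G T(3) show ?thesis by (intro that[of G N]) auto
qed

text \<open>The run from \<open>q\<close> has merged by slot \<open>i\<close> with the run from the
  true length \<open>q0\<close>. From there on its outputs are those of the queue in continuous
  time.\<close>

lemma queue_outs_slots_coupled:
  assumes lf: "locally_finite x" "locally_finite y" and g: "strict_mono g"
    and m: "slot_counts g N x y \<in> mark_lists N"
    and q0: "is_qlen x y (g 0) q0"
    and le: "q + npts x {g 0<..g i} \<le> npts y {g 0<..g i}" "q0 + npts x {g 0<..g i} \<le> npts y {g 0<..g i}"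
    and k: "i \<le> k" "k < N"
  shows "rev (queue_outs q (slot_counts g N x y)) ! k =
    (npts (departures x y) {g k<..g (Suc k)}, npts (dual_service x y) {g k<..g (Suc k)})"
proof -
  have "queue_run q (slot_counts g k x y) = queue_run q0 (slot_counts g k x y)"
    by (rule queue_run_slots_eq[OF lf g le k(1)])
  moreover have "is_qlen x y (g k) (queue_run q0 (slot_counts g k x y))"
    by (rule is_qlen_slots[OF lf g m q0]) (use k in simp)
  moreover have "(npts x {g k<..g (Suc k)}, npts y {g k<..g (Suc k)}) \<in> marks"
    using m k by (simp add: slot_counts_in_mark_lists)
  ultimately show ?thesis
    using queue_slot(2)[OF lf, of "g k" "g (Suc k)"] strict_monoD[OF g, of k "Suc k"] k(2)
    by (simp add: rev_nth_queue_outs)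
qed

text \<open>The length \<open>q\<close> at \<open>v\<close> is the excess over some window that
  starts at \<open>u \<le> v\<close>, so the claim is the given inequality for the longer window
  from \<open>u\<close> to \<open>t\<close>. The threshold \<open>M\<close> is independent of
  \<open>v\<close> and \<open>q\<close>, so it serves the left ends of all grids.\<close>

lemma drains_qlen_bound:
  assumes lf: "locally_finite x" "locally_finite y"
    and M: "\<And>u. u \<le> M \<Longrightarrow> npts x {u<..t} \<le> npts y {u<..t}"
    and v: "v \<le> M" "v \<le> t" and q: "is_qlen x y v q"
  shows "q + npts x {v<..t} \<le> npts y {v<..t}"
proof -
  obtain u where u: "u \<le> v" "npts x {u<..v} = npts y {u<..v} + q"
    using q unfolding is_qlen_def by blast
  have "npts x {u<..t} \<le> npts y {u<..t}" using u v by (intro M) simp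
  then show ?thesis using u(2) npts_split[OF lf(1) u(1) v(2)] npts_split[OF lf(2) u(1) v(2)] by linarith
qed

lemma count_event_Int: "count_event J1 J2 \<inter> count_event K1 K2 = count_event (J1 \<union> K1) (J2 \<union> K2)"
  unfolding count_event_def ball_Un by auto

text \<open>For the inclusion of the product sigma-algebra, both projections are measurable for the
  generated one, so the identity map is measurable into the product.\<close>

lemma sets_config_pair:
  "sets (config_space \<Otimes>\<^sub>M config_space) =
    sigma_sets ({x. locally_finite x} \<times> {x. locally_finite x})
      {count_event J1 J2 | J1 J2. finite J1 \<and> finite J2}"
  (is "_ = sigma_sets ?O ?G")
proof
  have O: "?O = space (config_space \<Otimes>\<^sub>M config_space)"
    by (simp add: space_pair_measure space_config_space)
  have "count_event J1 J2 \<in> sets (config_space \<Otimes>\<^sub>M config_space)" if "finite J1" "finite J2" for J1 J2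
  proof -
    let ?M = "config_space \<Otimes>\<^sub>M config_space"
    have "Measurable.pred ?M (\<lambda>w. npts (f w) {a<..b} = n)" if "f \<in> ?M \<rightarrow>\<^sub>M config_space" for f a b n
      by (rule measurable_compose[OF measurable_npts[OF that]]) simp
    then have "Measurable.pred ?M (\<lambda>w. npts (fst w) {fst p<..fst (snd p)} = snd (snd p))"
      "Measurable.pred ?M (\<lambda>w. npts (snd w) {fst p<..fst (snd p)} = snd (snd p))" for p :: "real \<times> real \<times> nat"
      using measurable_fst measurable_snd by blast+
    then have "Measurable.pred ?M (\<lambda>w. (\<forall>p\<in>J1. npts (fst w) {fst p<..fst (snd p)} = snd (snd p)) \<and>
        (\<forall>p\<in>J2. npts (snd w) {fst p<..fst (snd p)} = snd (snd p)))"
      using that by (intro pred_intros_logic pred_intros_finite) auto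
    then have "{w \<in> space ?M. (\<forall>p\<in>J1. npts (fst w) {fst p<..fst (snd p)} = snd (snd p)) \<and>
        (\<forall>p\<in>J2. npts (snd w) {fst p<..fst (snd p)} = snd (snd p))} \<in> sets ?M"
      by (simp add: pred_def)
    also have "{w \<in> space ?M. (\<forall>p\<in>J1. npts (fst w) {fst p<..fst (snd p)} = snd (snd p)) \<and>
        (\<forall>p\<in>J2. npts (snd w) {fst p<..fst (snd p)} = snd (snd p))} = count_event J1 J2"
      by (auto simp: count_event_def space_pair_measure space_config_space split_beta)
    finally show ?thesis .
  qed
  then show "sigma_sets ?O ?G \<subseteq> sets (config_space \<Otimes>\<^sub>M config_space)"
    unfolding O by (intro sets.sigma_sets_subset) auto
  define S where "S = sigma ?O ?G"
  have G: "?G \<subseteq> Pow ?O" by (auto simp: count_event_def)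
  have S: "space S = ?O" "sets S = sigma_sets ?O ?G"
    unfolding S_def using G by (simp_all add: space_measure_of sets_measure_of)
  have ce: "count_event J1 J2 \<in> sets S" if "finite J1" "finite J2" for J1 J2
    unfolding S using that by (intro sigma_sets.Basic) auto
  have "fst \<in> S \<rightarrow>\<^sub>M config_space"
  proof (rule measurable_configI)
    show "(\<lambda>w. npts (fst w) {a<..b}) \<in> S \<rightarrow>\<^sub>M count_space UNIV" for a b
    proof (rule measurable_count_space_eq2_countable[THEN iffD2])
      have "(\<lambda>w. npts (fst w) {a<..b}) -` {n} \<inter> space S = count_event {(a, b, n)} {}" for n
        by (auto simp: S count_event_def)
      then show "(\<lambda>w. npts (fst w) {a<..b}) \<in> space S \<rightarrow> UNIV \<and>
        (\<forall>n\<in>UNIV. (\<lambda>w. npts (fst w) {a<..b}) -` {n} \<inter> space S \<in> sets S)"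
        by (simp add: ce)
    qed
  qed (auto simp: S)
  moreover have "snd \<in> S \<rightarrow>\<^sub>M config_space"
  proof (rule measurable_configI)
    show "(\<lambda>w. npts (snd w) {a<..b}) \<in> S \<rightarrow>\<^sub>M count_space UNIV" for a b
    proof (rule measurable_count_space_eq2_countable[THEN iffD2])
      have "(\<lambda>w. npts (snd w) {a<..b}) -` {n} \<inter> space S = count_event {} {(a, b, n)}" for n
        by (auto simp: S count_event_def)
      then show "(\<lambda>w. npts (snd w) {a<..b}) \<in> space S \<rightarrow> UNIV \<and>
        (\<forall>n\<in>UNIV. (\<lambda>w. npts (snd w) {a<..b}) -` {n} \<inter> space S \<in> sets S)"
        by (simp add: ce)
    qed
  qed (auto simp: S)
  ultimately have id: "(\<lambda>w. (fst w, snd w)) \<in> S \<rightarrow>\<^sub>M config_space \<Otimes>\<^sub>M config_space"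
    by (rule measurable_Pair)
  show "sets (config_space \<Otimes>\<^sub>M config_space) \<subseteq> sigma_sets ?O ?G"
  proof
    fix A assume A: "A \<in> sets (config_space \<Otimes>\<^sub>M config_space)"
    then have "A \<subseteq> ?O" using sets.sets_into_space unfolding O by blast
    then have "(\<lambda>w. (fst w, snd w)) -` A \<inter> space S = A" by (auto simp: S)
    then show "A \<in> sigma_sets ?O ?G" using measurable_sets[OF id A] by (simp add: S)
  qed
qed

context poisson_pair
begin

definition dual_pair :: "config \<times> config \<Rightarrow> config \<times> config" where
  "dual_pair w = (departures (fst w) (snd w), dual_service (fst w) (snd w))"

lemma measurable_dual_pair [measurable]: "dual_pair \<in> Pr \<rightarrow>\<^sub>M config_space \<Otimes>\<^sub>M config_space"
  unfolding dual_pair_def[abs_def]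
  by (intro measurable_Pair measurable_departures measurable_dual_service fst_measurable snd_measurable)

lemma sets_Pr: "sets Pr = sets (config_space \<Otimes>\<^sub>M config_space)"
  by (intro sets_pair_measure_cong sets_P)

lemma AE_eventually_marks:
  assumes G: "\<And>j. strict_mono (G j)" "\<And>j. (\<Sum>k<N j. (G j (Suc k) - G j k)\<^sup>2) \<le> 2 * (1 / 2) ^ j"
  shows "AE w in Pr. eventually (\<lambda>j. counts (G j) (N j) w \<in> mark_lists (N j)) sequentially"
proof -
  have "AE w in Pr. eventually (\<lambda>j. w \<in> space Pr -
    {w \<in> space Pr. counts (G j) (N j) w \<notin> mark_lists (N j)}) sequentially"
  proof (rule borel_cantelli_AE1)
    show "{w \<in> space Pr. counts (G j) (N j) w \<notin> mark_lists (N j)} \<in> sets Pr" for j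
      using measurable_sets[OF measurable_counts[of "G j" "N j"], of "- mark_lists (N j)"]
      by (simp add: vimage_def Int_def conj_commute)
    show "emeasure Pr {w \<in> space Pr. counts (G j) (N j) w \<notin> mark_lists (N j)} < \<infinity>" for j
      by (simp add: P.emeasure_eq_measure)
    have "summable (\<lambda>j. (lam + mu)\<^sup>2 * 2 * (1 / 2 :: real) ^ j)"
      by (intro summable_mult summable_geometric) simp
    then show "summable (\<lambda>j. measure Pr {w \<in> space Pr. counts (G j) (N j) w \<notin> mark_lists (N j)})"
    proof (rule summable_comparison_test'[where N=0])
      fix j :: nat
      have "measure Pr {w \<in> space Pr. counts (G j) (N j) w \<notin> mark_lists (N j)} \<le>
        (lam + mu)\<^sup>2 * (\<Sum>k<N j. (G j (Suc k) - G j k)\<^sup>2)"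
        using counts_not_marks[OF G(1)[of j], of "N j"] by (simp add: power_mult_distrib sum_distrib_left)
      also have "\<dots> \<le> (lam + mu)\<^sup>2 * (2 * (1 / 2) ^ j)"
        by (intro mult_left_mono G(2)) simp
      finally show "norm (measure Pr {w \<in> space Pr. counts (G j) (N j) w \<notin> mark_lists (N j)}) \<le>
        (lam + mu)\<^sup>2 * 2 * (1 / 2) ^ j" by simp
    qed
  qed
  then show ?thesis
    by (rule AE_mp) (intro AE_I2 impI, erule eventually_mono, simp)
qed

text \<open>On a single almost sure event some grid covers \<open>t\<close> with good slots only,
  and the slot of \<open>t\<close> holds at most one point of both processes. The event does not
  depend on \<open>t\<close>, so all \<open>t\<close> are treated at once.\<close>

lemma AE_simple: "AE w in Pr. \<forall>t. fst w t + snd w t \<le> 1"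
proof -
  obtain G :: "nat \<Rightarrow> nat \<Rightarrow> real" and N where G: "\<And>j. strict_mono (G j)"
    "\<And>j. G j 0 \<le> - real j" "\<And>j. real j \<le> G j (N j)"
    "\<And>j. (\<Sum>k<N j. (G j (Suc k) - G j k)\<^sup>2) \<le> 2 * (1 / 2) ^ j"
    using grid_sequence_exists[of "{}"] by auto
  show ?thesis
    using AE_eventually_marks[OF G(1,4)] AE_space
  proof eventually_elim
    case (elim w)
    then have lf: "locally_finite (fst w)" "locally_finite (snd w)" by (auto simp: space_Pr)
    show ?case
    proof
      fix t
      have "eventually (\<lambda>j. \<bar>t\<bar> < real j) sequentially"
        using filterlim_real_sequentially unfolding filterlim_at_top_dense by blast
      then obtain j where j: "\<bar>t\<bar> < real j" "counts (G j) (N j) w \<in> mark_lists (N j)"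
        using eventually_happens'[OF trivial_limit_sequentially eventually_conj[OF _ elim(1)]] by blast
      have "\<exists>k<N j. G j k < t \<and> t \<le> G j (Suc k)"
      proof -
        define i where "i = (LEAST i. t \<le> G j i)"
        have tN: "t \<le> G j (N j)" "G j 0 < t" using j(1) G(2,3)[of j] by linarith+
        have "t \<le> G j i" "i \<le> N j" unfolding i_def by (rule LeastI Least_le, rule tN)+
        moreover have "i \<noteq> 0" using tN \<open>t \<le> G j i\<close> by (metis not_le)
        moreover have "\<not> t \<le> G j (i - 1)"
          using not_less_Least[of "i - 1" "\<lambda>i. t \<le> G j i"] \<open>i \<noteq> 0\<close> unfolding i_def[symmetric] by simp
        ultimately show ?thesis by (intro exI[of _ "i - 1"]) auto
      qed
      then obtain k where k: "k < N j" "t \<in> {G j k<..G j (Suc k)}" by auto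
      have p: "x t \<le> npts x {G j k<..G j (Suc k)}" if "locally_finite x" for x
      proof -
        have "npts x {t} = x t" by (rule npts_point) auto
        moreover have "npts x {t} \<le> npts x {G j k<..G j (Suc k)}"
          by (rule npts_mono_set[OF that, where a="G j k" and b="G j (Suc k)"]) (use k in auto)
        ultimately show ?thesis by simp
      qed
      have "(npts (fst w) {G j k<..G j (Suc k)}, npts (snd w) {G j k<..G j (Suc k)}) \<in> marks"
        using j(2) k(1) by (simp add: counts_def slot_counts_in_mark_lists)
      then have "npts (fst w) {G j k<..G j (Suc k)} + npts (snd w) {G j k<..G j (Suc k)} \<le> 1"
        by (auto simp: marks_def)
      then show "fst w t + snd w t \<le> 1" using p[OF lf(1)] p[OF lf(2)] by linarith
    qed
  qed
qed

text \<open>The probabilities of \<open>B j\<close>, read off the true slots, tend to the right-hand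
  side. Those of \<open>A q j\<close>, read off the output of a queue started with \<open>q\<close>
  at the left end, tend to the left-hand side for every \<open>q\<close>. Averaged over a geometric
  \<open>q\<close> they equal those of \<open>B j\<close>, for every \<open>j\<close>.\<close>

lemma emeasure_dual_pair_count_event:
  assumes J: "finite J1" "finite J2"
  shows "emeasure Pr (dual_pair -` count_event J1 J2 \<inter> space Pr) = emeasure Pr (count_event J1 J2)"
proof -
  \<comment> \<open>The point 0 keeps the set nonempty, so that there is an earliest time
    \<open>t\<close> by which the queues have to merge.\<close>
  define F where "F = insert 0 (endpoints (J1 \<union> J2))"
  have F: "finite F" unfolding F_def endpoints_def using J by simp
  define t where "t = Min F"
  have "F \<noteq> {}" by (simp add: F_def)
  then have t: "t \<in> F" "\<And>p. p \<in> F \<Longrightarrow> t \<le> p"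
    unfolding t_def using Min_in[OF F] Min_le[OF F] by simp_all
  obtain G :: "nat \<Rightarrow> nat \<Rightarrow> real" and N where G: "\<And>j. strict_mono (G j)" "\<And>j. F \<subseteq> G j ` {..N j}"
    "\<And>j. G j 0 \<le> - real j" "\<And>j. real j \<le> G j (N j)"
    "\<And>j. (\<Sum>k<N j. (G j (Suc k) - G j k)\<^sup>2) \<le> 2 * (1 / 2) ^ j"
    using grid_sequence_exists[OF F] by blast
  define V where "V j v \<longleftrightarrow> slot_event J1 J2 (G j) (N j) v" for j v
  define A where "A q j = {w \<in> space Pr. counts (G j) (N j) w \<in> mark_lists (N j) \<and>
    V j (queue_outs q (counts (G j) (N j) w))}" for q j
  define B where "B j = {w \<in> space Pr. counts (G j) (N j) w \<in> mark_lists (N j) \<and>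
    V j (counts (G j) (N j) w)}" for j
  have ends: "endpoints (J1 \<union> J2) \<subseteq> G j ` {..N j}" for j using G(2)[of j] by (auto simp: F_def)
  have meas: "{w \<in> space Pr. counts (G j) (N j) w \<in> mark_lists (N j) \<and> Q (counts (G j) (N j) w)} \<in> sets Pr" for j Q
    using measurable_sets[OF measurable_counts[of "G j" "N j"], of "{v \<in> mark_lists (N j). Q v}"]
    by (simp add: vimage_def Int_def conj_commute)
  have ce: "count_event J1 J2 \<in> sets (config_space \<Otimes>\<^sub>M config_space)"
    unfolding sets_config_pair using J by (intro sigma_sets.Basic) auto
  have A: "A q j \<in> sets Pr" for q j unfolding A_def by (rule meas)
  have B: "B j \<in> sets Pr" for j unfolding B_def by (rule meas)
  have "(\<lambda>j. emeasure Pr (B j)) \<longlonglongrightarrow> emeasure Pr (count_event J1 J2)"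
  proof (rule P.emeasure_tendsto[OF B])
    show "AE w in Pr. eventually (\<lambda>j. w \<in> B j \<longleftrightarrow> w \<in> count_event J1 J2) sequentially"
      using AE_eventually_marks[OF G(1,5)] AE_space
    proof eventually_elim
      case (elim w)
      then have lf: "locally_finite (fst w)" "locally_finite (snd w)" by (auto simp: space_Pr)
      from elim(1) show ?case
      proof eventually_elim
        case (elim j)
        have "V j (counts (G j) (N j) w) \<longleftrightarrow> (fst w, snd w) \<in> count_event J1 J2"
          unfolding V_def counts_def
          by (rule slot_event_iff[OF lf G(1) ends]) (rule rev_nth_slot_counts)
        then show ?case using elim \<open>w \<in> space Pr\<close> by (simp add: B_def)
      qed
    qed
  qed (use ce in \<open>simp add: sets_Pr\<close>)
  moreover have "(\<lambda>j. emeasure Pr (B j)) \<longlonglongrightarrow> emeasure Pr (dual_pair -` count_event J1 J2 \<inter> space Pr)"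
  proof -
    let ?L = "emeasure Pr (dual_pair -` count_event J1 J2 \<inter> space Pr)"
    have "(\<lambda>j. emeasure Pr (A q j)) \<longlonglongrightarrow> ?L" for q
    proof (rule P.emeasure_tendsto[OF A])
      show "AE w in Pr. eventually (\<lambda>j. w \<in> A q j \<longleftrightarrow> w \<in> dual_pair -` count_event J1 J2 \<inter> space Pr) sequentially"
        using AE_eventually_marks[OF G(1,5)] AE_drains AE_space
      proof eventually_elim
        case (elim w)
        define x y where "x = fst w" and "y = snd w"
        have lf: "locally_finite x" "locally_finite y" using elim(3) by (auto simp: space_Pr x_def y_def)
        have lfd: "locally_finite (departures x y)" "locally_finite (dual_service x y)"
          by (intro locally_finite_departures locally_finite_dual_service lf)+
        have "eventually (\<lambda>u. npts x {u<..t} + 0 \<le> npts y {u<..t}) at_bot"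
          "eventually (\<lambda>u. npts x {u<..t} + q \<le> npts y {u<..t}) at_bot"
          using elim(2) unfolding drains_def x_def y_def by blast+
        from eventually_conj[OF this]
        obtain M where M: "\<And>u. u \<le> M \<Longrightarrow> npts x {u<..t} + 0 \<le> npts y {u<..t}"
          "\<And>u. u \<le> M \<Longrightarrow> npts x {u<..t} + q \<le> npts y {u<..t}"
          unfolding eventually_at_bot_linorder by blast
        \<comment> \<open>Then the grid begins before both \<open>M\<close> and
          \<open>t\<close>.\<close>
        have "eventually (\<lambda>j. \<bar>M\<bar> + \<bar>t\<bar> < real j) sequentially"
          using filterlim_real_sequentially unfolding filterlim_at_top_dense by blast
        with elim(1) show ?case
        proof eventually_elim
          case (elim j)
          have g0: "G j 0 \<le> M" "G j 0 \<le> t" using elim(2) G(3)[of j] by linarith+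
          have m: "slot_counts (G j) (N j) x y \<in> mark_lists (N j)"
            using elim(1) by (simp add: counts_def x_def y_def)
          obtain q0 where q0: "is_qlen x y (G j 0) q0"
            using drains_stable[OF lf] \<open>drains (fst w) (snd w)\<close> unfolding stable_def x_def y_def by blast
          obtain i where i: "G j i = t" using t(1) G(2)[of j] by auto
          have le: "q + npts x {G j 0<..G j i} \<le> npts y {G j 0<..G j i}"
            "q0 + npts x {G j 0<..G j i} \<le> npts y {G j 0<..G j i}"
            using M(2)[OF g0(1)] drains_qlen_bound[OF lf _ g0 q0] M(1) unfolding i by (simp_all add: add.commute)
          have "V j (queue_outs q (slot_counts (G j) (N j) x y)) \<longleftrightarrow>
            (departures x y, dual_service x y) \<in> count_event J1 J2"
            unfolding V_def
          proof (rule slot_event_iff[OF lfd G(1) ends])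
            fix k assume k: "k < N j" "\<exists>p\<in>endpoints (J1 \<union> J2). p \<le> G j k"
            then have "t \<le> G j k" using t(2) by (force simp: F_def)
            then have "i \<le> k" using G(1)[of j] i by (metis strict_mono_less_eq)
            then show "rev (queue_outs q (slot_counts (G j) (N j) x y)) ! k =
              (npts (departures x y) {G j k<..G j (Suc k)}, npts (dual_service x y) {G j k<..G j (Suc k)})"
              by (intro queue_outs_slots_coupled[OF lf G(1) m q0 le _ k(1)])
          qed
          then show ?case
            using elim(1) \<open>w \<in> space Pr\<close> by (simp add: A_def dual_pair_def counts_def x_def y_def)
        qed
      qed
    qed (use measurable_sets[OF measurable_dual_pair ce] in simp)
    \<comment> \<open>A second dominated convergence, now over the initial length; the limit
      \<open>?L\<close> is the same for all \<open>q\<close>.\<close>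
    then have "(\<lambda>j. \<integral>\<^sup>+q. emeasure Pr (A q j) \<partial>geometric_pmf (1 - lam / mu)) \<longlonglongrightarrow>
      (\<integral>\<^sup>+q. ?L \<partial>geometric_pmf (1 - lam / mu))"
      by (intro nn_integral_dominated_convergence[where w="\<lambda>_. 1"])
        (simp_all add: measure_pmf.emeasure_space_1 P.emeasure_le_1)
    moreover have "(\<integral>\<^sup>+q. emeasure Pr (A q j) \<partial>geometric_pmf (1 - lam / mu)) = emeasure Pr (B j)" for j
      unfolding A_def B_def by (rule counts_invariant[OF G(1)])
    ultimately show ?thesis by (simp add: measure_pmf.emeasure_space_1)
  qed
  ultimately show ?thesis by (rule LIMSEQ_unique[symmetric])
qed

theorem distr_dual_pair: "distr Pr (config_space \<Otimes>\<^sub>M config_space) dual_pair = Pr"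
proof (rule measure_eqI_generator_eq)
  let ?G = "{count_event J1 J2 | J1 J2. finite J1 \<and> finite J2}"
  let ?O = "{x. locally_finite x} \<times> {x. locally_finite x}"
  show "Int_stable ?G"
  proof (rule Int_stableI)
    fix a b assume "a \<in> ?G" "b \<in> ?G"
    then obtain J1 J2 K1 K2 where "a = count_event J1 J2" "b = count_event K1 K2"
      and f: "finite J1" "finite J2" "finite K1" "finite K2" by auto
    then have "a \<inter> b = count_event (J1 \<union> K1) (J2 \<union> K2)" by (simp add: count_event_Int)
    moreover have "finite (J1 \<union> K1)" "finite (J2 \<union> K2)" using f by simp_all
    ultimately show "a \<inter> b \<in> ?G" by blast
  qed
  show "?G \<subseteq> Pow ?O" by (auto simp: count_event_def)
  show "sets (distr Pr (config_space \<Otimes>\<^sub>M config_space) dual_pair) = sigma_sets ?O ?G"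
    by (simp add: sets_config_pair)
  show "sets Pr = sigma_sets ?O ?G" by (simp add: sets_Pr sets_config_pair)
  show "range (\<lambda>_::nat. count_event {} {}) \<subseteq> ?G" by auto
  show "(\<Union>_::nat. count_event {} {}) = ?O" by (auto simp: count_event_def)
  fix X assume "X \<in> ?G"
  then obtain J1 J2 where X: "X = count_event J1 J2" "finite J1" "finite J2" by auto
  then have "X \<in> sets (config_space \<Otimes>\<^sub>M config_space)"
    unfolding sets_config_pair by (intro sigma_sets.Basic) auto
  then show "emeasure (distr Pr (config_space \<Otimes>\<^sub>M config_space) dual_pair) X = emeasure Pr X"
    using emeasure_dual_pair_count_event[OF X(2,3)] by (simp add: emeasure_distr X(1))
next
  show "emeasure (distr Pr (config_space \<Otimes>\<^sub>M config_space) dual_pair) (count_event {} {}) \<noteq> \<infinity>"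
    by (metis P.prob_space_distr measurable_dual_pair prob_space.emeasure_le_1 ennreal_one_neq_top
        infinity_ennreal_def neq_top_trans)
qed

end

section \<open>Multi-type queues\<close>

definition queue_types :: "nat \<Rightarrow> mt_config \<Rightarrow> config \<Rightarrow> mt_config" where
  "queue_types m A S = (mt_departures m A S)(Suc m := mt_unused m A S)"

lemma class_le_0: "class_le A 0 = (\<lambda>t. 0)"
  by (simp add: class_le_def)

lemma class_le_Suc: "class_le A (Suc r) = (\<lambda>t. class_le A r t + A (Suc r) t)"
  by (simp add: class_le_def)

lemma class_le_cong: "(\<And>i. 1 \<le> i \<Longrightarrow> i \<le> r \<Longrightarrow> A i = B i) \<Longrightarrow> class_le A r = class_le B r"
  unfolding class_le_def by (intro ext sum.cong) auto

lemma class_le_mono: "r \<le> r' \<Longrightarrow> class_le A r t \<le> class_le A r' t"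
  unfolding class_le_def by (intro sum_mono2) auto

lemma measurable_class_le:
  assumes f: "f \<in> N \<rightarrow>\<^sub>M mt_space m" and r: "r \<le> m"
  shows "(\<lambda>w. class_le (f w) r) \<in> N \<rightarrow>\<^sub>M config_space"
  using r
proof (induction r)
  case (Suc r)
  have "(\<lambda>w. f w (Suc r)) \<in> N \<rightarrow>\<^sub>M config_space"
    using measurable_compose[OF f[unfolded mt_space_def] measurable_component_singleton, of "Suc r"] Suc by simp
  then show ?case unfolding class_le_Suc using Suc by (intro measurable_config_add) auto
qed (simp add: class_le_0 measurable_config_zero)

lemma locally_finite_class_le:
  assumes "A \<in> space (mt_space m)" "r \<le> m"
  shows "locally_finite (class_le A r)"
  using measurable_config_locally_finite[OF measurable_class_le[OF measurable_ident[of "mt_space m"] assms(2)], of A]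
    assms(1) by simp

lemma measurable_departures_le:
  assumes f: "f \<in> N \<rightarrow>\<^sub>M mt_space m" and g: "g \<in> N \<rightarrow>\<^sub>M config_space" and r: "r \<le> m"
  shows "(\<lambda>w. departures_le (f w) (g w) r) \<in> N \<rightarrow>\<^sub>M config_space"
  unfolding departures_le_def
  by (cases "r = 0") (simp_all add: measurable_config_zero measurable_departures[OF measurable_class_le[OF f r] g])

lemma departures_le_mono:
  assumes A: "A \<in> space (mt_space m)" and r: "r \<le> r'" "r' \<le> m"
  shows "departures_le A S r t \<le> departures_le A S r' t"
proof -
  have "departures (class_le A r) S t \<le> departures (class_le A r') S t"
    by (rule departures_mono) (rule locally_finite_class_le[OF A r(2)] class_le_mono[OF r(1)])+
  then show ?thesis using r by (auto simp: departures_le_def)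
qed

lemma departures_le_le_service: "departures_le A S r t \<le> S t"
  by (simp add: departures_le_def departures_le_service)

lemma measurable_mt_departures:
  assumes f: "f \<in> N \<rightarrow>\<^sub>M mt_space m" and g: "g \<in> N \<rightarrow>\<^sub>M config_space"
  shows "(\<lambda>w. mt_departures m (f w) (g w)) \<in> N \<rightarrow>\<^sub>M mt_space m"
  unfolding mt_departures_def mt_space_def
proof (rule measurable_restrict)
  fix r assume r: "r \<in> {1..m}"
  show "(\<lambda>w. departures_eq (f w) (g w) r) \<in> N \<rightarrow>\<^sub>M config_space"
    unfolding departures_eq_def
  proof (rule measurable_config_diff)
    fix w t assume "w \<in> space N"
    then have "f w \<in> space (mt_space m)" using measurable_space[OF f] by simp
    then show "departures_le (f w) (g w) (r - 1) t \<le> departures_le (f w) (g w) r t"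
      by (rule departures_le_mono) (use r in auto)
  qed (use r in \<open>auto intro!: measurable_departures_le[OF f g]\<close>)
qed

lemma measurable_queue_types:
  assumes f: "f \<in> N \<rightarrow>\<^sub>M mt_space m" and g: "g \<in> N \<rightarrow>\<^sub>M config_space"
  shows "(\<lambda>w. queue_types m (f w) (g w)) \<in> N \<rightarrow>\<^sub>M mt_space (Suc m)"
  unfolding queue_types_def mt_space_def
proof (rule measurable_fun_upd)
  show "{1..Suc m} = {1..m} \<union> {Suc m}" by auto
  show "(\<lambda>w. mt_departures m (f w) (g w)) \<in> N \<rightarrow>\<^sub>M Pi\<^sub>M {1..m} (\<lambda>i. config_space)"
    using measurable_mt_departures[OF f g] by (simp add: mt_space_def)
  show "(\<lambda>w. mt_unused m (f w) (g w)) \<in> N \<rightarrow>\<^sub>M config_space"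
    unfolding mt_unused_def
    by (rule measurable_config_diff[OF g measurable_departures_le[OF f g order_refl]])
      (rule departures_le_le_service)
qed

lemma class_le_mt_departures:
  assumes A: "A \<in> space (mt_space m)" and r: "r \<le> m"
  shows "class_le (mt_departures m A S) r = departures_le A S r"
  using r
proof (induction r)
  case (Suc r)
  show ?case
  proof
    fix t
    have "departures_le A S r t \<le> departures_le A S (Suc r) t"
      by (rule departures_le_mono[OF A]) (use Suc in auto)
    moreover have "mt_departures m A S (Suc r) t = departures_le A S (Suc r) t - departures_le A S r t"
      using Suc by (simp add: mt_departures_def departures_eq_def)
    moreover have "class_le (mt_departures m A S) r = departures_le A S r"
      using Suc by simp
    ultimately show "class_le (mt_departures m A S) (Suc r) t = departures_le A S (Suc r) t"
      by (simp add: class_le_Suc)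
  qed
qed (simp add: class_le_0 departures_le_def)

lemma class_le_queue_types:
  assumes A: "A \<in> space (mt_space m)" and r: "r \<le> m"
  shows "class_le (queue_types m A S) r = departures_le A S r"
  unfolding class_le_mt_departures[OF A r, symmetric]
  by (rule class_le_cong) (use r in \<open>simp add: queue_types_def\<close>)

lemma class_le_queue_types_Suc:
  assumes A: "A \<in> space (mt_space m)"
  shows "class_le (queue_types m A S) (Suc m) = S"
  unfolding class_le_Suc class_le_queue_types[OF A order_refl]
  by (simp add: queue_types_def mt_unused_def departures_le_le_service)

lemma (in tandem) mt_departures_queue_types:
  assumes A: "A \<in> space (mt_space m)"
  shows "mt_departures (Suc m) (queue_types m A a) s =
    queue_types m (mt_departures m A (dual_service a s)) (departures a s)"
proof -
  have le: "departures_le (queue_types m A a) s r =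
      departures_le (mt_departures m A (dual_service a s)) (departures a s) r" if "r \<le> m" for r
    using interchange[OF locally_finite_class_le[OF A that]]
    by (simp add: departures_le_def[of "queue_types m A a"] class_le_queue_types[OF A that]
        departures_le_def[of "mt_departures m A (dual_service a s)"] class_le_mt_departures[OF A that])
      (simp add: departures_le_def)
  have last: "departures_le (queue_types m A a) s (Suc m) = departures a s"
    by (simp add: departures_le_def class_le_queue_types_Suc[OF A])
  show ?thesis
  proof
    fix r
    consider "r \<in> {1..m}" | "r = Suc m" | "r \<notin> {1..Suc m}" by fastforce
    then show "mt_departures (Suc m) (queue_types m A a) s r =
      queue_types m (mt_departures m A (dual_service a s)) (departures a s) r"
    proof cases
      case 1
      then have "r \<le> m" "r - 1 \<le> m" "r \<noteq> Suc m" by auto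
      then show ?thesis
        using 1 by (simp add: mt_departures_def[of "Suc m"] queue_types_def[of m "mt_departures m A (dual_service a s)"]
            mt_departures_def[of m "mt_departures m A (dual_service a s)"] departures_eq_def le)
    next
      case 2
      then show ?thesis
        by (simp add: mt_departures_def[of "Suc m"] queue_types_def[of m "mt_departures m A (dual_service a s)"]
            departures_eq_def last le mt_unused_def)
    next
      case 3
      then have "r \<notin> {1..m}" "r \<noteq> Suc m" by auto
      then show ?thesis
        using 3 by (auto simp: mt_departures_def[of "Suc m"] queue_types_def[of m "mt_departures m A (dual_service a s)"]
            mt_departures_def[of m "mt_departures m A (dual_service a s)"])
    qed
  qed
qed

lemma mt_departures_1:
  "mt_departures 1 (\<lambda>i\<in>{1..1}. x) S = (\<lambda>i\<in>{1..1}. departures x S)"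
proof -
  have "class_le (\<lambda>i\<in>{1..1}. x) 1 = x" by (simp add: class_le_def)
  then show ?thesis
    by (auto simp: mt_departures_def departures_eq_def departures_le_def restrict_def)
qed

lemma F_law_space:
  "F_law lam m Q \<Longrightarrow> prob_space Q \<and> sets Q = sets (mt_space m) \<and> 1 \<le> m"
proof (induction rule: F_law.induct)
  case (F_law_1 R)
  interpret R: prob_space R by (rule poisson_process_law_prob_space[OF F_law_1])
  have "(\<lambda>x. \<lambda>i\<in>{1..1}. x) \<in> R \<rightarrow>\<^sub>M mt_space 1"
    unfolding mt_space_def
    by (rule measurable_restrict)
      (simp add: measurable_cong_sets[OF poisson_process_law_sets[OF F_law_1] refl])
  then show ?case by (simp add: R.prob_space_distr)
next
  case (F_law_Suc m Q R)
  interpret Q: prob_space Q using F_law_Suc by simp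
  interpret R: prob_space R by (rule poisson_process_law_prob_space[OF F_law_Suc(2)])
  interpret QR: pair_prob_space Q R ..
  have "fst \<in> Q \<Otimes>\<^sub>M R \<rightarrow>\<^sub>M mt_space m" "snd \<in> Q \<Otimes>\<^sub>M R \<rightarrow>\<^sub>M config_space"
    using measurable_fst[of Q R] measurable_snd[of Q R] F_law_Suc poisson_process_law_sets[OF F_law_Suc(2)]
    by (simp_all cong: measurable_cong_sets)
  from measurable_queue_types[OF this]
  have "(\<lambda>(A, S). (mt_departures m A S)(Suc m := mt_unused m A S)) \<in> Q \<Otimes>\<^sub>M R \<rightarrow>\<^sub>M mt_space (Suc m)"
    by (simp add: queue_types_def case_prod_beta')
  then show ?case by (simp add: QR.prob_space_distr)
qed

section \<open>The fixed point\<close>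

lemma measure_eqI_nn_integral:
  assumes sets: "sets M = sets N"
    and eq: "\<And>f :: 'a \<Rightarrow> ennreal. f \<in> borel_measurable N \<Longrightarrow> (\<integral>\<^sup>+x. f x \<partial>M) = (\<integral>\<^sup>+x. f x \<partial>N)"
  shows "M = N"
proof (rule measure_eqI[OF sets])
  fix A assume A: "A \<in> sets M"
  then have "emeasure M A = (\<integral>\<^sup>+x. indicator A x \<partial>M)" by simp
  also have "\<dots> = (\<integral>\<^sup>+x. indicator A x \<partial>N)"
    using A sets by (intro eq) simp
  also have "\<dots> = emeasure N A" using A sets by simp
  finally show "emeasure M A = emeasure N A" .
qed

lemma nn_integral_distr':
  "T \<in> M \<rightarrow>\<^sub>M N \<Longrightarrow> f \<in> borel_measurable N \<Longrightarrow> (\<integral>\<^sup>+x. f x \<partial>distr M N T) = (\<integral>\<^sup>+x. f (T x) \<partial>M)"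
  by (rule nn_integral_distr) simp_all

context poisson_pair
begin

lemma AE_tandem: "AE w in Pr. tandem (fst w) (snd w)"
  using AE_simple AE_drains AE_space
proof eventually_elim
  case (elim w)
  then have lf: "locally_finite (fst w)" "locally_finite (snd w)" by (auto simp: space_Pr)
  show ?case
    by unfold_locales (use lf elim drains_stable[OF lf] in auto)
qed

lemma nn_integral_dual_pair:
  assumes f: "f \<in> borel_measurable (config_space \<Otimes>\<^sub>M config_space)"
  shows "(\<integral>\<^sup>+w. f (dual_pair w) \<partial>Pr) = (\<integral>\<^sup>+w. f w \<partial>Pr)"
  using nn_integral_distr'[OF measurable_dual_pair f] by (simp add: distr_dual_pair)

end

lemma measurable_pair_components:
  assumes "sets M = sets M'" "sets N = sets N'"
  shows "fst \<in> M \<Otimes>\<^sub>M N \<rightarrow>\<^sub>M M'" "snd \<in> M \<Otimes>\<^sub>M N \<rightarrow>\<^sub>M N'"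
  using measurable_fst[of M N] measurable_snd[of M N] assms by (simp_all cong: measurable_cong_sets)

lemma nn_integral_distr_pair:
  assumes "sigma_finite_measure R" "sets Q = sets (mt_space m)" "sets R = sets config_space"
    and h: "h \<in> mt_space m \<Otimes>\<^sub>M config_space \<rightarrow>\<^sub>M X" and f: "f \<in> borel_measurable X"
  shows "(\<integral>\<^sup>+x. f x \<partial>distr (Q \<Otimes>\<^sub>M R) X h) = (\<integral>\<^sup>+A. \<integral>\<^sup>+S. f (h (A, S)) \<partial>R \<partial>Q)"
proof -
  interpret R: sigma_finite_measure R by fact
  have s: "sets (Q \<Otimes>\<^sub>M R) = sets (mt_space m \<Otimes>\<^sub>M config_space)"
    using assms(2,3) by (rule sets_pair_measure_cong)
  have h': "h \<in> Q \<Otimes>\<^sub>M R \<rightarrow>\<^sub>M X" using h by (simp cong: measurable_cong_sets add: s)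
  have "(\<integral>\<^sup>+x. f x \<partial>distr (Q \<Otimes>\<^sub>M R) X h) = (\<integral>\<^sup>+w. f (h w) \<partial>(Q \<Otimes>\<^sub>M R))"
    by (rule nn_integral_distr'[OF h' f])
  also have "\<dots> = (\<integral>\<^sup>+A. \<integral>\<^sup>+S. f (h (A, S)) \<partial>R \<partial>Q)"
    by (rule R.nn_integral_fst[symmetric]) (rule measurable_compose[OF h' f])
  finally show ?thesis .
qed

abbreviation "departures_map m \<equiv> (\<lambda>(A, S). mt_departures m A S)"
abbreviation "types_map m \<equiv> (\<lambda>(A, S). (mt_departures m A S)(Suc m := mt_unused m A S))"

lemma measurable_maps:
  "departures_map m \<in> mt_space m \<Otimes>\<^sub>M config_space \<rightarrow>\<^sub>M mt_space m"
  "types_map m \<in> mt_space m \<Otimes>\<^sub>M config_space \<rightarrow>\<^sub>M mt_space (Suc m)"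
  unfolding case_prod_beta' queue_types_def[symmetric]
  by (rule measurable_mt_departures[OF measurable_fst measurable_snd]
      measurable_queue_types[OF measurable_fst measurable_snd])+

text \<open>Burke's theorem, of which one class sees the first component of the dual pair.\<close>

lemma F_law_1_departures:
  assumes R1: "poisson_process_law (lam 1) R1" and R: "poisson_process_law mu R"
    and lam: "0 < lam 1" "lam 1 < mu"
  defines "Q \<equiv> distr R1 (mt_space 1) (\<lambda>x. \<lambda>i\<in>{1..1}. x)"
  shows "distr (Q \<Otimes>\<^sub>M R) (mt_space 1) (departures_map 1) = Q"
proof (rule measure_eqI_nn_integral)
  show "sets (distr (Q \<Otimes>\<^sub>M R) (mt_space 1) (departures_map 1)) = sets Q" by (simp add: Q_def)
  interpret poisson_pair "lam 1" mu R1 R by unfold_locales (use lam R1 R in auto)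
  have one: "(\<lambda>x. \<lambda>i\<in>{1..1}. x) \<in> config_space \<rightarrow>\<^sub>M mt_space 1"
    unfolding mt_space_def by (rule measurable_restrict) simp
  then have one': "(\<lambda>x. \<lambda>i\<in>{1..1}. x) \<in> R1 \<rightarrow>\<^sub>M mt_space 1"
    by (simp cong: measurable_cong_sets add: sets_P(1))
  fix f :: "mt_config \<Rightarrow> ennreal" assume "f \<in> borel_measurable Q"
  then have f: "f \<in> borel_measurable (mt_space 1)" by (simp add: Q_def)
  have fone: "(\<lambda>x. f (\<lambda>i\<in>{1..1}. x)) \<in> borel_measurable config_space"
    by (rule measurable_compose[OF one f])
  have "(\<integral>\<^sup>+x. f x \<partial>distr (Q \<Otimes>\<^sub>M R) (mt_space 1) (departures_map 1)) =
    (\<integral>\<^sup>+A. \<integral>\<^sup>+S. f (mt_departures 1 A S) \<partial>R \<partial>Q)"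
    using nn_integral_distr_pair[OF P2.sigma_finite_measure_axioms _ sets_P(2) measurable_maps(1) f]
    by (simp add: Q_def)
  also have "\<dots> = (\<integral>\<^sup>+x. \<integral>\<^sup>+S. f (mt_departures 1 (\<lambda>i\<in>{1..1}. x) S) \<partial>R \<partial>R1)"
    unfolding Q_def
  proof (rule nn_integral_distr'[OF one'])
    have "(\<lambda>w. f (departures_map 1 w)) \<in> borel_measurable (mt_space 1 \<Otimes>\<^sub>M R)"
      using measurable_compose[OF measurable_maps(1) f] by (simp cong: measurable_cong_sets add: sets_P(2) sets_pair_measure_cong[OF refl sets_P(2)])
    from P2.borel_measurable_nn_integral_fst[OF this]
    show "(\<lambda>A. \<integral>\<^sup>+S. f (mt_departures 1 A S) \<partial>R) \<in> borel_measurable (mt_space 1)" by simp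
  qed
  also have "\<dots> = (\<integral>\<^sup>+x. \<integral>\<^sup>+S. f (\<lambda>i\<in>{1..1}. fst (dual_pair (x, S))) \<partial>R \<partial>R1)"
    by (simp only: mt_departures_1 dual_pair_def fst_conv snd_conv)
  also have "\<dots> = (\<integral>\<^sup>+w. f (\<lambda>i\<in>{1..1}. fst (dual_pair w)) \<partial>Pr)"
    by (rule P2.nn_integral_fst)
      (rule measurable_compose[OF measurable_compose[OF measurable_dual_pair measurable_fst] fone])
  also have "\<dots> = (\<integral>\<^sup>+w. f (\<lambda>i\<in>{1..1}. fst w) \<partial>Pr)"
    by (rule nn_integral_dual_pair[where f="\<lambda>w. f (\<lambda>i\<in>{1..1}. fst w)"])
      (rule measurable_compose[OF measurable_fst fone])
  also have "\<dots> = (\<integral>\<^sup>+x. \<integral>\<^sup>+S. f (\<lambda>i\<in>{1..1}. x) \<partial>R \<partial>R1)"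
    using P2.nn_integral_fst[OF measurable_compose[OF fst_measurable fone]] by simp
  also have "\<dots> = (\<integral>\<^sup>+x. f (\<lambda>i\<in>{1..1}. x) \<partial>R1)"
    by (simp add: P2.emeasure_space_1)
  also have "\<dots> = (\<integral>\<^sup>+x. f x \<partial>Q)"
    unfolding Q_def by (rule nn_integral_distr'[OF one' f, symmetric])
  finally show "(\<integral>\<^sup>+x. f x \<partial>distr (Q \<Otimes>\<^sub>M R) (mt_space 1) (departures_map 1)) = (\<integral>\<^sup>+x. f x \<partial>Q)" .
qed

text \<open>For a fixed arrival configuration the pathwise identity makes the integrand a function
  of the dual pair, and Burke's theorem replaces this pair by the original one. The dual service
  thereby becomes the server of rate \<open>mu\<close> that acts first.\<close>

lemma distr_queue_types_departures:
  assumes Q: "prob_space Q" "sets Q = sets (mt_space m)"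
    and R0: "poisson_process_law r R0" and R: "poisson_process_law mu R" and r: "0 < r" "r < mu"
  shows "distr (distr (Q \<Otimes>\<^sub>M R0) (mt_space (Suc m)) (types_map m) \<Otimes>\<^sub>M R) (mt_space (Suc m)) (departures_map (Suc m)) =
    distr (distr (Q \<Otimes>\<^sub>M R) (mt_space m) (departures_map m) \<Otimes>\<^sub>M R0) (mt_space (Suc m)) (types_map m)"
proof (rule measure_eqI_nn_integral)
  interpret poisson_pair r mu R0 R by unfold_locales (use r R0 R in auto)
  interpret Q: prob_space Q by fact
  have m1: "fst \<in> mt_space k \<Otimes>\<^sub>M R \<rightarrow>\<^sub>M mt_space k" "snd \<in> mt_space k \<Otimes>\<^sub>M R \<rightarrow>\<^sub>M config_space"
    "fst \<in> mt_space k \<Otimes>\<^sub>M R0 \<rightarrow>\<^sub>M mt_space k" "snd \<in> mt_space k \<Otimes>\<^sub>M R0 \<rightarrow>\<^sub>M config_space" for k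
    by (rule measurable_pair_components; simp add: sets_P)+
  fix f :: "mt_config \<Rightarrow> ennreal"
  assume "f \<in> borel_measurable (distr (distr (Q \<Otimes>\<^sub>M R) (mt_space m) (departures_map m) \<Otimes>\<^sub>M R0) (mt_space (Suc m)) (types_map m))"
  then have f: "f \<in> borel_measurable (mt_space (Suc m))" by simp
  have l1: "(\<lambda>B. \<integral>\<^sup>+S. f (mt_departures (Suc m) B S) \<partial>R) \<in> borel_measurable (mt_space (Suc m))"
  proof -
    have "(\<lambda>w. f (mt_departures (Suc m) (fst w) (snd w))) \<in> borel_measurable (mt_space (Suc m) \<Otimes>\<^sub>M R)"
      by (rule measurable_compose[OF measurable_mt_departures[OF m1(1,2)] f])
    from P2.borel_measurable_nn_integral_fst[OF this] show ?thesis by simp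
  qed
  have l2: "(\<lambda>B. \<integral>\<^sup>+d. f (queue_types m B d) \<partial>R0) \<in> borel_measurable (mt_space m)"
  proof -
    have "(\<lambda>w. f (queue_types m (fst w) (snd w))) \<in> borel_measurable (mt_space m \<Otimes>\<^sub>M R0)"
      by (rule measurable_compose[OF measurable_queue_types[OF m1(3,4)] f])
    from P1.borel_measurable_nn_integral_fst[OF this] show ?thesis by simp
  qed
  have core: "(\<integral>\<^sup>+S0. \<integral>\<^sup>+S. f (mt_departures (Suc m) (queue_types m A S0) S) \<partial>R \<partial>R0) =
    (\<integral>\<^sup>+S. \<integral>\<^sup>+d. f (queue_types m (mt_departures m A S) d) \<partial>R0 \<partial>R)" if A: "A \<in> space Q" for A
  proof -
    have A': "A \<in> space (mt_space m)" using A sets_eq_imp_space_eq[OF Q(2)] by simp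
    have cA: "(\<lambda>w. A) \<in> N \<rightarrow>\<^sub>M mt_space m" for N :: "(config \<times> config) measure"
      using A' by simp
    define h where "h w = f (queue_types m (mt_departures m A (snd w)) (fst w))" for w
    have h: "h \<in> borel_measurable (config_space \<Otimes>\<^sub>M config_space)"
      unfolding h_def[abs_def]
      by (intro measurable_compose[OF measurable_queue_types f] measurable_mt_departures cA measurable_fst measurable_snd)
    have k: "(\<lambda>w. f (mt_departures (Suc m) (queue_types m A (fst w)) (snd w))) \<in> borel_measurable Pr"
      by (intro measurable_compose[OF measurable_mt_departures f] measurable_queue_types cA fst_measurable snd_measurable)
    have "(\<integral>\<^sup>+S0. \<integral>\<^sup>+S. f (mt_departures (Suc m) (queue_types m A S0) S) \<partial>R \<partial>R0) =
      (\<integral>\<^sup>+w. f (mt_departures (Suc m) (queue_types m A (fst w)) (snd w)) \<partial>Pr)"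
      using P2.nn_integral_fst[OF k] by simp
    also have "\<dots> = (\<integral>\<^sup>+w. h (dual_pair w) \<partial>Pr)"
      using AE_tandem
      by (intro nn_integral_cong_AE, eventually_elim)
        (simp add: tandem.mt_departures_queue_types[OF _ A'] h_def dual_pair_def)
    also have "\<dots> = (\<integral>\<^sup>+w. h w \<partial>Pr)" by (rule nn_integral_dual_pair[OF h])
    \<comment> \<open>Fubini in the other order: the server of rate \<open>mu\<close> is integrated
      outside because it now comes first in the chain.\<close>
    also have "\<dots> = (\<integral>\<^sup>+S. \<integral>\<^sup>+d. h (d, S) \<partial>R0 \<partial>R)"
      using h by (intro nn_integral_snd[symmetric]) (simp cong: measurable_cong_sets add: sets_Pr case_prod_beta')
    finally show ?thesis by (simp add: h_def)
  qed
  have Q1: "sets (distr (Q \<Otimes>\<^sub>M R0) (mt_space (Suc m)) (types_map m)) = sets (mt_space (Suc m))"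
    "sets (distr (Q \<Otimes>\<^sub>M R) (mt_space m) (departures_map m)) = sets (mt_space m)" by simp_all
  have "(\<integral>\<^sup>+x. f x \<partial>distr (distr (Q \<Otimes>\<^sub>M R0) (mt_space (Suc m)) (types_map m) \<Otimes>\<^sub>M R) (mt_space (Suc m)) (departures_map (Suc m))) =
    (\<integral>\<^sup>+B. \<integral>\<^sup>+S. f (mt_departures (Suc m) B S) \<partial>R \<partial>distr (Q \<Otimes>\<^sub>M R0) (mt_space (Suc m)) (types_map m))"
    using nn_integral_distr_pair[OF P2.sigma_finite_measure_axioms Q1(1) sets_P(2) measurable_maps(1) f] by simp
  also have "\<dots> = (\<integral>\<^sup>+A. \<integral>\<^sup>+S0. \<integral>\<^sup>+S. f (mt_departures (Suc m) (queue_types m A S0) S) \<partial>R \<partial>R0 \<partial>Q)"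
    using nn_integral_distr_pair[OF P1.sigma_finite_measure_axioms Q(2) sets_P(1) measurable_maps(2) l1]
    by (simp add: queue_types_def)
  also have "\<dots> = (\<integral>\<^sup>+A. \<integral>\<^sup>+S. \<integral>\<^sup>+d. f (queue_types m (mt_departures m A S) d) \<partial>R0 \<partial>R \<partial>Q)"
    by (rule nn_integral_cong) (rule core)
  also have "\<dots> = (\<integral>\<^sup>+B. \<integral>\<^sup>+d. f (queue_types m B d) \<partial>R0 \<partial>distr (Q \<Otimes>\<^sub>M R) (mt_space m) (departures_map m))"
    using nn_integral_distr_pair[OF P2.sigma_finite_measure_axioms Q(2) sets_P(2) measurable_maps(1) l2] by simp
  also have "\<dots> = (\<integral>\<^sup>+x. f x \<partial>distr (distr (Q \<Otimes>\<^sub>M R) (mt_space m) (departures_map m) \<Otimes>\<^sub>M R0) (mt_space (Suc m)) (types_map m))"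
    using nn_integral_distr_pair[OF P1.sigma_finite_measure_axioms Q1(2) sets_P(1) measurable_maps(2) f]
    by (simp add: queue_types_def)
  finally show "(\<integral>\<^sup>+x. f x \<partial>distr (distr (Q \<Otimes>\<^sub>M R0) (mt_space (Suc m)) (types_map m) \<Otimes>\<^sub>M R) (mt_space (Suc m)) (departures_map (Suc m))) =
    (\<integral>\<^sup>+x. f x \<partial>distr (distr (Q \<Otimes>\<^sub>M R) (mt_space m) (departures_map m) \<Otimes>\<^sub>M R0) (mt_space (Suc m)) (types_map m))" .
qed simp

text \<open>After the reordering, the rule for one more class is applied with the same last server
  \<open>R0\<close> to the departure law of \<open>m\<close> classes, which the induction hypothesis
  covers. Since \<open>lam (Suc m)\<close> is positive, the smaller sum of rates is below
  \<open>mu\<close> too.\<close>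

lemma F_law_departures:
  assumes "F_law lam m Q" and R: "poisson_process_law mu R"
    and "\<And>i. i \<in> {1..m} \<Longrightarrow> lam i > 0" and "(\<Sum>i = 1..m. lam i) < mu"
  shows "F_law lam m (distr (Q \<Otimes>\<^sub>M R) (mt_space m) (departures_map m))"
  using assms(1,3,4)
proof (induction rule: F_law.induct)
  case (F_law_1 R1)
  then have "distr (distr R1 (mt_space 1) (\<lambda>x. \<lambda>i\<in>{1..1}. x) \<Otimes>\<^sub>M R) (mt_space 1) (departures_map 1) =
    distr R1 (mt_space 1) (\<lambda>x. \<lambda>i\<in>{1..1}. x)"
    by (intro F_law_1_departures[where lam=lam, OF F_law_1(1) R]) auto
  then show ?case using F_law.F_law_1[of lam, OF F_law_1(1)] by simp
next
  case (F_law_Suc m Q R0)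
  have pos: "0 < lam i" if "i \<in> {1..Suc m}" for i using F_law_Suc.prems(1) that by simp
  have Q: "prob_space Q" "sets Q = sets (mt_space m)" using F_law_space[OF F_law_Suc(1)] by auto
  have "(\<Sum>i = 1..Suc m. lam i) = (\<Sum>i = 1..m. lam i) + lam (Suc m)" by simp
  then have "(\<Sum>i = 1..m. lam i) < mu" using F_law_Suc.prems(2) pos[of "Suc m"] by simp
  then have IH: "F_law lam m (distr (Q \<Otimes>\<^sub>M R) (mt_space m) (departures_map m))"
    using pos by (intro F_law_Suc.IH) auto
  have "0 < (\<Sum>i = 1..Suc m. lam i)" using pos by (intro sum_pos) auto
  from distr_queue_types_departures[OF Q F_law_Suc(2) R this F_law_Suc.prems(2)]
  show ?case using F_law.F_law_Suc[OF IH F_law_Suc(2)] by simp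
qed

theorem theorem2p2:
  fixes m :: nat and lam :: "nat \<Rightarrow> real" and mu :: real
    and M :: "'w measure" and A :: "'w \<Rightarrow> mt_config" and S :: "'w \<Rightarrow> config"
  assumes "m \<ge> 2"
    and "\<And>i. i \<in> {1..m} \<Longrightarrow> lam i > 0"
    and "mu > (\<Sum>i = 1..m. lam i)"
    and "prob_space M"
    and "A \<in> measurable M (mt_space m)"
    and "F_law lam m (distr M (mt_space m) A)"
    and "S \<in> measurable M config_space"
    and "poisson_process_law mu (distr M config_space S)"
    and "prob_space.indep_set M
           {A -` E \<inter> space M | E. E \<in> sets (mt_space m)}
           {S -` E \<inter> space M | E. E \<in> sets config_space}"
  shows "(\<lambda>w. mt_departures m (A w) (S w)) \<in> measurable M (mt_space m) \<and>
         F_law lam m (distr M (mt_space m) (\<lambda>w. mt_departures m (A w) (S w)))"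
proof
  interpret prob_space M by fact
  show "(\<lambda>w. mt_departures m (A w) (S w)) \<in> measurable M (mt_space m)"
    by (rule measurable_mt_departures) fact+
  note [measurable] = assms(5,7)
  interpret DA: prob_space "distr M (mt_space m) A" by (rule prob_space_distr) fact
  interpret DS: prob_space "distr M config_space S" by (rule prob_space_distr) fact
  \<comment> \<open>Independence is given for the two families of preimages. Evaluated on
    rectangles, it identifies the joint law as the product on which the preceding results are
    stated.\<close>
  have joint: "distr M (mt_space m) A \<Otimes>\<^sub>M distr M config_space S =
    distr M (mt_space m \<Otimes>\<^sub>M config_space) (\<lambda>w. (A w, S w))"
  proof (rule pair_measure_eqI)
    fix E F assume "E \<in> sets (distr M (mt_space m) A)" "F \<in> sets (distr M config_space S)"
    then have EF: "E \<in> sets (mt_space m)" "F \<in> sets config_space" by simp_all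
    have "prob ((A -` E \<inter> space M) \<inter> (S -` F \<inter> space M)) = prob (A -` E \<inter> space M) * prob (S -` F \<inter> space M)"
      by (rule indep_setD[OF assms(9)]) (use EF in auto)
    moreover have "(\<lambda>w. (A w, S w)) -` (E \<times> F) \<inter> space M = (A -` E \<inter> space M) \<inter> (S -` F \<inter> space M)"
      by auto
    ultimately show "emeasure (distr M (mt_space m) A) E * emeasure (distr M config_space S) F =
        emeasure (distr M (mt_space m \<Otimes>\<^sub>M config_space) (\<lambda>w. (A w, S w))) (E \<times> F)"
      using EF assms(5,7) by (simp add: emeasure_distr measurable_Pair emeasure_eq_measure ennreal_mult)
  qed (simp_all add: DA.sigma_finite_measure_axioms DS.sigma_finite_measure_axioms
      cong: sets_pair_measure_cong)
  have "distr (distr M (mt_space m) A \<Otimes>\<^sub>M distr M config_space S) (mt_space m) (departures_map m) =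
    distr M (mt_space m) (\<lambda>w. mt_departures m (A w) (S w))"
    unfolding joint
    by (subst distr_distr[OF measurable_maps(1) measurable_Pair[OF assms(5,7)]]) (simp add: comp_def)
  then show "F_law lam m (distr M (mt_space m) (\<lambda>w. mt_departures m (A w) (S w)))"
    using F_law_departures[OF assms(6,8,2,3)] by simp
qed

end
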